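(* Let $(M,F)$ be a complete connected Berwaldian manifold of dimension $n\ge 2$. Let $\mathcal Z\subset M$ be the set of points $p\in M$ at which some flag curvature vanishes (i.e. there are linearly independent $v,w\in T_pM$ with $\mathcal K(v\wedge w)=0$), and suppose that $\mathcal Z$ is a nowhere dense subset of $M$ (in particular, this covers the case where $\mathcal Z$ has Lebesgue measure zero in charts). If $(M,F)$ admits a nontrivial Finslerian conformal circle-preserving transformation $\bar F=e^{\sigma}F$, then $F$ is Riemannian, i.e. the fundamental tensor $g_{ij}(x,y)$ of $F$ does not depend on $y$.
   Context: Finsler structure. $F:TM\to[0,\infty)$ is smooth on the slit tangent bundle $TM_0$, positively $1$-homogeneous in $y$, with positive definite fundamental tensor $g_{ij}(x,y)=\frac12\frac{\partial^2F^2}{\partial y^i\partial y^j}$; $F$ is not assumed reversible. Write $\langle\cdot,\cdot\rangle_y=g^y$ for the inner product $g_{ij}(x,y)$ and $\|\cdot\|_y$ for its norm; $\dot\partial_i=\partial/\partial y^i$; $C_{ijk}=\frac12\dot\partial_kg_{ij}$ is the Cartan tensor, with indices raised by $g$. Cartan connection. $G^s=\frac14g^{sl}(y^k\dot\partial_l\partial_k(F^2)-\partial_l(F^2))$, $G^i_j=\dot\partial_jG^i$, $\delta_i=\partial_i-G^r_i\dot\partial_r$, $\overset{\star}{\Gamma}{}^k_{ij}=\frac12g^{kl}(\delta_ig_{jl}+\delta_jg_{il}-\delta_lg_{ij})$. The Cartan connection on the pullback bundle $\pi^*TM\to TM_0$ is given by $\nabla_{\delta_j}\partial_i=\overset{\star}{\Gamma}{}^k_{ij}\partial_k$,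 $\nabla_{\dot\partial_j}\partial_i=C^k_{ij}\partial_k$. A geodesic is a curve $c$ with $\ddot x^k+2G^k(x,\dot x)=0$. "Complete" means geodesically complete. Berwaldian: the coefficients $\overset{\star}{\Gamma}{}^k_{ij}$ are independent of $y$. Flag curvature: with $\Omega(A,B)=[\nabla_A,\nabla_B]-\nabla_{[A,B]}$ and $\mathrm{Riem}^y(X,Y)=\Omega(X^h,Y^h)$ at $(x,y)$, where $X^h,Y^h$ are the horizontal lifts, the flag curvature of linearly independent $v,w\in T_xM$ with flag pole $v$ is $\mathcal K(v\wedge w)=\dfrac{\langle \mathrm{Riem}^v(v,w)w,v\rangle_v}{\|v\|_v^2\|w\|_v^2-\langle v,w\rangle_v^2}$. Geodesic circles: for a curve $c(s)$ with $F(c'(s))=1$ and canonical lift $\widetilde c=(c,c')$, put $c''=\nabla_{\widetilde c'}c'$, $c'''=\nabla_{\widetilde c'}c''$. The curve $c$ is a geodesic circle of $F$ if it has constant first geodesic curvature and vanishing second geodesic curvature, equivalently $c'''+\|c''\|_{c'}^2c'=0$. Conformal circle-preserving transformation: a conformal change $\bar F=e^{\sigma}F$ with $\sigma:M\to\mathbb R$ a smooth function (obtained by pulling back a Finsler metric by a diffeomorphism, which is suppressed from the notation), such that geodesic circles of $F$ are, after reparametrization, geodesic circles of $\bar F$. It is called trivial if it is a homothety, i.e. $\sigma$ is constant, and nontrivial otherwise. $\bar F$ is not assumed Berwaldian. *)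

theory Defs
  imports "HOL-Analysis.Analysis"
begin

section \<open>Smooth maps on open subsets of normed spaces\<close>

primrec Ck_on :: "nat \<Rightarrow> 'a::real_normed_vector set \<Rightarrow> ('a \<Rightarrow> 'b::real_normed_vector) \<Rightarrow> bool" where
  "Ck_on 0 S f \<longleftrightarrow> continuous_on S f"
| "Ck_on (Suc k) S f \<longleftrightarrow> (\<forall>x\<in>S. f differentiable (at x)) \<and>
     (\<forall>v. Ck_on k S (\<lambda>x. frechet_derivative f (at x) v))"

text \<open>Only used for open \<open>S\<close>; values of \<open>f\<close> outside \<open>S\<close> are then irrelevant.\<close>

definition smooth_on :: "'a::real_normed_vector set \<Rightarrow> ('a \<Rightarrow> 'b::real_normed_vector) \<Rightarrow> bool" where
  "smooth_on S f \<longleftrightarrow> (\<forall>k. Ck_on k S f)"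

section \<open>Smooth manifolds and their tangent spaces\<close>

text \<open>The manifold is the whole type \<open>'m\<close>. A chart is an open domain together with a coordinate
  map, whose values outside the domain are irrelevant.\<close>

type_synonym ('m, 'n) chart = "'m set \<times> ('m \<Rightarrow> real ^ 'n)"

definition chart_dom :: "('m, 'n::finite) chart \<Rightarrow> 'm set" where
  "chart_dom a = fst a"

definition chart_map :: "('m, 'n::finite) chart \<Rightarrow> 'm \<Rightarrow> real ^ 'n" where
  "chart_map a = snd a"

definition chart_img :: "('m, 'n::finite) chart \<Rightarrow> (real ^ 'n) set" where
  "chart_img a = chart_map a ` chart_dom a"

definition chart_inv :: "('m, 'n::finite) chart \<Rightarrow> real ^ 'n \<Rightarrow> 'm" where
  "chart_inv a = inv_into (chart_dom a) (chart_map a)"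

definition transition :: "('m, 'n::finite) chart \<Rightarrow> ('m, 'n) chart \<Rightarrow> real ^ 'n \<Rightarrow> real ^ 'n" where
  "transition a b = chart_map b \<circ> chart_inv a"

definition smooth_atlas :: "('m::topological_space, 'n::finite) chart set \<Rightarrow> bool" where
  "smooth_atlas \<A> \<longleftrightarrow>
     (\<Union>a\<in>\<A>. chart_dom a) = UNIV \<and>
     (\<forall>a\<in>\<A>. open (chart_dom a) \<and> open (chart_img a) \<and>
        homeomorphism (chart_dom a) (chart_img a) (chart_map a) (chart_inv a)) \<and>
     (\<forall>a\<in>\<A>. \<forall>b\<in>\<A>.
        smooth_on (chart_map a ` (chart_dom a \<inter> chart_dom b)) (transition a b))"

definition smooth_function ::
  "('m::topological_space, 'n::finite) chart set \<Rightarrow> ('m \<Rightarrow> real) \<Rightarrow> bool" where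
  "smooth_function \<A> f \<longleftrightarrow> (\<forall>a\<in>\<A>. smooth_on (chart_img a) (f \<circ> chart_inv a))"

text \<open>A tangent vector at \<open>p\<close> is the family of its components in all charts around \<open>p\<close>,
  which are related by the Jacobians of the transition maps. The value at everything that is not
  a chart around \<open>p\<close> is normalised to \<open>0\<close>, so that equality of families is equality of
  tangent vectors.\<close>

type_synonym ('m, 'n) tvec = "('m, 'n) chart \<Rightarrow> real ^ 'n"

definition tangent_space ::
  "('m::topological_space, 'n::finite) chart set \<Rightarrow> 'm \<Rightarrow> ('m, 'n) tvec set" where
  "tangent_space \<A> p = {v.
     (\<forall>a. \<not> (a \<in> \<A> \<and> p \<in> chart_dom a) \<longrightarrow> v a = 0) \<and>
     (\<forall>a\<in>\<A>. \<forall>b\<in>\<A>. p \<in> chart_dom a \<inter> chart_dom b \<longrightarrow>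
        v b = frechet_derivative (transition a b) (at (chart_map a p)) (v a))}"

text \<open>The tangent vector at \<open>p\<close> with components \<open>y\<close> in the chart \<open>a\<close>.\<close>

definition tvec_of ::
  "('m::topological_space, 'n::finite) chart set \<Rightarrow> ('m, 'n) chart \<Rightarrow> 'm \<Rightarrow> real ^ 'n \<Rightarrow> ('m, 'n) tvec" where
  "tvec_of \<A> a p y = (\<lambda>b. if b \<in> \<A> \<and> p \<in> chart_dom b
     then frechet_derivative (transition a b) (at (chart_map a p)) y else 0)"

definition lin_indep2 :: "('m, 'n::finite) tvec \<Rightarrow> ('m, 'n) tvec \<Rightarrow> bool" where
  "lin_indep2 v w \<longleftrightarrow>
     (\<forall>r s::real. (\<forall>a. r *\<^sub>R v a + s *\<^sub>R w a = 0) \<longrightarrow> r = 0 \<and> s = 0)"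

section \<open>Local Finsler geometry\<close>

text \<open>Here \<open>L\<close> is the coordinate expression of a Finsler structure in a chart and a point of the
  slit tangent bundle is \<open>z = (x, y)\<close>. Indices range over \<open>'n\<close>.\<close>

type_synonym 'n tpoint = "(real ^ 'n) \<times> (real ^ 'n)"

definition dx :: "'n::finite \<Rightarrow> ('n tpoint \<Rightarrow> real) \<Rightarrow> 'n tpoint \<Rightarrow> real" where
  "dx i f z = frechet_derivative f (at z) (axis i 1, 0)"

definition dy :: "'n::finite \<Rightarrow> ('n tpoint \<Rightarrow> real) \<Rightarrow> 'n tpoint \<Rightarrow> real" where
  "dy i f z = frechet_derivative f (at z) (0, axis i 1)"

definition fund_tensor :: "('n::finite tpoint \<Rightarrow> real) \<Rightarrow> 'n tpoint \<Rightarrow> real ^ 'n ^ 'n" where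
  "fund_tensor L z = (\<chi> i j. 1/2 * dy i (dy j (\<lambda>z. (L z)\<^sup>2)) z)"

definition fund_inv :: "('n::finite tpoint \<Rightarrow> real) \<Rightarrow> 'n tpoint \<Rightarrow> real ^ 'n ^ 'n" where
  "fund_inv L z = matrix_inv (fund_tensor L z)"

definition metric :: "('n::finite tpoint \<Rightarrow> real) \<Rightarrow> 'n tpoint \<Rightarrow> real ^ 'n \<Rightarrow> real ^ 'n \<Rightarrow> real" where
  "metric L z u v = (\<Sum>i\<in>UNIV. \<Sum>j\<in>UNIV. fund_tensor L z $ i $ j * u $ i * v $ j)"

text \<open>\<open>cartan L i j k\<close> is $C_{ijk}$ and \<open>cartan_up L k i j\<close> is $C^k_{ij}$.\<close>

definition cartan :: "('n::finite tpoint \<Rightarrow> real) \<Rightarrow> 'n \<Rightarrow> 'n \<Rightarrow> 'n \<Rightarrow> 'n tpoint \<Rightarrow> real" where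
  "cartan L i j k z = 1/2 * dy k (\<lambda>z. fund_tensor L z $ i $ j) z"

definition cartan_up :: "('n::finite tpoint \<Rightarrow> real) \<Rightarrow> 'n \<Rightarrow> 'n \<Rightarrow> 'n \<Rightarrow> 'n tpoint \<Rightarrow> real" where
  "cartan_up L k i j z = (\<Sum>l\<in>UNIV. fund_inv L z $ k $ l * cartan L i j l z)"

text \<open>\<open>spray L s\<close> is $G^s$ and \<open>nonlin L i j\<close> is $G^i_j$.\<close>

definition spray :: "('n::finite tpoint \<Rightarrow> real) \<Rightarrow> 'n \<Rightarrow> 'n tpoint \<Rightarrow> real" where
  "spray L s z = 1/4 * (\<Sum>l\<in>UNIV. fund_inv L z $ s $ l *
     ((\<Sum>k\<in>UNIV. snd z $ k * dy l (dx k (\<lambda>z. (L z)\<^sup>2)) z) - dx l (\<lambda>z. (L z)\<^sup>2) z))"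

definition nonlin :: "('n::finite tpoint \<Rightarrow> real) \<Rightarrow> 'n \<Rightarrow> 'n \<Rightarrow> 'n tpoint \<Rightarrow> real" where
  "nonlin L i j z = dy j (spray L i) z"

definition delta :: "('n::finite tpoint \<Rightarrow> real) \<Rightarrow> 'n \<Rightarrow> ('n tpoint \<Rightarrow> real) \<Rightarrow> 'n tpoint \<Rightarrow> real" where
  "delta L i f z = dx i f z - (\<Sum>r\<in>UNIV. nonlin L r i z * dy r f z)"

text \<open>\<open>Gam L k i j\<close> is the horizontal coefficient with upper index \<open>k\<close> and lower indices
  \<open>i\<close>, \<open>j\<close>.\<close>

definition Gam :: "('n::finite tpoint \<Rightarrow> real) \<Rightarrow> 'n \<Rightarrow> 'n \<Rightarrow> 'n \<Rightarrow> 'n tpoint \<Rightarrow> real" where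
  "Gam L k i j z = 1/2 * (\<Sum>l\<in>UNIV. fund_inv L z $ k $ l *
     (delta L i (\<lambda>z. fund_tensor L z $ j $ l) z
      + delta L j (\<lambda>z. fund_tensor L z $ i $ l) z
      - delta L l (\<lambda>z. fund_tensor L z $ i $ j) z))"

text \<open>Tangent vectors \<open>A\<close> of the slit tangent bundle are given by their components with respect to
  $(\partial_i, \dot\partial_i)$. In the adapted frame $(\delta_i, \dot\partial_i)$ the horizontal
  components are unchanged and the vertical ones are given by \<open>vert_part\<close>.\<close>

definition vert_part :: "('n::finite tpoint \<Rightarrow> real) \<Rightarrow> 'n tpoint \<Rightarrow> 'n tpoint \<Rightarrow> real ^ 'n" where
  "vert_part L z A = (\<chi> j. snd A $ j + (\<Sum>l\<in>UNIV. nonlin L j l z * fst A $ l))"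

definition hlift :: "('n::finite tpoint \<Rightarrow> real) \<Rightarrow> real ^ 'n \<Rightarrow> 'n tpoint \<Rightarrow> 'n tpoint" where
  "hlift L u z = (u, - (\<chi> r. \<Sum>j\<in>UNIV. nonlin L r j z * u $ j))"

text \<open>The zeroth-order part of the Cartan connection of the pullback bundle:
  \<open>conn_form L z A u\<close> is the derivative in direction \<open>A\<close> of the section with constant
  components \<open>u\<close>.\<close>

definition conn_form ::
  "('n::finite tpoint \<Rightarrow> real) \<Rightarrow> 'n tpoint \<Rightarrow> 'n tpoint \<Rightarrow> real ^ 'n \<Rightarrow> real ^ 'n" where
  "conn_form L z A u = (\<chi> k. \<Sum>i\<in>UNIV. \<Sum>j\<in>UNIV.
     u $ i * (fst A $ j * Gam L k i j z + vert_part L z A $ j * cartan_up L k i j z))"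

definition conn :: "('n::finite tpoint \<Rightarrow> real) \<Rightarrow> ('n tpoint \<Rightarrow> 'n tpoint)
    \<Rightarrow> ('n tpoint \<Rightarrow> real ^ 'n) \<Rightarrow> 'n tpoint \<Rightarrow> real ^ 'n" where
  "conn L X \<xi> z = frechet_derivative \<xi> (at z) (X z) + conn_form L z (X z) (\<xi> z)"

definition bracket :: "('n::finite tpoint \<Rightarrow> 'n tpoint) \<Rightarrow> ('n tpoint \<Rightarrow> 'n tpoint)
    \<Rightarrow> 'n tpoint \<Rightarrow> 'n tpoint" where
  "bracket X Y z = frechet_derivative Y (at z) (X z) - frechet_derivative X (at z) (Y z)"

definition curvature :: "('n::finite tpoint \<Rightarrow> real) \<Rightarrow> ('n tpoint \<Rightarrow> 'n tpoint)
    \<Rightarrow> ('n tpoint \<Rightarrow> 'n tpoint) \<Rightarrow> ('n tpoint \<Rightarrow> real ^ 'n) \<Rightarrow> 'n tpoint \<Rightarrow> real ^ 'n" where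
  "curvature L X Y \<xi> z =
     conn L X (conn L Y \<xi>) z - conn L Y (conn L X \<xi>) z - conn L (bracket X Y) \<xi> z"

text \<open>By tensoriality the vectors may be extended with constant components.\<close>

definition riem :: "('n::finite tpoint \<Rightarrow> real) \<Rightarrow> 'n tpoint
    \<Rightarrow> real ^ 'n \<Rightarrow> real ^ 'n \<Rightarrow> real ^ 'n \<Rightarrow> real ^ 'n" where
  "riem L z u v w = curvature L (hlift L u) (hlift L v) (\<lambda>_. w) z"

definition flag_curv_loc ::
  "('n::finite tpoint \<Rightarrow> real) \<Rightarrow> real ^ 'n \<Rightarrow> real ^ 'n \<Rightarrow> real ^ 'n \<Rightarrow> real" where
  "flag_curv_loc L x v w =
     metric L (x, v) (riem L (x, v) v w w) v /
     (metric L (x, v) v v * metric L (x, v) w w - (metric L (x, v) v w)\<^sup>2)"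

section \<open>Finsler manifolds\<close>

type_synonym ('m, 'n) finsler_fun = "'m \<Rightarrow> ('m, 'n) tvec \<Rightarrow> real"

definition loc_rep :: "('m::topological_space, 'n::finite) chart set \<Rightarrow> ('m, 'n) finsler_fun
    \<Rightarrow> ('m, 'n) chart \<Rightarrow> 'n tpoint \<Rightarrow> real" where
  "loc_rep \<A> F a z = F (chart_inv a (fst z)) (tvec_of \<A> a (chart_inv a (fst z)) (snd z))"

definition slit :: "('m, 'n::finite) chart \<Rightarrow> 'n tpoint set" where
  "slit a = chart_img a \<times> (- {0})"

definition finsler_structure ::
  "('m::topological_space, 'n::finite) chart set \<Rightarrow> ('m, 'n) finsler_fun \<Rightarrow> bool" where
  "finsler_structure \<A> F \<longleftrightarrow>
     (\<forall>p. \<forall>v\<in>tangent_space \<A> p. F p v \<ge> 0) \<and>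
     (\<forall>p. \<forall>v\<in>tangent_space \<A> p. \<forall>r>0. F p (\<lambda>a. r *\<^sub>R v a) = r * F p v) \<and>
     (\<forall>a\<in>\<A>. smooth_on (slit a) (loc_rep \<A> F a)) \<and>
     (\<forall>a\<in>\<A>. \<forall>z\<in>slit a. \<forall>u. u \<noteq> 0 \<longrightarrow> metric (loc_rep \<A> F a) z u u > 0)"

definition berwaldian ::
  "('m::topological_space, 'n::finite) chart set \<Rightarrow> ('m, 'n) finsler_fun \<Rightarrow> bool" where
  "berwaldian \<A> F \<longleftrightarrow> (\<forall>a\<in>\<A>. \<forall>x\<in>chart_img a. \<forall>y y'. y \<noteq> 0 \<longrightarrow> y' \<noteq> 0 \<longrightarrow>
     (\<forall>k i j. Gam (loc_rep \<A> F a) k i j (x, y) = Gam (loc_rep \<A> F a) k i j (x, y')))"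

definition riemannian ::
  "('m::topological_space, 'n::finite) chart set \<Rightarrow> ('m, 'n) finsler_fun \<Rightarrow> bool" where
  "riemannian \<A> F \<longleftrightarrow> (\<forall>a\<in>\<A>. \<forall>x\<in>chart_img a. \<forall>y y'. y \<noteq> 0 \<longrightarrow> y' \<noteq> 0 \<longrightarrow>
     fund_tensor (loc_rep \<A> F a) (x, y) = fund_tensor (loc_rep \<A> F a) (x, y'))"

text \<open>The flag curvature does not depend on the chart around \<open>p\<close> used to compute it.\<close>

definition flag_curvature :: "('m::topological_space, 'n::finite) chart set
    \<Rightarrow> ('m, 'n) finsler_fun \<Rightarrow> 'm \<Rightarrow> ('m, 'n) tvec \<Rightarrow> ('m, 'n) tvec \<Rightarrow> real" where
  "flag_curvature \<A> F p v w =
     (let a = (SOME a. a \<in> \<A> \<and> p \<in> chart_dom a)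
      in flag_curv_loc (loc_rep \<A> F a) (chart_map a p) (v a) (w a))"

definition zero_flag_set ::
  "('m::topological_space, 'n::finite) chart set \<Rightarrow> ('m, 'n) finsler_fun \<Rightarrow> 'm set" where
  "zero_flag_set \<A> F = {p. \<exists>v\<in>tangent_space \<A> p. \<exists>w\<in>tangent_space \<A> p.
     lin_indep2 v w \<and> flag_curvature \<A> F p v w = 0}"

definition nowhere_dense :: "'a::topological_space set \<Rightarrow> bool" where
  "nowhere_dense S \<longleftrightarrow> interior (closure S) = {}"

section \<open>Curves, geodesics and geodesic circles\<close>

definition open_interval :: "real set \<Rightarrow> bool" where
  "open_interval I \<longleftrightarrow> open I \<and> is_interval I \<and> I \<noteq> {}"

definition smooth_curve :: "('m::topological_space, 'n::finite) chart set \<Rightarrow> real set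
    \<Rightarrow> (real \<Rightarrow> 'm) \<Rightarrow> bool" where
  "smooth_curve \<A> I c \<longleftrightarrow> continuous_on I c \<and>
     (\<forall>a\<in>\<A>. smooth_on {t \<in> I. c t \<in> chart_dom a} (chart_map a \<circ> c))"

definition chart_vel :: "('m, 'n::finite) chart \<Rightarrow> (real \<Rightarrow> 'm) \<Rightarrow> real \<Rightarrow> real ^ 'n" where
  "chart_vel a c t = vector_derivative (chart_map a \<circ> c) (at t)"

definition velocity :: "('m::topological_space, 'n::finite) chart set
    \<Rightarrow> (real \<Rightarrow> 'm) \<Rightarrow> real \<Rightarrow> ('m, 'n) tvec" where
  "velocity \<A> c t = (\<lambda>a. if a \<in> \<A> \<and> c t \<in> chart_dom a then chart_vel a c t else 0)"

definition chart_lift :: "('m, 'n::finite) chart \<Rightarrow> (real \<Rightarrow> 'm) \<Rightarrow> real \<Rightarrow> 'n tpoint" where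
  "chart_lift a c t = (chart_map a (c t), chart_vel a c t)"

text \<open>Geodesics are required to be regular because the spray coefficients only make sense on the
  slit tangent bundle; this excludes just the constant curves, which are defined for all times
  anyway.\<close>

definition geodesic :: "('m::topological_space, 'n::finite) chart set
    \<Rightarrow> ('m, 'n) finsler_fun \<Rightarrow> real set \<Rightarrow> (real \<Rightarrow> 'm) \<Rightarrow> bool" where
  "geodesic \<A> F I c \<longleftrightarrow> smooth_curve \<A> I c \<and>
     (\<forall>a\<in>\<A>. \<forall>t\<in>I. c t \<in> chart_dom a \<longrightarrow> chart_vel a c t \<noteq> 0 \<and>
        (\<forall>k. vector_derivative (chart_vel a c) (at t) $ k
              + 2 * spray (loc_rep \<A> F a) k (chart_lift a c t) = 0))"

definition geodesically_complete ::
  "('m::topological_space, 'n::finite) chart set \<Rightarrow> ('m, 'n) finsler_fun \<Rightarrow> bool" where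
  "geodesically_complete \<A> F \<longleftrightarrow>
     (\<forall>I c. open_interval I \<and> geodesic \<A> F I c \<longrightarrow>
        (\<exists>c'. geodesic \<A> F UNIV c' \<and> (\<forall>t\<in>I. c' t = c t)))"

text \<open>The Cartan derivative, along the canonical lift of \<open>c\<close>, of a section \<open>\<xi>\<close> given by its
  components in the chart \<open>a\<close>.\<close>

definition cov_deriv :: "('n::finite tpoint \<Rightarrow> real) \<Rightarrow> ('m, 'n) chart \<Rightarrow> (real \<Rightarrow> 'm)
    \<Rightarrow> (real \<Rightarrow> real ^ 'n) \<Rightarrow> real \<Rightarrow> real ^ 'n" where
  "cov_deriv L a c \<xi> t = vector_derivative \<xi> (at t)
     + conn_form L (chart_lift a c t) (vector_derivative (chart_lift a c) (at t)) (\<xi> t)"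

definition geodesic_circle :: "('m::topological_space, 'n::finite) chart set
    \<Rightarrow> ('m, 'n) finsler_fun \<Rightarrow> real set \<Rightarrow> (real \<Rightarrow> 'm) \<Rightarrow> bool" where
  "geodesic_circle \<A> F I c \<longleftrightarrow> smooth_curve \<A> I c \<and>
     (\<forall>s\<in>I. F (c s) (velocity \<A> c s) = 1) \<and>
     (\<forall>a\<in>\<A>. \<forall>s\<in>I. c s \<in> chart_dom a \<longrightarrow>
        (let L = loc_rep \<A> F a;
             c1 = chart_vel a c;
             c2 = cov_deriv L a c c1;
             c3 = cov_deriv L a c c2
         in c3 s + metric L (chart_lift a c s) (c2 s) (c2 s) *\<^sub>R c1 s = 0))"

section \<open>Conformal circle-preserving transformations\<close>

definition conformal_change :: "('m \<Rightarrow> real) \<Rightarrow> ('m, 'n::finite) finsler_fun \<Rightarrow> ('m, 'n) finsler_fun" where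
  "conformal_change \<sigma> F = (\<lambda>p v. exp (\<sigma> p) * F p v)"

text \<open>Reparametrizations preserve the orientation, as the metrics need not be reversible.\<close>

definition conformal_circle_preserving :: "('m::topological_space, 'n::finite) chart set
    \<Rightarrow> ('m, 'n) finsler_fun \<Rightarrow> ('m \<Rightarrow> real) \<Rightarrow> bool" where
  "conformal_circle_preserving \<A> F \<sigma> \<longleftrightarrow> smooth_function \<A> \<sigma> \<and>
     (\<forall>I c. open_interval I \<and> geodesic_circle \<A> F I c \<longrightarrow>
        (\<exists>J h. open_interval J \<and> smooth_on J h \<and> bij_betw h J I \<and> (\<forall>s\<in>J. deriv h s > 0) \<and>
           geodesic_circle \<A> (conformal_change \<sigma> F) J (c \<circ> h)))"

definition nontrivial :: "('m \<Rightarrow> real) \<Rightarrow> bool" where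
  "nontrivial \<sigma> \<longleftrightarrow> \<not> (\<exists>k. \<forall>p. \<sigma> p = k)"

end

theory Submission
  imports Defs
begin

text \<open>
  Why the theorem is true. Let \<open>ds\<close> be the differential of \<open>\<sigma>\<close> and \<open>S\<close> its gradient with respect to the
  fundamental tensor \<open>g\<close>, so that \<open>S\<close> depends on the line element \<open>(x, y)\<close>. Write the equation of geodesic
  circles of the changed metric along a reparametrized circle of \<open>F\<close> with direction \<open>y\<close> and
  acceleration \<open>A\<close>. Almost everything cancels, and what remains is that
  \<open>\<nabla>_y S - C(A, S) - ds(y) S\<close> is a multiple of \<open>y\<close>, where \<open>C\<close> is the Cartan tensor
  (\<open>circle_preserved_condition\<close>). A circle exists for every unit vector \<open>y\<close> and every \<open>A\<close> orthogonal to it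
  (\<open>circle_exists\<close>), so \<open>A\<close> is a free parameter. Therefore \<open>C(A, S) = 0\<close> (\<open>cartan_S\<close>), which
  says that \<open>S\<close> does not depend on \<open>y\<close>: it is a vector field \<open>P\<close> on \<open>M\<close>.

  For a Berwald structure \<open>\<nabla>\<close> is an affine connection on \<open>M\<close>. So \<open>u \<mapsto> \<nabla>_u P - ds(u) P\<close> is an
  endomorphism of the tangent space for which every vector is an eigenvector, hence equal to \<open>k id\<close> with a
  number \<open>k\<close> that depends only on the point (\<open>hess_eigen\<close>). Lowering the index gives
  \<open>k g(u, w) = (\<nabla>_u ds)(w) - ds(u) ds(w)\<close>, and the right-hand side does not contain \<open>y\<close>
  (\<open>g_hess\<close>). Where \<open>k\<close> is not \<open>0\<close>, the fundamental tensor is therefore independent of \<open>y\<close>.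

  If this is so at one point, it is so everywhere, because the parallel transport of \<open>\<nabla>\<close> is linear and
  preserves \<open>F\<close> (\<open>quadratic_near\<close>) and \<open>M\<close> is connected. Otherwise \<open>k = 0\<close> everywhere. Then
  \<open>exp (-\<sigma>) P\<close> is parallel, the curvature annihilates it, and every flag spanned by \<open>P\<close> and another
  vector has curvature \<open>0\<close> (\<open>zero_flag\<close>). As \<open>\<sigma>\<close> is not constant, \<open>P\<close> is nonzero on a nonempty open set,
  and this set consists of points with a vanishing flag curvature: a contradiction.

  Two reductions make the computations short. Along the lift of a curve the Cartan connection only
  involves the vertical derivative \<open>N\<close> of the spray and the Cartan tensor applied to the acceleration
  (\<open>conn_form_lift\<close>). And to obtain a geodesic circle of the manifold from a solution of a differential
  equation in one chart, one needs the transformation laws of spray, \<open>N\<close> and Cartan tensor only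
  (\<open>circle_eq_change\<close>).
\<close>

section \<open>Smooth maps\<close>

text \<open>With the direction fixed, iterated derivatives are again functions on the same space, and the
  recursion defining \<open>Ck_on\<close> becomes a statement about them.\<close>

definition ddir :: "'a::real_normed_vector \<Rightarrow> ('a \<Rightarrow> 'b::real_normed_vector) \<Rightarrow> 'a \<Rightarrow> 'b" where
  "ddir v f x = frechet_derivative f (at x) v"

lemma ddir_eq: "(f has_derivative f') (at x) \<Longrightarrow> ddir v f x = f' v"
  unfolding ddir_def by (metis frechet_derivative_at)

lemma has_derivative_ddir: "f differentiable (at x) \<Longrightarrow> (f has_derivative (\<lambda>v. ddir v f x)) (at x)"
  unfolding ddir_def by (simp add: frechet_derivative_works[symmetric])

lemma linear_ddir: "f differentiable (at x) \<Longrightarrow> linear (\<lambda>v. ddir v f x)"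
  using has_derivative_ddir has_derivative_linear by blast

lemma ddir_cong:
  assumes "open S" "x \<in> S" "\<And>x. x \<in> S \<Longrightarrow> f x = g x"
  shows "ddir v f x = ddir v g x"
proof -
  have "(f has_derivative D) (at x) \<longleftrightarrow> (g has_derivative D) (at x)" for D
    using assms has_derivative_transform_within_open[of f D x UNIV S g]
      has_derivative_transform_within_open[of g D x UNIV S f] by auto
  then show ?thesis unfolding ddir_def frechet_derivative_def by simp
qed

lemma differentiable_cong_open:
  assumes "open S" "x \<in> S" "\<And>x. x \<in> S \<Longrightarrow> f x = g x" "f differentiable (at x)"
  shows "g differentiable (at x)"
  using assms has_derivative_transform_within_open[of f _ x UNIV S g]
  unfolding differentiable_def by blast

lemma Ck_on_Suc_ddir: "Ck_on (Suc k) S f \<longleftrightarrow>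
    (\<forall>x\<in>S. f differentiable (at x)) \<and> (\<forall>v. Ck_on k S (ddir v f))"
  by (simp add: ddir_def[abs_def])

lemma Ck_on_cong:
  assumes "open S" "\<And>x. x \<in> S \<Longrightarrow> f x = g x" "Ck_on k S f"
  shows "Ck_on k S g"
  using assms(2,3)
proof (induction k arbitrary: f g)
  case 0
  then show ?case using continuous_on_cong[of S S f g] by simp
next
  case (Suc k)
  have "Ck_on k S (ddir v g)" for v
    using Suc.IH[of "ddir v f" "ddir v g"] Suc.prems ddir_cong[OF assms(1), of _ f g v]
    unfolding Ck_on_Suc_ddir by blast
  moreover have "g differentiable (at x)" if "x \<in> S" for x
    using differentiable_cong_open[OF assms(1) that] Suc.prems that by auto
  ultimately show ?case unfolding Ck_on_Suc_ddir by blast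
qed

lemma Ck_on_subset: "Ck_on k S f \<Longrightarrow> T \<subseteq> S \<Longrightarrow> Ck_on k T f"
  by (induction k arbitrary: f) (auto intro: continuous_on_subset)

lemma Ck_on_SucD: "Ck_on (Suc k) S f \<Longrightarrow> Ck_on k S f"
proof (induction k arbitrary: f)
  case 0
  then show ?case
    by (simp add: continuous_at_imp_continuous_on differentiable_imp_continuous_within)
next
  case (Suc k)
  then show ?case by (metis Ck_on_Suc_ddir)
qed

lemma Ck_onI:
  assumes "open S" "\<And>x. x \<in> S \<Longrightarrow> (f has_derivative f' x) (at x)"
    and "\<And>v. Ck_on k S (\<lambda>x. f' x v)"
  shows "Ck_on (Suc k) S f"
  unfolding Ck_on_Suc_ddir
proof (intro conjI ballI allI)
  fix x assume "x \<in> S" then show "f differentiable (at x)"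
    using assms(2) unfolding differentiable_def by blast
next
  fix v show "Ck_on k S (ddir v f)"
    by (rule Ck_on_cong[OF assms(1) _ assms(3)[of v]]) (metis assms(2) ddir_eq)
qed

lemma Ck_on_has_derivative:
  "Ck_on (Suc k) S f \<Longrightarrow> x \<in> S \<Longrightarrow> (f has_derivative (\<lambda>v. ddir v f x)) (at x)"
  using has_derivative_ddir by auto

lemma Ck_on_const: "open S \<Longrightarrow> Ck_on k S (\<lambda>x. c)"
proof (induction k arbitrary: c)
  case (Suc k)
  then show ?case by (intro Ck_onI[where f'="\<lambda>_ _. 0"]) auto
qed simp

lemma Ck_on_bounded_linear:
  assumes "bounded_linear A" "open S" "Ck_on k S f"
  shows "Ck_on k S (\<lambda>x. A (f x))"
  using assms(3)
proof (induction k arbitrary: f)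
  case 0
  then show ?case using assms(1) bounded_linear.continuous_on by auto
next
  case (Suc k)
  show ?case
  proof (rule Ck_onI[OF assms(2)])
    show "((\<lambda>x. A (f x)) has_derivative (\<lambda>v. A (ddir v f x))) (at x)" if "x \<in> S" for x
      using bounded_linear.has_derivative[OF assms(1)] Ck_on_has_derivative[OF Suc.prems that] by blast
    show "Ck_on k S (\<lambda>x. A (ddir v f x))" for v
      using Suc by (metis Ck_on_Suc_ddir)
  qed
qed

lemma Ck_on_add:
  assumes "open S" "Ck_on k S f" "Ck_on k S g"
  shows "Ck_on k S (\<lambda>x. f x + g x)"
  using assms(2,3)
proof (induction k arbitrary: f g)
  case 0
  then show ?case by (simp add: continuous_on_add)
next
  case (Suc k)
  show ?case
  proof (rule Ck_onI[OF assms(1)])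
    show "((\<lambda>x. f x + g x) has_derivative (\<lambda>v. ddir v f x + ddir v g x)) (at x)" if "x \<in> S" for x
      by (intro has_derivative_add Ck_on_has_derivative[OF _ that, of k] Suc.prems)
    show "Ck_on k S (\<lambda>x. ddir v f x + ddir v g x)" for v
      using Suc by (metis Ck_on_Suc_ddir)
  qed
qed

lemma Ck_on_bounded_bilinear:
  assumes "bounded_bilinear B" "open S" "Ck_on k S f" "Ck_on k S g"
  shows "Ck_on k S (\<lambda>x. B (f x) (g x))"
  using assms(3,4)
proof (induction k arbitrary: f g)
  case 0
  then show ?case using bounded_bilinear.continuous_on[OF assms(1)] by auto
next
  case (Suc k)
  show ?case
  proof (rule Ck_onI[OF assms(2)])
    show "((\<lambda>x. B (f x) (g x)) has_derivative (\<lambda>v. B (f x) (ddir v g x) + B (ddir v f x) (g x))) (at x)"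
      if "x \<in> S" for x
      by (intro bounded_bilinear.FDERIV[OF assms(1)] Ck_on_has_derivative[OF _ that, of k] Suc.prems)
    show "Ck_on k S (\<lambda>x. B (f x) (ddir v g x) + B (ddir v f x) (g x))" for v
      using Suc.prems unfolding Ck_on_Suc_ddir
      by (intro Ck_on_add assms(2) Suc.IH Ck_on_SucD[OF Suc.prems(1)] Ck_on_SucD[OF Suc.prems(2)]) blast+
  qed
qed

lemma Ck_on_sum:
  assumes "open S" "\<And>i. i \<in> I \<Longrightarrow> Ck_on k S (f i)"
  shows "Ck_on k S (\<lambda>x. \<Sum>i\<in>I. f i x)"
  using assms(2)
  by (induction I rule: infinite_finite_induct)
    (auto intro!: Ck_on_const Ck_on_add assms(1) simp del: Ck_on.simps)

lemma ddir_Basis_sum: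
  fixes f :: "'a::euclidean_space \<Rightarrow> 'b::real_normed_vector"
  assumes "f differentiable (at x)"
  shows "ddir w f x = (\<Sum>b\<in>Basis. (w \<bullet> b) *\<^sub>R ddir b f x)"
proof -
  have l: "linear (\<lambda>v. ddir v f x)" using linear_ddir assms by blast
  have "ddir w f x = ddir (\<Sum>b\<in>Basis. (w \<bullet> b) *\<^sub>R b) f x"
    by (simp add: euclidean_representation)
  also have "\<dots> = (\<Sum>b\<in>Basis. ddir ((w \<bullet> b) *\<^sub>R b) f x)"
    using linear_sum[OF l, of "\<lambda>b. (w \<bullet> b) *\<^sub>R b" Basis] by simp
  also have "\<dots> = (\<Sum>b\<in>Basis. (w \<bullet> b) *\<^sub>R ddir b f x)"
    by (intro sum.cong refl linear_scale[OF l])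
  finally show ?thesis .
qed

text \<open>The direction in which the outer map is differentiated moves with the point. Expanding it in a
  basis turns the derivative into a sum of products with fixed directions, to which the induction
  hypothesis applies.\<close>

lemma Ck_on_compose:
  fixes g :: "'a::real_normed_vector \<Rightarrow> 'b::euclidean_space"
  assumes "open S" "open T" "g ` S \<subseteq> T" "Ck_on k S g" "Ck_on k T f"
  shows "Ck_on k S (\<lambda>x. f (g x))"
  using assms(4,5)
proof (induction k arbitrary: f)
  case 0
  then show ?case using assms(3) continuous_on_compose2 by auto
next
  case (Suc k)
  show ?case
  proof (rule Ck_onI[OF assms(1)])
    fix x assume x: "x \<in> S"
    have "f differentiable (at (g x))" using Suc.prems(2) x assms(3) by auto
    note eq = ddir_Basis_sum[OF this, of "ddir _ g x"]
    have "((\<lambda>x. f (g x)) has_derivative (\<lambda>v. ddir (ddir v g x) f (g x))) (at x)"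
      using has_derivative_compose[OF Ck_on_has_derivative[OF Suc.prems(1) x], of f]
        Ck_on_has_derivative[OF Suc.prems(2)] assms(3) x by blast
    then show "((\<lambda>x. f (g x)) has_derivative
        (\<lambda>v. \<Sum>b\<in>Basis. (ddir v g x \<bullet> b) *\<^sub>R ddir b f (g x))) (at x)"
      by (rule has_derivative_eq_rhs) (rule ext, rule eq)
  next
    fix v
    have "Ck_on k T (ddir b f)" for b using Suc.prems(2) unfolding Ck_on_Suc_ddir by blast
    then have "Ck_on k S (\<lambda>x. ddir b f (g x))" for b
      by (intro Suc.IH Ck_on_SucD[OF Suc.prems(1)])
    moreover have "Ck_on k S (ddir v g)"
      using Suc.prems(1) unfolding Ck_on_Suc_ddir by blast
    ultimately show "Ck_on k S (\<lambda>x. \<Sum>b\<in>Basis. (ddir v g x \<bullet> b) *\<^sub>R ddir b f (g x))"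
      by (intro Ck_on_sum Ck_on_bounded_bilinear[OF bounded_bilinear_scaleR]
          Ck_on_bounded_linear[OF bounded_linear_inner_left] assms(1))
  qed
qed

lemma Ck_on_inverse:
  fixes f :: "'a::real_normed_vector \<Rightarrow> real"
  assumes "open S" "\<And>x. x \<in> S \<Longrightarrow> f x \<noteq> 0" "Ck_on k S f"
  shows "Ck_on k S (\<lambda>x. inverse (f x))"
  using assms(3)
proof (induction k)
  case 0
  then show ?case using assms(2) by (simp add: continuous_on_inverse)
next
  case (Suc k)
  show ?case
  proof (rule Ck_onI[OF assms(1)])
    show "((\<lambda>x. inverse (f x)) has_derivative
        (\<lambda>v. - (inverse (f x) * ddir v f x * inverse (f x)))) (at x)" if "x \<in> S" for x
      by (rule Deriv.has_derivative_inverse[OF assms(2)[OF that] Ck_on_has_derivative[OF Suc.prems that]])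
    show "Ck_on k S (\<lambda>x. - (inverse (f x) * ddir v f x * inverse (f x)))" for v
    proof -
      have 1: "Ck_on k S (\<lambda>x. inverse (f x))" by (rule Suc.IH[OF Ck_on_SucD[OF Suc.prems]])
      have 2: "Ck_on k S (ddir v f)" using Suc.prems unfolding Ck_on_Suc_ddir by blast
      have 3: "bounded_linear (uminus :: real \<Rightarrow> real)"
        by (simp add: bounded_linear_minus bounded_linear_ident)
      show ?thesis
        by (intro Ck_on_bounded_linear[OF 3] Ck_on_bounded_bilinear[OF bounded_bilinear_mult] assms(1) 1 2)
    qed
  qed
qed

lemma Ck_on_exp:
  fixes f :: "'a::real_normed_vector \<Rightarrow> real"
  assumes "open S" "Ck_on k S f"
  shows "Ck_on k S (\<lambda>x. exp (f x))"
  using assms(2)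
proof (induction k)
  case 0
  then show ?case by (simp add: continuous_on_exp)
next
  case (Suc k)
  show ?case
  proof (rule Ck_onI[OF assms(1)])
    show "((\<lambda>x. exp (f x)) has_derivative (\<lambda>v. ddir v f x * exp (f x))) (at x)" if "x \<in> S" for x
      using has_derivative_exp[OF Ck_on_has_derivative[OF Suc.prems that]] by simp
    show "Ck_on k S (\<lambda>x. ddir v f x * exp (f x))" for v
      using Suc.prems unfolding Ck_on_Suc_ddir
      by (intro Ck_on_bounded_bilinear[OF bounded_bilinear_mult] assms(1) Suc.IH Ck_on_SucD[OF Suc.prems]) blast+
  qed
qed

named_theorems smooth_intros

lemma smooth_on_cong:
  "open S \<Longrightarrow> (\<And>x. x \<in> S \<Longrightarrow> f x = g x) \<Longrightarrow> smooth_on S f \<Longrightarrow> smooth_on S g"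
  unfolding smooth_on_def using Ck_on_cong by blast

lemma smooth_on_subset: "smooth_on S f \<Longrightarrow> T \<subseteq> S \<Longrightarrow> smooth_on T f"
  unfolding smooth_on_def using Ck_on_subset by blast

lemma smooth_on_differentiable: "smooth_on S f \<Longrightarrow> x \<in> S \<Longrightarrow> f differentiable (at x)"
  unfolding smooth_on_def by (meson Ck_on.simps(2))

lemma smooth_on_has_derivative:
  "smooth_on S f \<Longrightarrow> x \<in> S \<Longrightarrow> (f has_derivative (\<lambda>v. ddir v f x)) (at x)"
  by (simp add: has_derivative_ddir smooth_on_differentiable)

lemma smooth_on_continuous: "smooth_on S f \<Longrightarrow> continuous_on S f"
  unfolding smooth_on_def using Ck_on.simps(1) by blast

lemma smooth_on_ddir [smooth_intros]: "smooth_on S f \<Longrightarrow> smooth_on S (ddir v f)"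
  unfolding smooth_on_def using Ck_on_Suc_ddir by blast

lemma smooth_on_const [smooth_intros]: "open S \<Longrightarrow> smooth_on S (\<lambda>x. c)"
  by (simp add: smooth_on_def Ck_on_const)

lemma smooth_on_ident [smooth_intros]:
  assumes "open S" shows "smooth_on S (\<lambda>x. x)"
  unfolding smooth_on_def
proof
  fix k
  show "Ck_on k S (\<lambda>x. x)"
  proof (cases k)
    case (Suc m)
    then show ?thesis
      using Ck_onI[OF assms, of "\<lambda>x. x" "\<lambda>_ v. v"] Ck_on_const[OF assms] by auto
  qed simp
qed

lemma smooth_on_bounded_linear:
  "bounded_linear A \<Longrightarrow> open S \<Longrightarrow> smooth_on S f \<Longrightarrow> smooth_on S (\<lambda>x. A (f x))"
  by (simp add: smooth_on_def Ck_on_bounded_linear)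

lemma smooth_on_bounded_bilinear:
  "bounded_bilinear B \<Longrightarrow> open S \<Longrightarrow> smooth_on S f \<Longrightarrow> smooth_on S g \<Longrightarrow> smooth_on S (\<lambda>x. B (f x) (g x))"
  by (simp add: smooth_on_def Ck_on_bounded_bilinear)

lemma smooth_on_compose:
  fixes g :: "'a::real_normed_vector \<Rightarrow> 'b::euclidean_space"
  assumes "smooth_on T f" "smooth_on S g" "open S" "open T" "\<And>x. x \<in> S \<Longrightarrow> g x \<in> T"
  shows "smooth_on S (\<lambda>x. f (g x))"
  unfolding smooth_on_def
proof
  fix k
  have 1: "g ` S \<subseteq> T" using assms(5) by (rule image_subsetI)
  have 2: "Ck_on k S g" "Ck_on k T f" using assms(1,2) by (simp_all add: smooth_on_def)
  show "Ck_on k S (\<lambda>x. f (g x))" by (rule Ck_on_compose[OF assms(3,4) 1 2])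
qed

lemmas smooth_on_fst [smooth_intros] = smooth_on_bounded_linear[OF bounded_linear_fst]
lemmas smooth_on_snd [smooth_intros] = smooth_on_bounded_linear[OF bounded_linear_snd]
lemmas smooth_on_nth [smooth_intros] = smooth_on_bounded_linear[OF bounded_linear_vec_nth]
lemmas smooth_on_mult [smooth_intros] = smooth_on_bounded_bilinear[OF bounded_bilinear_mult]
lemmas smooth_on_scaleR [smooth_intros] = smooth_on_bounded_bilinear[OF bounded_bilinear_scaleR]
lemmas smooth_on_inner [smooth_intros] = smooth_on_bounded_bilinear[OF bounded_bilinear_inner]

lemma smooth_on_add [smooth_intros]:
  "open S \<Longrightarrow> smooth_on S f \<Longrightarrow> smooth_on S g \<Longrightarrow> smooth_on S (\<lambda>x. f x + g x)"
  by (simp add: smooth_on_def Ck_on_add)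

lemma smooth_on_minus [smooth_intros]:
  "open S \<Longrightarrow> smooth_on S f \<Longrightarrow> smooth_on S (\<lambda>x. - f x)"
  by (rule smooth_on_bounded_linear) (simp_all add: bounded_linear_minus bounded_linear_ident)

lemma smooth_on_diff [smooth_intros]:
  "open S \<Longrightarrow> smooth_on S f \<Longrightarrow> smooth_on S g \<Longrightarrow> smooth_on S (\<lambda>x. f x - g x)"
  unfolding diff_conv_add_uminus by (intro smooth_on_add smooth_on_minus)

lemma smooth_on_sum [smooth_intros]:
  "open S \<Longrightarrow> (\<And>i. i \<in> I \<Longrightarrow> smooth_on S (f i)) \<Longrightarrow> smooth_on S (\<lambda>x. \<Sum>i\<in>I. f i x)"
  by (simp add: smooth_on_def Ck_on_sum)

lemma smooth_on_prod [smooth_intros]: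
  fixes f :: "'i \<Rightarrow> 'a::real_normed_vector \<Rightarrow> real"
  assumes "open S" "\<And>i. i \<in> I \<Longrightarrow> smooth_on S (f i)"
  shows "smooth_on S (\<lambda>x. \<Prod>i\<in>I. f i x)"
  using assms(2)
  by (induction I rule: infinite_finite_induct)
    (simp_all add: smooth_on_const smooth_on_mult assms(1))

lemma smooth_on_power [smooth_intros]:
  fixes f :: "'a::real_normed_vector \<Rightarrow> real"
  shows "open S \<Longrightarrow> smooth_on S f \<Longrightarrow> smooth_on S (\<lambda>x. f x ^ n)"
  by (induction n) (simp_all add: smooth_on_const smooth_on_mult)

lemma smooth_on_inverse [smooth_intros]:
  fixes f :: "'a::real_normed_vector \<Rightarrow> real"
  shows "open S \<Longrightarrow> (\<And>x. x \<in> S \<Longrightarrow> f x \<noteq> 0) \<Longrightarrow> smooth_on S f \<Longrightarrow> smooth_on S (\<lambda>x. inverse (f x))"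
  by (simp add: smooth_on_def Ck_on_inverse)

lemma smooth_on_divide [smooth_intros]:
  fixes f :: "'a::real_normed_vector \<Rightarrow> real"
  shows "open S \<Longrightarrow> (\<And>x. x \<in> S \<Longrightarrow> g x \<noteq> 0) \<Longrightarrow> smooth_on S f \<Longrightarrow> smooth_on S g \<Longrightarrow>
    smooth_on S (\<lambda>x. f x / g x)"
  unfolding divide_inverse by (intro smooth_on_mult smooth_on_inverse)

lemma smooth_on_exp [smooth_intros]:
  fixes f :: "'a::real_normed_vector \<Rightarrow> real"
  shows "open S \<Longrightarrow> smooth_on S f \<Longrightarrow> smooth_on S (\<lambda>x. exp (f x))"
  by (simp add: smooth_on_def Ck_on_exp)

lemma smooth_on_Pair [smooth_intros]:
  assumes "open S" "smooth_on S f" "smooth_on S g"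
  shows "smooth_on S (\<lambda>x. (f x, g x))"
proof -
  have 1: "bounded_linear (\<lambda>u. (u, 0))" "bounded_linear (\<lambda>u. (0, u))"
    by (auto intro!: bounded_linear_Pair bounded_linear_ident bounded_linear_zero)
  have "smooth_on S (\<lambda>x. (f x, 0) + (0, g x))"
    using assms by (intro smooth_on_add smooth_on_bounded_linear[OF 1(1)] smooth_on_bounded_linear[OF 1(2)])
  then show ?thesis by simp
qed

lemma smooth_on_vec [smooth_intros]:
  fixes f :: "'a::real_normed_vector \<Rightarrow> 'n::finite \<Rightarrow> 'b::euclidean_space"
  assumes "open S" "\<And>i. smooth_on S (\<lambda>x. f x i)"
  shows "smooth_on S (\<lambda>x. \<chi> i. f x i)"
proof -
  have bl: "bounded_linear (\<lambda>u. axis i u :: 'b^'n)" for i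
    unfolding linear_conv_bounded_linear[symmetric]
    by (intro linearI) (auto simp: axis_def vec_eq_iff)
  have "smooth_on S (\<lambda>x. \<Sum>i\<in>UNIV. axis i (f x i) :: 'b^'n)"
    by (intro smooth_on_sum smooth_on_bounded_linear[OF bl] assms)
  moreover have "(\<Sum>i\<in>UNIV. axis i (f x i)) = (\<chi> i. f x i)" for x
    by (simp add: vec_eq_iff axis_def if_distrib cong: if_cong)
  ultimately show ?thesis by simp
qed

lemma bounded_bilinear_matrix_vector:
  "bounded_bilinear ((*v) :: real^'n^'m \<Rightarrow> real^'n \<Rightarrow> real^'m)"
  unfolding bilinear_conv_bounded_bilinear[symmetric] bilinear_def
  by (auto intro!: linearI simp: matrix_vector_mult_add_rdistrib algebra_simps
      scaleR_matrix_vector_assoc[symmetric] matrix_vector_mult_scaleR)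

lemmas smooth_on_matrix_vector [smooth_intros] =
  smooth_on_bounded_bilinear[OF bounded_bilinear_matrix_vector]

lemma smooth_on_det [smooth_intros]:
  fixes A :: "'a::real_normed_vector \<Rightarrow> real^'n^'n"
  assumes "open S" "smooth_on S A"
  shows "smooth_on S (\<lambda>x. det (A x))"
  unfolding det_def by (intro smooth_intros assms)

text \<open>Cramer's rule reduces inversion to determinants.\<close>

lemma smooth_on_matrix_inv [smooth_intros]:
  fixes A :: "'a::real_normed_vector \<Rightarrow> real^'n^'n"
  assumes "open S" "smooth_on S A" "\<And>x. x \<in> S \<Longrightarrow> invertible (A x)"
  shows "smooth_on S (\<lambda>x. matrix_inv (A x))"
proof -
  have "matrix_inv (A x) = (\<chi> k i. det (\<chi> p q. if q = k then axis i 1 $ p else A x $ p $ q) / det (A x))"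
    if "x \<in> S" for x
  proof -
    have inv: "A x ** matrix_inv (A x) = mat 1"
      using assms(3)[OF that] unfolding matrix_inv_def invertible_def by (rule someI2_ex) blast
    have d: "det (A x) \<noteq> 0" using assms(3)[OF that] invertible_det_nz by blast
    have "matrix_inv (A x) *v axis i 1 =
        (\<chi> k. det (\<chi> p q. if q = k then axis i 1 $ p else A x $ p $ q) / det (A x))" for i
      using cramer[OF d, of "matrix_inv (A x) *v axis i 1" "axis i 1"] inv
      by (simp add: matrix_vector_mul_assoc)
    then show ?thesis
      by (simp add: vec_eq_iff matrix_vector_mult_basis column_def)
  qed
  moreover have "smooth_on S (\<lambda>x. \<chi> k i. det (\<chi> p q. if q = k then axis i 1 $ p else A x $ p $ q) / det (A x))"
  proof -
    have *: "smooth_on S (\<lambda>x. if q = k then axis i 1 $ p else A x $ p $ q :: real)" for q k p and i :: 'n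
      by (cases "q = k") (auto intro!: smooth_intros assms)
    show ?thesis
      using assms(3) invertible_det_nz by (intro smooth_intros assms * ) blast+
  qed
  ultimately show ?thesis using smooth_on_cong[OF assms(1)] by (metis (no_types, lifting))
qed

lemma smooth_on_ddir_var:
  fixes f :: "'a::euclidean_space \<Rightarrow> 'b::real_normed_vector"
  assumes "open S" "smooth_on S f" "smooth_on S X"
  shows "smooth_on S (\<lambda>x. ddir (X x) f x)"
proof -
  have "ddir (X x) f x = (\<Sum>b\<in>Basis. (X x \<bullet> b) *\<^sub>R ddir b f x)" if "x \<in> S" for x
    using ddir_Basis_sum smooth_on_differentiable[OF assms(2) that] by blast
  moreover have "smooth_on S (\<lambda>x. \<Sum>b\<in>Basis. (X x \<bullet> b) *\<^sub>R ddir b f x)"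
    by (intro smooth_intros assms)
  ultimately show ?thesis using smooth_on_cong[OF assms(1)] by (metis (no_types, lifting))
qed

subsection \<open>Symmetry of second derivatives\<close>

lemma ddir_along_line:
  assumes "f differentiable (at (x + t *\<^sub>R v))"
  shows "((\<lambda>t. f (x + t *\<^sub>R v)) has_vector_derivative ddir v f (x + t *\<^sub>R v)) (at t)"
proof -
  have "((\<lambda>t. x + t *\<^sub>R v) has_derivative (\<lambda>h. h *\<^sub>R v)) (at t)"
    by (auto intro!: derivative_eq_intros)
  from has_derivative_compose[OF this has_derivative_ddir[OF assms]]
  show ?thesis
    unfolding has_vector_derivative_def
    using linear_scale[OF linear_ddir[OF assms]] by simp
qed

text \<open>Applying the mean value theorem once in each direction turns a second difference into a mixed
  second derivative at a nearby point. The second difference is symmetric in the two directions, so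
  that in the limit the two mixed derivatives agree.\<close>

lemma second_difference_mvt:
  fixes f :: "'a::real_normed_vector \<Rightarrow> real"
  assumes "t > 0" and sm: "smooth_on S f"
    and sub: "\<And>p q. 0 \<le> p \<Longrightarrow> p \<le> t \<Longrightarrow> 0 \<le> q \<Longrightarrow> q \<le> t \<Longrightarrow> x + p *\<^sub>R v + q *\<^sub>R w \<in> S"
  obtains p q where "0 \<le> p" "p \<le> t" "0 \<le> q" "q \<le> t"
    "f (x + t *\<^sub>R v + t *\<^sub>R w) - f (x + t *\<^sub>R v) - f (x + t *\<^sub>R w) + f x
      = t * (t * ddir w (ddir v f) (x + p *\<^sub>R v + q *\<^sub>R w))"
proof -
  have df: "f differentiable (at (x + p *\<^sub>R v + q *\<^sub>R w))"
    "ddir v f differentiable (at (x + p *\<^sub>R v + q *\<^sub>R w))"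
    if "0 \<le> p" "p \<le> t" "0 \<le> q" "q \<le> t" for p q
    using sub[OF that] smooth_on_differentiable[OF sm] smooth_on_differentiable[OF smooth_on_ddir[OF sm]]
    by blast+
  let ?h = "\<lambda>p. f ((x + t *\<^sub>R w) + p *\<^sub>R v) - f (x + p *\<^sub>R v)"
  have d1: "DERIV ?h p :> ddir v f ((x + t *\<^sub>R w) + p *\<^sub>R v) - ddir v f (x + p *\<^sub>R v)"
    if "0 \<le> p" "p \<le> t" for p
  proof -
    have "f differentiable (at ((x + t *\<^sub>R w) + p *\<^sub>R v))" "f differentiable (at (x + p *\<^sub>R v))"
      using df(1)[of p t] df(1)[of p 0] that assms(1) by (simp_all add: add_ac)
    then show ?thesis
      by (intro DERIV_diff) (simp_all add: has_real_derivative_iff_has_vector_derivative ddir_along_line)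
  qed
  obtain p where p: "0 < p" "p < t"
    "?h t - ?h 0 = (t - 0) * (ddir v f ((x + t *\<^sub>R w) + p *\<^sub>R v) - ddir v f (x + p *\<^sub>R v))"
    using MVT2[OF assms(1) d1] by blast
  let ?k = "\<lambda>q. ddir v f ((x + p *\<^sub>R v) + q *\<^sub>R w)"
  have d2: "DERIV ?k q :> ddir w (ddir v f) ((x + p *\<^sub>R v) + q *\<^sub>R w)" if "0 \<le> q" "q \<le> t" for q
    using df(2)[of p q] that p
    by (simp add: has_real_derivative_iff_has_vector_derivative ddir_along_line)
  obtain q where q: "0 < q" "q < t"
    "?k t - ?k 0 = (t - 0) * ddir w (ddir v f) ((x + p *\<^sub>R v) + q *\<^sub>R w)"
    using MVT2[OF assms(1) d2] by blast
  show thesis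
    using p q by (intro that[of p q]) (simp_all add: add_ac)
qed

lemma ddir_commute_real:
  fixes f :: "'a::real_normed_vector \<Rightarrow> real"
  assumes "open S" "smooth_on S f" "x \<in> S"
  shows "ddir w (ddir v f) x = ddir v (ddir w f) x"
proof (rule ccontr)
  let ?a = "ddir w (ddir v f)" and ?b = "ddir v (ddir w f)"
  assume ne: "\<not> ?a x = ?b x"
  define e where "e = \<bar>?a x - ?b x\<bar> / 2"
  have e: "e > 0" using ne by (simp add: e_def)
  have "isCont ?a x" "isCont ?b x"
    using assms by (meson continuous_on_eq_continuous_at smooth_on_continuous smooth_on_ddir)+
  then obtain d1 d2 where d: "d1 > 0" "d2 > 0"
    "\<And>y. dist y x < d1 \<Longrightarrow> dist (?a y) (?a x) < e" "\<And>y. dist y x < d2 \<Longrightarrow> dist (?b y) (?b x) < e"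
    using e unfolding continuous_at_eps_delta by metis
  obtain d3 where d3: "d3 > 0" "ball x d3 \<subseteq> S" using assms(1,3) open_contains_ball by blast
  define r where "r = min (min d1 d2) d3"
  define t where "t = r / (2 * (norm v + norm w + 1))"
  have r: "r > 0" using d d3 by (simp add: r_def)
  have n: "norm v + norm w + 1 > 0" by (simp add: add_nonneg_pos)
  have t: "t > 0" using r n by (simp add: t_def)
  have close: "dist (x + p *\<^sub>R v + q *\<^sub>R w) x < r" if "0 \<le> p" "p \<le> t" "0 \<le> q" "q \<le> t" for p q
  proof -
    have "dist (x + p *\<^sub>R v + q *\<^sub>R w) x = norm (p *\<^sub>R v + q *\<^sub>R w)"
      by (simp add: dist_norm add.assoc)
    also have "\<dots> \<le> p * norm v + q * norm w"
      using norm_triangle_ineq[of "p *\<^sub>R v" "q *\<^sub>R w"] that by simp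
    also have "\<dots> \<le> t * norm v + t * norm w"
      using that by (intro add_mono mult_right_mono) auto
    also have "\<dots> \<le> t * (norm v + norm w + 1)" using t by (simp add: algebra_simps)
    also have "\<dots> = r / 2" using n by (simp add: t_def field_simps)
    finally show ?thesis using r by simp
  qed
  have S1: "x + p *\<^sub>R v + q *\<^sub>R w \<in> S" if "0 \<le> p" "p \<le> t" "0 \<le> q" "q \<le> t" for p q
    using close[OF that] d3 by (auto simp: r_def dist_commute)
  have S2: "x + p *\<^sub>R w + q *\<^sub>R v \<in> S" if "0 \<le> p" "p \<le> t" "0 \<le> q" "q \<le> t" for p q
    using S1[of q p] that by (simp add: add_ac)
  obtain p q where pq: "0 \<le> p" "p \<le> t" "0 \<le> q" "q \<le> t"
    "f (x + t *\<^sub>R v + t *\<^sub>R w) - f (x + t *\<^sub>R v) - f (x + t *\<^sub>R w) + f x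
      = t * (t * ?a (x + p *\<^sub>R v + q *\<^sub>R w))"
    by (rule second_difference_mvt[OF t assms(2) S1])
  obtain p' q' where pq': "0 \<le> p'" "p' \<le> t" "0 \<le> q'" "q' \<le> t"
    "f (x + t *\<^sub>R w + t *\<^sub>R v) - f (x + t *\<^sub>R w) - f (x + t *\<^sub>R v) + f x
      = t * (t * ?b (x + p' *\<^sub>R w + q' *\<^sub>R v))"
    by (rule second_difference_mvt[OF t assms(2) S2])
  have "t * (t * ?a (x + p *\<^sub>R v + q *\<^sub>R w)) = t * (t * ?b (x + p' *\<^sub>R w + q' *\<^sub>R v))"
    unfolding pq(5)[symmetric] pq'(5)[symmetric] by (simp add: add_ac)
  then have eq: "?a (x + p *\<^sub>R v + q *\<^sub>R w) = ?b (x + p' *\<^sub>R w + q' *\<^sub>R v)" using t by simp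
  have "dist (?a (x + p *\<^sub>R v + q *\<^sub>R w)) (?a x) < e"
    using close[OF pq(1-4)] d(3) by (simp add: r_def)
  moreover have "dist (?b (x + p' *\<^sub>R w + q' *\<^sub>R v)) (?b x) < e"
    using close[OF pq'(3,4,1,2)] d(4) by (simp add: r_def add_ac)
  ultimately have "\<bar>?a x - ?b x\<bar> < e + e" unfolding eq dist_real_def by linarith
  then show False by (simp add: e_def)
qed

lemma ddir_bounded_linear:
  assumes "bounded_linear A" "f differentiable (at x)"
  shows "ddir v (\<lambda>x. A (f x)) x = A (ddir v f x)"
  using ddir_eq[OF bounded_linear.has_derivative[OF assms(1) has_derivative_ddir[OF assms(2)]]] .

lemma ddir_commute:
  fixes f :: "'a::real_normed_vector \<Rightarrow> 'b::euclidean_space"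
  assumes "open S" "smooth_on S f" "x \<in> S"
  shows "ddir w (ddir v f) x = ddir v (ddir w f) x"
proof (rule euclidean_eqI)
  fix b :: 'b
  have d: "f differentiable (at y)" "ddir u f differentiable (at y)" if "y \<in> S" for y u
    using assms smooth_on_differentiable smooth_on_ddir that by blast+
  have eq: "ddir u (ddir v f) x \<bullet> b = ddir u (ddir v (\<lambda>y. f y \<bullet> b)) x" for u v
  proof -
    have "ddir u (ddir v (\<lambda>y. f y \<bullet> b)) x = ddir u (\<lambda>y. ddir v f y \<bullet> b) x"
      by (intro ddir_cong[OF assms(1,3)] ddir_bounded_linear[OF bounded_linear_inner_left d(1)])
    also have "\<dots> = ddir u (ddir v f) x \<bullet> b"
      using assms(3) d(2) ddir_bounded_linear[OF bounded_linear_inner_left] by blast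
    finally show ?thesis by simp
  qed
  have "smooth_on S (\<lambda>y. f y \<bullet> b)" by (intro smooth_intros assms)
  then show "ddir w (ddir v f) x \<bullet> b = ddir v (ddir w f) x \<bullet> b"
    unfolding eq using ddir_commute_real assms by blast
qed

section \<open>Local solutions of ordinary differential equations\<close>

lemma smooth_on_lipschitz_compact:
  fixes f :: "'a::euclidean_space \<Rightarrow> 'b::real_normed_vector"
  assumes "open S" "smooth_on S f" "convex C" "compact C" "C \<subseteq> S"
  obtains K where "K \<ge> 0" "\<And>x y. x \<in> C \<Longrightarrow> y \<in> C \<Longrightarrow> norm (f x - f y) \<le> K * norm (x - y)"
proof -
  have "\<exists>M. \<forall>x\<in>C. norm (ddir b f x) \<le> M" for b
  proof -
    have "continuous_on C (ddir b f)"
      using assms smooth_on_continuous[OF smooth_on_ddir] continuous_on_subset by blast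
    then have "bounded (ddir b f ` C)"
      using assms(4) compact_continuous_image compact_imp_bounded by blast
    then show ?thesis unfolding bounded_iff by blast
  qed
  then obtain M where M: "\<And>b x. x \<in> C \<Longrightarrow> norm (ddir b f x) \<le> M b" by metis
  define K where "K = (\<Sum>b\<in>Basis. \<bar>M b\<bar>)"
  have der: "(f has_derivative (\<lambda>v. ddir v f x)) (at x within C)" if "x \<in> C" for x
    using smooth_on_has_derivative[OF assms(2)] that assms(5) has_derivative_at_withinI by blast
  have bd: "norm (ddir v f x) \<le> K * norm v" if "x \<in> C" for x v
  proof -
    have "f differentiable (at x)" using smooth_on_differentiable assms(2,5) that by blast
    from ddir_Basis_sum[OF this, of v]
    have "norm (ddir v f x) \<le> (\<Sum>b\<in>Basis. norm ((v \<bullet> b) *\<^sub>R ddir b f x))"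
      by (metis norm_sum)
    also have "\<dots> \<le> (\<Sum>b\<in>Basis. \<bar>M b\<bar> * norm v)"
    proof (intro sum_mono)
      fix b :: 'a assume "b \<in> Basis"
      then have "\<bar>v \<bullet> b\<bar> \<le> norm v" by (simp add: Basis_le_norm)
      moreover have "norm (ddir b f x) \<le> \<bar>M b\<bar>" using M[OF that, of b] by linarith
      ultimately have "\<bar>v \<bullet> b\<bar> * norm (ddir b f x) \<le> norm v * \<bar>M b\<bar>" by (intro mult_mono) auto
      then show "norm ((v \<bullet> b) *\<^sub>R ddir b f x) \<le> \<bar>M b\<bar> * norm v" by (simp add: mult.commute)
    qed
    finally show ?thesis by (simp add: K_def sum_distrib_right)
  qed
  have "norm (f x - f y) \<le> K * norm (x - y)" if "x \<in> C" "y \<in> C" for x y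
    by (rule differentiable_bound[OF assms(3) der _ that]) (auto intro!: onorm_le bd)
  moreover have "K \<ge> 0" by (simp add: K_def sum_nonneg)
  ultimately show thesis using that by blast
qed

text \<open>Banach's theorem needs a complete space of curves defined on the whole line; clamping the time to
  the interval of radius \<open>d\<close> makes every such curve bounded.\<close>

definition integral_curve :: "real \<Rightarrow> 'a::euclidean_space \<Rightarrow> (real \<Rightarrow> 'a) \<Rightarrow> real \<Rightarrow> 'a" where
  "integral_curve d w h t = w + (integral {-d..max (-d) (min d t)} h - integral {-d..0} h)"

lemma integral_curve_dist:
  assumes "d > 0" "continuous_on UNIV h" "continuous_on UNIV k" "\<And>t. norm (h t - k t) \<le> B"
  shows "norm (integral_curve d w h t - integral_curve d w k t) \<le> 4 * d * B"
proof -
  have B: "B \<ge> 0" using assms(4)[of 0] norm_ge_zero order_trans by blast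
  have int: "h integrable_on {-d..s}" "k integrable_on {-d..s}" for s
    by (intro integrable_continuous_real continuous_on_subset[OF assms(2)]
        continuous_on_subset[OF assms(3)]; simp)+
  have bd: "norm (integral {-d..s} h - integral {-d..s} k) \<le> 2 * d * B" if "-d \<le> s" "s \<le> d" for s
  proof -
    have "norm (integral {-d..s} (\<lambda>t. h t - k t)) \<le> B * (s - (-d))"
      using assms that
      by (intro integral_bound continuous_on_diff continuous_on_subset[OF assms(2)]
          continuous_on_subset[OF assms(3)]) simp_all
    also have "\<dots> \<le> B * (2 * d)" using that B by (intro mult_left_mono) auto
    finally show ?thesis using integral_diff[OF int, of s] by (simp add: mult_ac)
  qed
  have "norm ((integral {-d..max (-d) (min d t)} h - integral {-d..max (-d) (min d t)} k)
      - (integral {-d..0} h - integral {-d..0} k)) \<le> 2 * d * B + 2 * d * B"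
    by (rule order_trans[OF norm_triangle_ineq4 add_mono[OF bd bd]]) (use assms(1) in auto)
  then show ?thesis by (simp add: integral_curve_def algebra_simps)
qed

lemma integral_curve_continuous:
  assumes "d > 0" "continuous_on UNIV h"
  shows "continuous_on UNIV (integral_curve d w h)"
proof -
  have "continuous_on {-d..d} (\<lambda>s. integral {-d..s} h)"
    by (intro indefinite_integral_continuous_1 integrable_continuous_real
        continuous_on_subset[OF assms(2)]) simp
  then have "continuous_on UNIV (\<lambda>t. integral {-d..max (-d) (min d t)} h)"
    by (rule continuous_on_compose2) (use assms(1) in \<open>auto intro!: continuous_intros\<close>)
  then show ?thesis unfolding integral_curve_def[abs_def] by (intro continuous_intros)
qed

lemma integral_curve_derivative:
  assumes "continuous_on UNIV h" "-d < t" "t < d"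
  shows "(integral_curve d w h has_vector_derivative h t) (at t)"
proof -
  have "((\<lambda>s. integral {-d..s} h) has_vector_derivative h t) (at t within {-d..d})"
    using assms by (intro integral_has_vector_derivative continuous_on_subset[OF assms(1)]) simp_all
  then have "((\<lambda>s. integral {-d..s} h) has_vector_derivative h t) (at t)"
    unfolding at_within_Icc_at[OF assms(2,3)] .
  then have *: "((\<lambda>s. w + (integral {-d..s} h - integral {-d..0} h)) has_vector_derivative h t) (at t)"
    using has_vector_derivative_add[OF has_vector_derivative_const[of w]
        has_vector_derivative_diff[OF _ has_vector_derivative_const[of "integral {-d..0} h"]]]
    by fastforce
  have "w + (integral {-d..s} h - integral {-d..0} h) = integral_curve d w h s" if "s \<in> {-d<..<d}" for s
    using that unfolding integral_curve_def by simp
  then show ?thesis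
    using assms(2,3) by (intro has_vector_derivative_transform_within_open[OF *, of "{-d<..<d}"]) simp_all
qed

text \<open>Picard iteration. An integral curve is a difference of two integrals over intervals of length at
  most \<open>2 * d\<close>, which gives the factor \<open>4 * d\<close>.\<close>

lemma ode_solution_bounded_lipschitz:
  fixes f :: "'a::euclidean_space \<Rightarrow> 'a"
  assumes d: "d > 0" and K: "K \<ge> 0" "4 * d * K \<le> 1/2"
    and lip: "\<And>x y. norm (f x - f y) \<le> K * norm (x - y)" and bd: "\<And>x. norm (f x) \<le> B"
  obtains u where "u 0 = w" "\<And>t. norm (u t - w) \<le> 4 * d * B"
    "\<And>t. -d < t \<Longrightarrow> t < d \<Longrightarrow> (u has_vector_derivative f (u t)) (at t)"
proof -
  have cf: "continuous_on UNIV f"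
    by (rule lipschitz_on_continuous_on[of K], rule lipschitz_onI) (use lip K in \<open>auto simp: dist_norm\<close>)
  have ch: "continuous_on UNIV (\<lambda>t. f (apply_bcontfun u t))" for u :: "real \<Rightarrow>\<^sub>C 'a"
    by (rule continuous_on_compose2[OF cf]) auto
  define T :: "(real \<Rightarrow>\<^sub>C 'a) \<Rightarrow> (real \<Rightarrow>\<^sub>C 'a)" where
    "T u = Bcontfun (integral_curve d w (\<lambda>t. f (apply_bcontfun u t)))" for u
  have near: "norm (integral_curve d w (\<lambda>t. f (apply_bcontfun u t)) t - w) \<le> 4 * d * B" for u t
    using integral_curve_dist[OF d ch[of u], of "\<lambda>_. 0" B w t] bd
    by (simp add: integral_curve_def)
  have T: "apply_bcontfun (T u) = integral_curve d w (\<lambda>t. f (apply_bcontfun u t))" for u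
  proof -
    have "integral_curve d w (\<lambda>t. f (apply_bcontfun u t)) \<in> bcontfun"
    proof (rule bcontfun_normI)
      show "continuous_on UNIV (integral_curve d w (\<lambda>t. f (apply_bcontfun u t)))"
        by (rule integral_curve_continuous[OF d ch])
      show "norm (integral_curve d w (\<lambda>t. f (apply_bcontfun u t)) t) \<le> norm w + 4 * d * B" for t
        using near[of u t] norm_triangle_sub[of "integral_curve d w (\<lambda>t. f (apply_bcontfun u t)) t" w]
        by linarith
    qed
    then show ?thesis unfolding T_def by (rule Bcontfun_inverse)
  qed
  have "dist (T u) (T v) \<le> 1/2 * dist u v" for u v
  proof (rule dist_bound)
    fix t
    have "norm (f (apply_bcontfun u s) - f (apply_bcontfun v s)) \<le> K * dist u v" for s
      using lip[of "apply_bcontfun u s" "apply_bcontfun v s"] dist_bounded[of u s v] K(1)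
      by (smt (verit) dist_norm mult_left_mono)
    from integral_curve_dist[OF d ch ch this]
    have "dist (apply_bcontfun (T u) t) (apply_bcontfun (T v) t) \<le> 4 * d * (K * dist u v)"
      unfolding T dist_norm .
    also have "\<dots> = (4 * d * K) * dist u v" by simp
    also have "\<dots> \<le> 1/2 * dist u v" using K(2) by (intro mult_right_mono) auto
    finally show "dist (apply_bcontfun (T u) t) (apply_bcontfun (T v) t) \<le> 1/2 * dist u v" .
  qed
  then have "\<exists>!u. T u = u" using banach_fix_type[of "1/2" T] by auto
  then obtain u where "T u = u" by blast
  then have u: "apply_bcontfun u = integral_curve d w (\<lambda>t. f (apply_bcontfun u t))" using T by metis
  show thesis
  proof (rule that)
    show "apply_bcontfun u 0 = w" using d by (subst u) (simp add: integral_curve_def)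
    show "norm (apply_bcontfun u t - w) \<le> 4 * d * B" for t using near[of u t] u by simp
    show "(apply_bcontfun u has_vector_derivative f (apply_bcontfun u t)) (at t)"
      if "-d < t" "t < d" for t
      using integral_curve_derivative[OF ch that, of w u] u by simp
  qed
qed

text \<open>Composing the field with the projection to a ball makes it bounded and globally Lipschitz, and
  solutions do not leave the ball for a short time. This time is uniform in the initial value, which is
  what lets parallel transport reach a whole neighbourhood.\<close>

lemma ode_local_solutions:
  fixes f :: "'a::euclidean_space \<Rightarrow> 'a"
  assumes "open W" "smooth_on W f" "w0 \<in> W"
  obtains d r where "d > 0" "r > 0" "\<And>w. w \<in> cball w0 r \<Longrightarrow> \<exists>u. u 0 = w \<and>
    (\<forall>t\<in>{-d<..<d}. u t \<in> W \<and> (u has_vector_derivative f (u t)) (at t))"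
proof -
  obtain R0 where R0: "R0 > 0" "cball w0 R0 \<subseteq> W" using assms(1,3) open_contains_cball by blast
  define R where "R = R0 / 2"
  define C where "C = cball w0 (2 * R)"
  have R: "R > 0" and C: "convex C" "compact C" "closed C" "C \<noteq> {}" "C \<subseteq> W"
    using R0 by (auto simp: R_def C_def)
  obtain K where K: "K \<ge> 0" "\<And>x y. x \<in> C \<Longrightarrow> y \<in> C \<Longrightarrow> norm (f x - f y) \<le> K * norm (x - y)"
    using smooth_on_lipschitz_compact[OF assms(1,2) C(1,2,5)] by blast
  have "bounded (f ` C)"
    using C smooth_on_continuous[OF assms(2)] continuous_on_subset
      compact_continuous_image compact_imp_bounded by metis
  then obtain B where B: "B > 0" "\<And>x. x \<in> C \<Longrightarrow> norm (f x) \<le> B"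
    unfolding bounded_pos by blast
  define F where "F = (\<lambda>x. f (closest_point C x))"
  have inC: "closest_point C x \<in> C" for x using C closest_point_in_set by blast
  have bd: "norm (F x) \<le> B" for x unfolding F_def using B inC by blast
  have lip: "norm (F x - F y) \<le> K * norm (x - y)" for x y
  proof -
    have "norm (F x - F y) \<le> K * norm (closest_point C x - closest_point C y)"
      unfolding F_def using K inC by blast
    also have "\<dots> \<le> K * norm (x - y)"
      using K(1) closest_point_lipschitz[OF C(1,3,4), of x y] by (intro mult_left_mono) (auto simp: dist_norm)
    finally show ?thesis .
  qed
  define d where "d = min (1 / (8 * (K + 1))) (R / (4 * B))"
  have d: "d > 0" using K(1) R B by (simp add: d_def)
  have "d \<le> 1 / (8 * (K + 1))" by (simp add: d_def)
  then have "d * (8 * (K + 1)) \<le> 1" using K(1) pos_le_divide_eq[of "8 * (K + 1)" d 1] by simp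
  then have dK: "4 * d * K \<le> 1/2" using d by (simp add: algebra_simps)
  have "d \<le> R / (4 * B)" by (simp add: d_def)
  then have dB: "4 * d * B \<le> R" using B(1) pos_le_divide_eq[of "4 * B" d R] by (simp add: mult_ac)
  show thesis
  proof (rule that[OF d R])
    fix w assume w: "w \<in> cball w0 R"
    obtain u where u: "u 0 = w" "\<And>t. norm (u t - w) \<le> 4 * d * B"
      "\<And>t. -d < t \<Longrightarrow> t < d \<Longrightarrow> (u has_vector_derivative F (u t)) (at t)"
      using ode_solution_bounded_lipschitz[OF d K(1) dK lip bd] by blast
    have "u t \<in> C" for t
    proof -
      have "dist w0 (u t) \<le> dist w0 w + dist w (u t)" by (rule dist_triangle)
      also have "\<dots> \<le> R + R" using w u(2)[of t] dB by (intro add_mono) (auto simp: dist_norm norm_minus_commute)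
      finally show ?thesis by (simp add: C_def)
    qed
    then have "u t \<in> W" "F (u t) = f (u t)" for t
      using C(5) by (auto simp: F_def closest_point_self)
    then show "\<exists>u. u 0 = w \<and> (\<forall>t\<in>{-d<..<d}. u t \<in> W \<and> (u has_vector_derivative f (u t)) (at t))"
      using u by (metis greaterThanLessThan_iff)
  qed
qed

text \<open>Bootstrapping: the equation turns each derivative of \<open>u\<close> into one more.\<close>

lemma ode_solution_smooth:
  fixes f :: "'a::euclidean_space \<Rightarrow> 'a"
  assumes "open I" "open W" "smooth_on W f"
    and "\<And>t. t \<in> I \<Longrightarrow> u t \<in> W" "\<And>t. t \<in> I \<Longrightarrow> (u has_vector_derivative f (u t)) (at t)"
  shows "smooth_on I u"
  unfolding smooth_on_def
proof
  fix k
  show "Ck_on k I u"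
  proof (induction k)
    case 0
    have "continuous_on I u"
      using assms(5) has_vector_derivative_continuous continuous_at_imp_continuous_on by blast
    then show ?case by simp
  next
    case (Suc k)
    show ?case
    proof (rule Ck_onI[OF assms(1)])
      show "(u has_derivative (\<lambda>v. v *\<^sub>R f (u t))) (at t)" if "t \<in> I" for t
        using assms(5)[OF that] by (simp add: has_vector_derivative_def)
      have "u ` I \<subseteq> W" using assms(4) by (rule image_subsetI)
      moreover have "Ck_on k W f" using assms(3) by (simp add: smooth_on_def)
      ultimately have "Ck_on k I (\<lambda>t. f (u t))" by (rule Ck_on_compose[OF assms(1,2) _ Suc.IH])
      then show "Ck_on k I (\<lambda>t. v *\<^sub>R f (u t))" for v
        by (rule Ck_on_bounded_linear[OF bounded_linear_scaleR_right assms(1)])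
    qed
  qed
qed

section \<open>The local geometry of a Finsler function\<close>

lemma ddir_add_dir: "f differentiable (at z) \<Longrightarrow> ddir (a + b) f z = ddir a f z + ddir b f z"
  by (rule linear_add[OF linear_ddir])

lemma ddir_scale_dir: "f differentiable (at z) \<Longrightarrow> ddir (r *\<^sub>R a) f z = r *\<^sub>R ddir a f z"
  by (rule linear_scale[OF linear_ddir])

lemma ddir_minus_dir: "f differentiable (at z) \<Longrightarrow> ddir (- a) f z = - ddir a f z"
  by (rule linear_neg[OF linear_ddir])

lemma ddir_zero_dir: "f differentiable (at z) \<Longrightarrow> ddir 0 f z = 0"
  by (rule linear_0[OF linear_ddir])

lemma ddir_split:
  "f differentiable (at z) \<Longrightarrow> ddir (u, v) f z = ddir (u, 0) f z + ddir (0, v) f z"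
  using ddir_add_dir[of f z "(u, 0)" "(0, v)"] by simp

lemma vec_axis_sum: "v = (\<Sum>i\<in>UNIV. v $ i *\<^sub>R axis i 1)" for v :: "real^'n"
  by (simp add: vec_eq_iff axis_def if_distrib cong: if_cong)

lemma ddir_axis_snd:
  fixes f :: "'n::finite tpoint \<Rightarrow> 'b::real_normed_vector"
  assumes "f differentiable (at z)"
  shows "ddir (0, v) f z = (\<Sum>i\<in>UNIV. v $ i *\<^sub>R ddir (0, axis i 1) f z)"
proof -
  have "(0 :: real^'n, v) = (\<Sum>i\<in>UNIV. v $ i *\<^sub>R (0, axis i 1))"
    unfolding prod_eq_iff fst_sum snd_sum by (simp add: vec_axis_sum[symmetric])
  then have "ddir (0, v) f z = ddir (\<Sum>i\<in>UNIV. v $ i *\<^sub>R (0, axis i 1)) f z" by simp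
  also have "\<dots> = (\<Sum>i\<in>UNIV. ddir (v $ i *\<^sub>R (0, axis i 1)) f z)"
    by (rule linear_sum[OF linear_ddir[OF assms]])
  also have "\<dots> = (\<Sum>i\<in>UNIV. v $ i *\<^sub>R ddir (0, axis i 1) f z)"
    by (intro sum.cong refl ddir_scale_dir assms)
  finally show ?thesis .
qed

lemma ddir_axis_fst:
  fixes f :: "'n::finite tpoint \<Rightarrow> 'b::real_normed_vector"
  assumes "f differentiable (at z)"
  shows "ddir (v, 0) f z = (\<Sum>i\<in>UNIV. v $ i *\<^sub>R ddir (axis i 1, 0) f z)"
proof -
  have "(v, 0 :: real^'n) = (\<Sum>i\<in>UNIV. v $ i *\<^sub>R (axis i 1, 0))"
    unfolding prod_eq_iff fst_sum snd_sum by (simp add: vec_axis_sum[symmetric])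
  then have "ddir (v, 0) f z = ddir (\<Sum>i\<in>UNIV. v $ i *\<^sub>R (axis i 1, 0)) f z" by simp
  also have "\<dots> = (\<Sum>i\<in>UNIV. ddir (v $ i *\<^sub>R (axis i 1, 0)) f z)"
    by (rule linear_sum[OF linear_ddir[OF assms]])
  also have "\<dots> = (\<Sum>i\<in>UNIV. v $ i *\<^sub>R ddir (axis i 1, 0) f z)"
    by (intro sum.cong refl ddir_scale_dir assms)
  finally show ?thesis .
qed

lemma ddir_bilinear:
  assumes "bounded_bilinear B" "f differentiable (at z)" "g differentiable (at z)"
  shows "ddir w (\<lambda>z. B (f z) (g z)) z = B (f z) (ddir w g z) + B (ddir w f z) (g z)"
  using ddir_eq[OF bounded_bilinear.FDERIV[OF assms(1) has_derivative_ddir[OF assms(2)]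
        has_derivative_ddir[OF assms(3)]]] .

lemmas ddir_scaleR = ddir_bilinear[OF bounded_bilinear_scaleR]
lemmas ddir_mult = ddir_bilinear[OF bounded_bilinear_mult]
lemmas ddir_inner = ddir_bilinear[OF bounded_bilinear_inner]
lemmas ddir_matrix_vector = ddir_bilinear[OF bounded_bilinear_matrix_vector]

lemma ddir_const: "ddir w (\<lambda>z. c) z = 0"
  by (rule ddir_eq) simp

lemma ddir_snd: "ddir w snd z = snd w"
  by (rule ddir_eq) (simp add: has_derivative_snd)

lemma ddir_diff:
  "f differentiable (at z) \<Longrightarrow> g differentiable (at z) \<Longrightarrow>
    ddir w (\<lambda>z. f z - g z) z = ddir w f z - ddir w g z"
  by (rule ddir_eq, rule has_derivative_diff) (auto intro: has_derivative_ddir)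

lemma ddir_scale_const:
  "f differentiable (at z) \<Longrightarrow> ddir w (\<lambda>z. c *\<^sub>R f z) z = c *\<^sub>R ddir w f z"
  by (rule ddir_bounded_linear[OF bounded_linear_scaleR_right])

lemma ddir_mult_const:
  fixes f :: "'a::real_normed_vector \<Rightarrow> real"
  shows "f differentiable (at z) \<Longrightarrow> ddir w (\<lambda>z. c * f z) z = c * ddir w f z"
  by (rule ddir_bounded_linear[OF bounded_linear_mult_right])

text \<open>The Euler--Lagrange expression differentiates the energy in the direction of the line element at
  which it is evaluated, so its own derivative needs the product rule for a moving direction.\<close>

lemma has_derivative_ddir_var:
  fixes h :: "'a::euclidean_space \<Rightarrow> 'b::real_normed_vector"
  assumes "open S" "smooth_on S h" "z \<in> S" "(X has_derivative X') (at z)"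
  shows "((\<lambda>z. ddir (X z) h z) has_derivative (\<lambda>w. ddir (X' w) h z + ddir w (ddir (X z) h) z)) (at z)"
proof -
  have dh: "h differentiable (at y)" "ddir v h differentiable (at y)" if "y \<in> S" for y v
    using smooth_on_differentiable assms(2) smooth_on_ddir that by blast+
  have "((\<lambda>z. \<Sum>b\<in>Basis. (X z \<bullet> b) *\<^sub>R ddir b h z) has_derivative
      (\<lambda>w. \<Sum>b\<in>Basis. (X z \<bullet> b) *\<^sub>R ddir w (ddir b h) z + (X' w \<bullet> b) *\<^sub>R ddir b h z)) (at z)"
    by (intro has_derivative_sum has_derivative_scaleR bounded_linear.has_derivative[OF bounded_linear_inner_left assms(4)]
        has_derivative_ddir dh(2) assms(3))
  moreover have "(\<Sum>b\<in>Basis. (X z \<bullet> b) *\<^sub>R ddir w (ddir b h) z + (X' w \<bullet> b) *\<^sub>R ddir b h z)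
      = ddir (X' w) h z + ddir w (ddir (X z) h) z" for w
  proof -
    have "ddir w (ddir (X z) h) z = ddir w (\<lambda>y. \<Sum>b\<in>Basis. (X z \<bullet> b) *\<^sub>R ddir b h y) z"
      by (rule ddir_cong[OF assms(1,3)]) (rule ddir_Basis_sum[OF dh(1)])
    also have "\<dots> = (\<Sum>b\<in>Basis. (X z \<bullet> b) *\<^sub>R ddir w (ddir b h) z)"
      by (rule ddir_eq) (intro has_derivative_sum has_derivative_scaleR_right has_derivative_ddir dh(2) assms(3))
    finally show ?thesis
      unfolding ddir_Basis_sum[OF dh(1)[OF assms(3)], of "X' w"] by (simp add: sum.distrib add.commute)
  qed
  ultimately have "((\<lambda>z. \<Sum>b\<in>Basis. (X z \<bullet> b) *\<^sub>R ddir b h z) has_derivative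
      (\<lambda>w. ddir (X' w) h z + ddir w (ddir (X z) h) z)) (at z)"
    by simp
  then show ?thesis
    by (rule has_derivative_transform_within_open[OF _ assms(1,3)]) (rule ddir_Basis_sum[OF dh(1), symmetric])
qed

lemma nondegenerate_inner: "(\<And>w. w \<bullet> a = w \<bullet> b) \<Longrightarrow> a = (b :: 'a::real_inner)"
  by (metis vector_eq_rdot inner_commute)

lemma inner_matrix_sum:
  "u \<bullet> (A *v v) = (\<Sum>i\<in>UNIV. \<Sum>j\<in>UNIV. u $ i * (A $ i $ j) * v $ j)" for u v :: "real^'n"
  by (simp add: inner_vec_def matrix_vector_mult_def sum_distrib_left mult.assoc)

subsection \<open>Index-free form of the basic tensors\<close>

text \<open>The objects \<open>C^k_ij\<close>, \<open>G^s\<close>, \<open>G^i_j\<close> and \<open>Gam^k_ij\<close> as maps between vectors, so that the identities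
  between them can be proved without indices by testing against vectors with the fundamental tensor.\<close>

definition energy :: "('n::finite tpoint \<Rightarrow> real) \<Rightarrow> 'n tpoint \<Rightarrow> real" where
  "energy L z = (L z)\<^sup>2"

definition cartan_op :: "('n::finite tpoint \<Rightarrow> real) \<Rightarrow> 'n tpoint \<Rightarrow> real^'n \<Rightarrow> real^'n \<Rightarrow> real^'n" where
  "cartan_op L z w u = fund_inv L z *v ((1/2) *\<^sub>R (ddir (0, w) (fund_tensor L) z *v u))"

definition spray_vec :: "('n::finite tpoint \<Rightarrow> real) \<Rightarrow> 'n tpoint \<Rightarrow> real^'n" where
  "spray_vec L z = (\<chi> s. spray L s z)"

definition nonlin_op :: "('n::finite tpoint \<Rightarrow> real) \<Rightarrow> 'n tpoint \<Rightarrow> real^'n \<Rightarrow> real^'n" where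
  "nonlin_op L z u = ddir (0, u) (spray_vec L) z"

definition chern :: "('n::finite tpoint \<Rightarrow> real) \<Rightarrow> 'n tpoint \<Rightarrow> real^'n \<Rightarrow> real^'n \<Rightarrow> real^'n" where
  "chern L z u v = (\<chi> k. \<Sum>i\<in>UNIV. \<Sum>j\<in>UNIV. u $ i * v $ j * Gam L k i j z)"

locale finsler_patch =
  fixes U :: "(real^'n::finite) set" and L :: "'n tpoint \<Rightarrow> real"
  assumes open_U: "open U"
    and smooth_L: "smooth_on (U \<times> (-{0})) L"
    and L_nonneg: "\<And>z. z \<in> U \<times> (-{0}) \<Longrightarrow> L z \<ge> 0"
    and L_hom: "\<And>x y r. x \<in> U \<Longrightarrow> y \<noteq> 0 \<Longrightarrow> r > 0 \<Longrightarrow> L (x, r *\<^sub>R y) = r * L (x, y)"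
    and metric_pos: "\<And>z u. z \<in> U \<times> (-{0}) \<Longrightarrow> u \<noteq> 0 \<Longrightarrow> metric L z u u > 0"
begin

abbreviation "W \<equiv> U \<times> (-{0::real^'n})"
abbreviation "E \<equiv> energy L"
abbreviation "g \<equiv> fund_tensor L"
abbreviation "G \<equiv> spray_vec L"
abbreviation "N \<equiv> nonlin_op L"
abbreviation "C \<equiv> cartan_op L"

lemma open_W: "open W"
  by (intro open_Times open_U open_Compl) simp

lemma smooth_E: "smooth_on W E"
  unfolding energy_def[abs_def] by (intro smooth_intros smooth_L open_W)

lemma diff_W: "smooth_on W f \<Longrightarrow> z \<in> W \<Longrightarrow> f differentiable (at z)"
  by (rule smooth_on_differentiable)

lemma g_nth: "g z $ i $ j = 1/2 * ddir (0, axis i 1) (ddir (0, axis j 1) E) z"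
  by (simp add: fund_tensor_def dy_def[abs_def] ddir_def[abs_def] energy_def[abs_def])

lemma smooth_g: "smooth_on W g"
proof -
  have eq: "g = (\<lambda>z. \<chi> i j. 1/2 * ddir (0, axis i 1) (ddir (0, axis j 1) E) z)"
    by (simp add: fun_eq_iff vec_eq_iff g_nth)
  show ?thesis unfolding eq by (intro smooth_intros open_W smooth_E)
qed

lemma g_apply:
  assumes "z \<in> W"
  shows "u \<bullet> (g z *v v) = 1/2 * ddir (0, u) (ddir (0, v) E) z"
proof -
  have d: "E differentiable (at z)" "ddir w E differentiable (at z)" if "z \<in> W" for z w
    using diff_W smooth_E smooth_on_ddir that by blast+
  have "ddir (0, u) (ddir (0, v) E) z = ddir (0, u) (\<lambda>z. \<Sum>j\<in>UNIV. v $ j *\<^sub>R ddir (0, axis j 1) E z) z"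
    by (rule ddir_cong[OF open_W assms]) (rule ddir_axis_snd[OF d(1)])
  also have "\<dots> = (\<Sum>j\<in>UNIV. v $ j *\<^sub>R ddir (0, u) (ddir (0, axis j 1) E) z)"
    by (rule ddir_eq) (intro has_derivative_sum has_derivative_scaleR_right has_derivative_ddir d assms)
  also have "\<dots> = (\<Sum>j\<in>UNIV. v $ j *\<^sub>R (\<Sum>i\<in>UNIV. u $ i *\<^sub>R ddir (0, axis i 1) (ddir (0, axis j 1) E) z))"
    by (intro sum.cong refl arg_cong2[where f=scaleR] ddir_axis_snd d assms)
  also have "\<dots> = 2 * (u \<bullet> (g z *v v))"
    unfolding inner_matrix_sum g_nth
    by (subst sum.swap) (simp add: sum_distrib_left mult_ac)
  finally show ?thesis by simp
qed

lemma metric_eq: "metric L z u v = u \<bullet> (g z *v v)"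
  unfolding metric_def inner_matrix_sum by (simp add: mult_ac)

lemma g_sym: "z \<in> W \<Longrightarrow> u \<bullet> (g z *v v) = v \<bullet> (g z *v u)"
  unfolding g_apply using ddir_commute[OF open_W smooth_E] by simp

lemma g_pos: "z \<in> W \<Longrightarrow> u \<noteq> 0 \<Longrightarrow> u \<bullet> (g z *v u) > 0"
  using metric_pos metric_eq by metis

lemma g_invertible:
  assumes "z \<in> W" shows "invertible (g z)"
proof -
  have "u = 0" if "g z *v u = 0" for u
    using g_pos[OF assms, of u] that by fastforce
  then show ?thesis
    unfolding invertible_left_inverse matrix_left_invertible_ker by blast
qed

lemma g_inv:
  assumes "z \<in> W" shows "g z *v (fund_inv L z *v b) = b"
proof -
  have "g z ** fund_inv L z = mat 1"
    using g_invertible[OF assms] unfolding fund_inv_def matrix_inv_def invertible_def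
    by (rule someI2_ex) blast
  then show ?thesis by (simp add: matrix_vector_mul_assoc)
qed

lemma g_nondeg:
  assumes "z \<in> W" "\<And>w. w \<bullet> (g z *v a) = w \<bullet> (g z *v b)"
  shows "a = b"
proof -
  have "g z *v a = g z *v b" using nondegenerate_inner assms(2) by blast
  then have "(a - b) \<bullet> (g z *v (a - b)) = 0" by (simp add: matrix_vector_mult_diff_distrib)
  then show ?thesis using g_pos[OF assms(1), of "a - b"] by fastforce
qed

lemma smooth_fund_inv: "smooth_on W (fund_inv L)"
  unfolding fund_inv_def[abs_def] by (intro smooth_intros open_W smooth_g g_invertible)

lemma ddir_g_apply:
  assumes "z \<in> W" shows "a \<bullet> (ddir X g z *v b) = ddir X (\<lambda>z. a \<bullet> (g z *v b)) z"
proof -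
  have "bounded_linear (\<lambda>A :: real^'n^'n. a \<bullet> (A *v b))"
    using bounded_linear_compose[OF bounded_linear_inner_right
        bounded_bilinear.bounded_linear_left[OF bounded_bilinear_matrix_vector]] by blast
  from ddir_bounded_linear[OF this diff_W[OF smooth_g assms]] show ?thesis by simp
qed

lemma ddir_g_sym: "z \<in> W \<Longrightarrow> a \<bullet> (ddir X g z *v b) = b \<bullet> (ddir X g z *v a)"
  unfolding ddir_g_apply using g_sym by (intro ddir_cong[OF open_W]) auto

lemma ddir_vert_g:
  assumes "z \<in> W"
  shows "a \<bullet> (ddir (0, w) g z *v b) = 1/2 * ddir (0, w) (ddir (0, a) (ddir (0, b) E)) z"
proof -
  have "a \<bullet> (ddir (0, w) g z *v b) = ddir (0, w) (\<lambda>z. 1/2 * ddir (0, a) (ddir (0, b) E) z) z"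
    unfolding ddir_g_apply[OF assms] by (rule ddir_cong[OF open_W assms]) (rule g_apply)
  also have "\<dots> = 1/2 * ddir (0, w) (ddir (0, a) (ddir (0, b) E)) z"
    by (rule ddir_mult_const) (intro diff_W[OF _ assms] smooth_on_ddir smooth_E)
  finally show ?thesis .
qed

text \<open>The Cartan tensor is totally symmetric, being a third derivative of the energy.\<close>

lemma ddir_vert_g_swap: "z \<in> W \<Longrightarrow> ddir (0, w) g z *v b = ddir (0, b) g z *v w"
proof (rule nondegenerate_inner)
  fix a assume z: "z \<in> W"
  have "a \<bullet> (ddir (0, w) g z *v b) = b \<bullet> (ddir (0, w) g z *v a)" by (rule ddir_g_sym[OF z])
  also have "\<dots> = w \<bullet> (ddir (0, b) g z *v a)"
    unfolding ddir_vert_g[OF z] using ddir_commute[OF open_W smooth_on_ddir[OF smooth_E] z] by simp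
  also have "\<dots> = a \<bullet> (ddir (0, b) g z *v w)" by (rule ddir_g_sym[OF z])
  finally show "a \<bullet> (ddir (0, w) g z *v b) = a \<bullet> (ddir (0, b) g z *v w)" .
qed

lemma g_cartan: "z \<in> W \<Longrightarrow> a \<bullet> (g z *v C z w u) = 1/2 * (a \<bullet> (ddir (0, w) g z *v u))"
  unfolding cartan_op_def g_inv by simp

lemma cartan_swap: "z \<in> W \<Longrightarrow> C z w u = C z u w"
  unfolding cartan_op_def by (simp add: ddir_vert_g_swap)

lemma cartan_sym: "z \<in> W \<Longrightarrow> a \<bullet> (g z *v C z w u) = u \<bullet> (g z *v C z w a)"
  unfolding g_cartan using ddir_g_sym by simp

lemma cartan_add_right: "C z w (u + v) = C z w u + C z w v"
  unfolding cartan_op_def by (simp add: algebra_simps)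

lemma cartan_scale_right: "C z w (r *\<^sub>R v) = r *\<^sub>R C z w v"
  unfolding cartan_op_def by (simp add: algebra_simps matrix_vector_mult_scaleR)

lemma cartan_add_left: "z \<in> W \<Longrightarrow> C z (u + v) w = C z u w + C z v w"
  using cartan_swap cartan_add_right by metis

lemma cartan_scale_left: "z \<in> W \<Longrightarrow> C z (r *\<^sub>R v) w = r *\<^sub>R C z v w"
  using cartan_swap cartan_scale_right by metis

subsection \<open>Homogeneity\<close>

lemma scaled_in_W: "z \<in> W \<Longrightarrow> r > 0 \<Longrightarrow> (fst z, r *\<^sub>R snd z) \<in> W"
  by auto

text \<open>The chain rule for \<open>y \<mapsto> r y\<close>, which stretches vertical directions: a vertical derivative has one
  degree of homogeneity less than the function, a horizontal one the same degree.\<close>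

lemma ddir_scaled:
  assumes "smooth_on W f" "r > 0" "z \<in> W" "\<And>z. z \<in> W \<Longrightarrow> f (fst z, r *\<^sub>R snd z) = c *\<^sub>R f z"
  shows "ddir (u, r *\<^sub>R v) f (fst z, r *\<^sub>R snd z) = c *\<^sub>R ddir (u, v) f z"
proof -
  have A: "((\<lambda>z::'n tpoint. (fst z, r *\<^sub>R snd z)) has_derivative (\<lambda>w. (fst w, r *\<^sub>R snd w))) (at z)"
    by (auto intro!: derivative_eq_intros)
  have "(fst z, r *\<^sub>R snd z) \<in> W" using assms(2,3) by auto
  then have "(f has_derivative (\<lambda>v. ddir v f (fst z, r *\<^sub>R snd z))) (at (fst z, r *\<^sub>R snd z))"
    by (rule has_derivative_ddir[OF diff_W[OF assms(1)]])
  from ddir_eq[OF has_derivative_compose[OF A this], of "(u, v)"]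
  have "ddir (u, v) (\<lambda>z. f (fst z, r *\<^sub>R snd z)) z = ddir (u, r *\<^sub>R v) f (fst z, r *\<^sub>R snd z)" by simp
  moreover have "ddir (u, v) (\<lambda>z. f (fst z, r *\<^sub>R snd z)) z = ddir (u, v) (\<lambda>z. c *\<^sub>R f z) z"
    by (rule ddir_cong[OF open_W assms(3)]) (rule assms(4))
  ultimately show ?thesis
    using ddir_scale_const[OF diff_W[OF assms(1,3)], of "(u, v)" c] by simp
qed

lemma ddir_euler:
  assumes "smooth_on W f" "z \<in> W" "\<And>r. r > 0 \<Longrightarrow> f (fst z, r *\<^sub>R snd z) = r ^ k *\<^sub>R f z"
  shows "ddir (0, snd z) f z = real k *\<^sub>R f z"
proof -
  have d: "f differentiable (at ((fst z, 0) + 1 *\<^sub>R (0, snd z)))"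
    using diff_W[OF assms(1,2)] by simp
  have "((\<lambda>r. f ((fst z, 0) + r *\<^sub>R (0, snd z))) has_vector_derivative ddir (0, snd z) f z) (at 1)"
    using ddir_along_line[OF d] by simp
  then have 1: "((\<lambda>r. r ^ k *\<^sub>R f z) has_vector_derivative ddir (0, snd z) f z) (at 1)"
    by (rule has_vector_derivative_transform_within_open[of _ _ _ "{0<..}"]) (use assms(3) in auto)
  have 2: "((\<lambda>r. r ^ k *\<^sub>R f z) has_vector_derivative real k *\<^sub>R f z) (at 1)"
    unfolding has_vector_derivative_def by (auto intro!: derivative_eq_intros)
  show ?thesis using vector_derivative_unique_at[OF 1 2] .
qed

lemma E_hom: "z \<in> W \<Longrightarrow> r > 0 \<Longrightarrow> E (fst z, r *\<^sub>R snd z) = r\<^sup>2 *\<^sub>R E z"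
  using L_hom[of "fst z" "snd z" r] by (cases z) (simp add: energy_def power_mult_distrib)

lemma ddir_scaled_vert:
  assumes "smooth_on W f" "r > 0" "z \<in> W" "\<And>z. z \<in> W \<Longrightarrow> f (fst z, r *\<^sub>R snd z) = (c * r) *\<^sub>R f z"
  shows "ddir (0, v) f (fst z, r *\<^sub>R snd z) = c *\<^sub>R ddir (0, v) f z"
proof -
  have "f differentiable (at (fst z, r *\<^sub>R snd z))"
    using diff_W[OF assms(1)] scaled_in_W assms(2,3) by blast
  from ddir_scale_dir[OF this, of r "(0, v)"]
  have "r *\<^sub>R ddir (0, v) f (fst z, r *\<^sub>R snd z) = ddir (0, r *\<^sub>R v) f (fst z, r *\<^sub>R snd z)"
    by simp
  also have "\<dots> = (c * r) *\<^sub>R ddir (0, v) f z"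
    by (rule ddir_scaled[of f r z "c * r", OF assms])
  also have "\<dots> = r *\<^sub>R (c *\<^sub>R ddir (0, v) f z)" by simp
  finally show ?thesis using assms(2) scaleR_left_imp_eq[of r] by blast
qed

lemma ddir_E_hom:
  assumes "z \<in> W" "r > 0"
  shows "ddir (0, v) E (fst z, r *\<^sub>R snd z) = r *\<^sub>R ddir (0, v) E z"
    and "ddir (u, 0) E (fst z, r *\<^sub>R snd z) = r\<^sup>2 *\<^sub>R ddir (u, 0) E z"
proof -
  show "ddir (0, v) E (fst z, r *\<^sub>R snd z) = r *\<^sub>R ddir (0, v) E z"
    by (rule ddir_scaled_vert[where f=E, OF smooth_E assms(2,1)]) (rule E_hom[OF _ assms(2), unfolded power2_eq_square])
  show "ddir (u, 0) E (fst z, r *\<^sub>R snd z) = r\<^sup>2 *\<^sub>R ddir (u, 0) E z"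
    using ddir_scaled[where f=E, OF smooth_E assms(2,1) E_hom[OF _ assms(2)], of u 0] unfolding scaleR_zero_right .
qed

lemma ddir2_E_hom:
  assumes "z \<in> W" "r > 0"
  shows "ddir (0, u) (ddir (0, v) E) (fst z, r *\<^sub>R snd z) = ddir (0, u) (ddir (0, v) E) z"
    and "ddir (u, 0) (ddir (0, v) E) (fst z, r *\<^sub>R snd z) = r *\<^sub>R ddir (u, 0) (ddir (0, v) E) z"
proof -
  note sm = smooth_on_ddir[OF smooth_E, of "(0, v)"] and hm = ddir_E_hom(1)[OF _ assms(2), of _ v]
  have "ddir (0, u) (ddir (0, v) E) (fst z, r *\<^sub>R snd z) = 1 *\<^sub>R ddir (0, u) (ddir (0, v) E) z"
    by (rule ddir_scaled_vert[where f="ddir (0, v) E", OF sm assms(2,1)]) (simp only: mult_1_left hm)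
  then show "ddir (0, u) (ddir (0, v) E) (fst z, r *\<^sub>R snd z) = ddir (0, u) (ddir (0, v) E) z"
    unfolding scaleR_one .
  show "ddir (u, 0) (ddir (0, v) E) (fst z, r *\<^sub>R snd z) = r *\<^sub>R ddir (u, 0) (ddir (0, v) E) z"
    using ddir_scaled[where f="ddir (0, v) E", OF sm assms(2,1) hm, of u 0] unfolding scaleR_zero_right .
qed

lemma g_hom: "z \<in> W \<Longrightarrow> r > 0 \<Longrightarrow> g (fst z, r *\<^sub>R snd z) = g z"
  by (simp add: vec_eq_iff g_nth ddir2_E_hom)

lemma ddir_vert_E: "z \<in> W \<Longrightarrow> ddir (0, v) E z = 2 * (snd z \<bullet> (g z *v v))"
  using ddir_euler[where f="ddir (0, v) E" and k=1 and z=z, OF smooth_on_ddir[OF smooth_E]] ddir_E_hom(1)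
  by (simp add: g_apply)

lemma E_eq: "z \<in> W \<Longrightarrow> E z = snd z \<bullet> (g z *v snd z)"
  using ddir_euler[where f=E and k=2 and z=z, OF smooth_E] E_hom ddir_vert_E[of z "snd z"] by simp

lemma E_pos: "z \<in> W \<Longrightarrow> E z > 0"
  using E_eq[of z] g_pos[of z "snd z"] by (cases z) simp

lemma ddir_snd_g: "z \<in> W \<Longrightarrow> ddir (0, snd z) g z = 0"
  using ddir_euler[where f=g and k=0 and z=z, OF smooth_g] g_hom by simp

lemma cartan_snd: "z \<in> W \<Longrightarrow> C z (snd z) u = 0" "z \<in> W \<Longrightarrow> C z u (snd z) = 0"
proof -
  show 1: "z \<in> W \<Longrightarrow> C z (snd z) u = 0" for u unfolding cartan_op_def by (simp add: ddir_snd_g)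
  then show "z \<in> W \<Longrightarrow> C z u (snd z) = 0" using cartan_swap by metis
qed

lemma cartan_orth: "z \<in> W \<Longrightarrow> snd z \<bullet> (g z *v C z u v) = 0"
  using cartan_sym[of z "snd z" u v] cartan_snd(2) by simp

lemma cartan_hom:
  assumes "z \<in> W" "r > 0"
  shows "C (fst z, r *\<^sub>R snd z) u v = (1 / r) *\<^sub>R C z u v"
proof -
  have eq: "ddir (0, r *\<^sub>R u) g (fst z, r *\<^sub>R snd z) = ddir (0, u) g z"
    using ddir_scaled[where f=g, OF smooth_g assms(2,1), of 1 0 u] g_hom assms(2) by simp
  have "r *\<^sub>R C (fst z, r *\<^sub>R snd z) u v = C (fst z, r *\<^sub>R snd z) (r *\<^sub>R u) v"
    using cartan_scale_left[OF scaled_in_W[OF assms]] by simp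
  also have "\<dots> = C z u v"
    unfolding cartan_op_def eq fund_inv_def g_hom[OF assms] ..
  finally have "(1 / r) *\<^sub>R (r *\<^sub>R C (fst z, r *\<^sub>R snd z) u v) = (1 / r) *\<^sub>R C z u v" by simp
  then show ?thesis using assms(2) by simp
qed

end

context finsler_patch
begin

subsection \<open>The spray and the Cartan connection\<close>

text \<open>Four times the spray with its index lowered.\<close>

definition spray_form :: "'n tpoint \<Rightarrow> real^'n" where
  "spray_form z = (\<chi> l. (\<Sum>k\<in>UNIV. snd z $ k * ddir (0, axis l 1) (ddir (axis k 1, 0) E) z)
     - ddir (axis l 1, 0) E z)"

lemma G_eq: "G z = (1/4) *\<^sub>R (fund_inv L z *v spray_form z)"
  by (simp add: vec_eq_iff spray_vec_def spray_def spray_form_def matrix_vector_mult_def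
      dx_def[abs_def] dy_def[abs_def] ddir_def[abs_def] energy_def[abs_def])

lemma smooth_G: "smooth_on W G"
  unfolding G_eq[abs_def] spray_form_def
  by (intro smooth_on_scaleR smooth_on_const smooth_on_matrix_vector smooth_fund_inv smooth_on_vec
      smooth_on_diff smooth_on_sum smooth_on_mult smooth_on_nth smooth_on_snd smooth_on_ident
      smooth_on_ddir smooth_E open_W)

lemma spray_form_apply:
  assumes z: "z \<in> W"
  shows "u \<bullet> spray_form z = ddir (snd z, 0) (ddir (0, u) E) z - ddir (u, 0) E z"
proof -
  note d = diff_W[OF smooth_E z] diff_W[OF smooth_on_ddir[OF smooth_E] z]
  note comm = ddir_commute[OF open_W smooth_E z]
  have "ddir (snd z, 0) (ddir (0, u) E) z = ddir (0, u) (ddir (snd z, 0) E) z"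
    by (rule comm)
  also have "\<dots> = (\<Sum>l\<in>UNIV. u $ l *\<^sub>R ddir (0, axis l 1) (ddir (snd z, 0) E) z)"
    by (rule ddir_axis_snd[OF d(2)])
  also have "\<dots> = (\<Sum>l\<in>UNIV. u $ l * (\<Sum>k\<in>UNIV. snd z $ k * ddir (0, axis l 1) (ddir (axis k 1, 0) E) z))"
  proof (intro sum.cong refl)
    fix l
    have "ddir (0, axis l 1) (ddir (snd z, 0) E) z = ddir (snd z, 0) (ddir (0, axis l 1) E) z"
      by (rule comm)
    also have "\<dots> = (\<Sum>k\<in>UNIV. snd z $ k *\<^sub>R ddir (axis k 1, 0) (ddir (0, axis l 1) E) z)"
      by (rule ddir_axis_fst[OF d(2)])
    also have "\<dots> = (\<Sum>k\<in>UNIV. snd z $ k * ddir (0, axis l 1) (ddir (axis k 1, 0) E) z)"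
      by (intro sum.cong refl) (simp add: comm[of "(axis _ 1, 0)" "(0, axis l 1)"])
    finally show "u $ l *\<^sub>R ddir (0, axis l 1) (ddir (snd z, 0) E) z
        = u $ l * (\<Sum>k\<in>UNIV. snd z $ k * ddir (0, axis l 1) (ddir (axis k 1, 0) E) z)" by simp
  qed
  finally have 1: "ddir (snd z, 0) (ddir (0, u) E) z = \<dots>" .
  have 2: "ddir (u, 0) E z = (\<Sum>l\<in>UNIV. u $ l * ddir (axis l 1, 0) E z)"
    using ddir_axis_fst[OF d(1), of u] by simp
  show ?thesis
    unfolding 1 2 by (simp add: inner_vec_def spray_form_def right_diff_distrib sum_subtractf)
qed

text \<open>The Euler--Lagrange form of the geodesic equation, which determines the spray because the
  fundamental tensor is nondegenerate.\<close>

lemma g_spray: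
  "z \<in> W \<Longrightarrow> 4 * (u \<bullet> (g z *v G z)) = ddir (snd z, 0) (ddir (0, u) E) z - ddir (u, 0) E z"
  unfolding G_eq by (simp add: matrix_vector_mult_scaleR g_inv spray_form_apply)

lemma G_hom:
  assumes z: "z \<in> W" and r: "r > 0"
  shows "G (fst z, r *\<^sub>R snd z) = r\<^sup>2 *\<^sub>R G z"
proof (rule g_nondeg[OF scaled_in_W[OF assms]])
  fix w
  note z' = scaled_in_W[OF assms]
  have "ddir (r *\<^sub>R snd z, 0) (ddir (0, w) E) (fst z, r *\<^sub>R snd z)
      = r * ddir (snd z, 0) (ddir (0, w) E) (fst z, r *\<^sub>R snd z)"
    using ddir_scale_dir[OF diff_W[OF smooth_on_ddir[OF smooth_E] z'], where r=r and a="(snd z, 0)"] by simp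
  also have "\<dots> = r\<^sup>2 * ddir (snd z, 0) (ddir (0, w) E) z"
    unfolding ddir2_E_hom(2)[OF assms] by (simp add: power2_eq_square)
  finally have "4 * (w \<bullet> (g (fst z, r *\<^sub>R snd z) *v G (fst z, r *\<^sub>R snd z)))
      = r\<^sup>2 * (ddir (snd z, 0) (ddir (0, w) E) z - ddir (w, 0) E z)"
    using g_spray[OF z', of w] ddir_E_hom(2)[OF assms, of w] by (simp add: right_diff_distrib)
  also have "\<dots> = r\<^sup>2 * (4 * (w \<bullet> (g z *v G z)))" using g_spray[OF z] by simp
  finally show "w \<bullet> (g (fst z, r *\<^sub>R snd z) *v G (fst z, r *\<^sub>R snd z))
      = w \<bullet> (g (fst z, r *\<^sub>R snd z) *v (r\<^sup>2 *\<^sub>R G z))"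
    unfolding g_hom[OF assms] by (simp add: matrix_vector_mult_scaleR)
qed

lemma nonlin_snd: "z \<in> W \<Longrightarrow> N z (snd z) = 2 *\<^sub>R G z"
  using ddir_euler[where f=G and k=2 and z=z, OF smooth_G] G_hom unfolding nonlin_op_def by simp

lemma nonlin_hom:
  assumes "z \<in> W" "r > 0"
  shows "N (fst z, r *\<^sub>R snd z) v = r *\<^sub>R N z v"
  unfolding nonlin_op_def
  by (rule ddir_scaled_vert[where f=G, OF smooth_G assms(2,1)])
    (rule G_hom[OF _ assms(2), unfolded power2_eq_square])

lemma linear_nonlin: "z \<in> W \<Longrightarrow> linear (N z)"
proof -
  assume "z \<in> W"
  note l = linear_ddir[OF diff_W[OF smooth_G this]]
  have "linear (\<lambda>u::real^'n. (0::real^'n, u))" by (intro linearI) auto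
  from linear_compose[OF this l] show "linear (N z)" by (simp add: nonlin_op_def[abs_def] o_def)
qed

text \<open>The vertical derivative of the Euler--Lagrange form.\<close>

lemma spray_derivative:
  assumes z: "z \<in> W"
  shows "4 * (u \<bullet> (ddir (0, v) g z *v G z)) + 4 * (u \<bullet> (g z *v N z v))
    = ddir (v, 0) (ddir (0, u) E) z - ddir (u, 0) (ddir (0, v) E) z + 2 * (u \<bullet> (ddir (snd z, 0) g z *v v))"
proof -
  note sE = smooth_on_ddir[OF smooth_E]
  have gG: "(\<lambda>z. g z *v G z) differentiable (at z)"
    by (rule diff_W[OF _ z]) (intro smooth_on_matrix_vector smooth_g smooth_G open_W)
  have "ddir (0, v) (\<lambda>z. 4 * (u \<bullet> (g z *v G z))) z = 4 * ddir (0, v) (\<lambda>z. u \<bullet> (g z *v G z)) z"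
    by (rule ddir_mult_const) (rule diff_W[OF _ z], intro smooth_on_inner smooth_on_const smooth_on_matrix_vector smooth_g smooth_G open_W)
  also have "ddir (0, v) (\<lambda>z. u \<bullet> (g z *v G z)) z = u \<bullet> ddir (0, v) (\<lambda>z. g z *v G z) z"
    by (rule ddir_bounded_linear[OF bounded_linear_inner_right gG])
  also have "ddir (0, v) (\<lambda>z. g z *v G z) z = g z *v N z v + ddir (0, v) g z *v G z"
    unfolding nonlin_op_def by (rule ddir_matrix_vector[OF diff_W[OF smooth_g z] diff_W[OF smooth_G z]])
  finally have 1: "ddir (0, v) (\<lambda>z. 4 * (u \<bullet> (g z *v G z))) z
      = 4 * (u \<bullet> (g z *v N z v + ddir (0, v) g z *v G z))" .
  have X: "((\<lambda>z::'n tpoint. (snd z, 0::real^'n)) has_derivative (\<lambda>w. (snd w, 0))) (at z)"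
    by (auto intro!: derivative_eq_intros)
  have "((\<lambda>z. ddir (snd z, 0) (ddir (0, u) E) z - ddir (u, 0) E z) has_derivative
     (\<lambda>w. (ddir (snd w, 0) (ddir (0, u) E) z + ddir w (ddir (snd z, 0) (ddir (0, u) E)) z)
        - ddir w (ddir (u, 0) E) z)) (at z)"
    by (intro has_derivative_diff has_derivative_ddir diff_W[OF sE z]
        has_derivative_ddir_var[OF open_W sE z X])
  from ddir_eq[OF this, of "(0, v)"]
  have 2: "ddir (0, v) (\<lambda>z. ddir (snd z, 0) (ddir (0, u) E) z - ddir (u, 0) E z) z
     = ddir (v, 0) (ddir (0, u) E) z + ddir (0, v) (ddir (snd z, 0) (ddir (0, u) E)) z
        - ddir (0, v) (ddir (u, 0) E) z" by simp
  have "ddir (0, v) (ddir (snd z, 0) (ddir (0, u) E)) z = ddir (snd z, 0) (ddir (0, v) (ddir (0, u) E)) z"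
    by (rule ddir_commute[OF open_W sE z])
  also have "\<dots> = ddir (snd z, 0) (\<lambda>z. 2 * (v \<bullet> (g z *v u))) z"
    by (rule ddir_cong[OF open_W z]) (simp add: g_apply)
  also have "\<dots> = 2 * ddir (snd z, 0) (\<lambda>z. v \<bullet> (g z *v u)) z"
    by (rule ddir_mult_const) (rule diff_W[OF _ z], intro smooth_on_inner smooth_on_const smooth_on_matrix_vector smooth_g open_W)
  also have "\<dots> = 2 * (u \<bullet> (ddir (snd z, 0) g z *v v))"
    unfolding ddir_g_apply[OF z, symmetric] using ddir_g_sym[OF z] by simp
  finally have 3: "ddir (0, v) (ddir (snd z, 0) (ddir (0, u) E)) z = 2 * (u \<bullet> (ddir (snd z, 0) g z *v v))" .
  have 4: "ddir (0, v) (ddir (u, 0) E) z = ddir (u, 0) (ddir (0, v) E) z"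
    by (rule ddir_commute[OF open_W smooth_E z])
  have "ddir (0, v) (\<lambda>z. 4 * (u \<bullet> (g z *v G z))) z
      = ddir (0, v) (\<lambda>z. ddir (snd z, 0) (ddir (0, u) E) z - ddir (u, 0) E z) z"
    by (rule ddir_cong[OF open_W z]) (rule g_spray)
  then show ?thesis unfolding 1 2 3 4 by (simp add: inner_add_right)
qed

text \<open>The symmetric part of the previous identity says that the nonlinear connection is metrical
  along the spray; the antisymmetric part identifies it with the Chern coefficients.\<close>

lemma g_derivative_along_spray:
  assumes z: "z \<in> W"
  shows "u \<bullet> (ddir (snd z, -2 *\<^sub>R G z) g z *v v) = u \<bullet> (g z *v N z v) + v \<bullet> (g z *v N z u)"
proof -
  note d = diff_W[OF smooth_g z]
  have "ddir (snd z, -2 *\<^sub>R G z) g z = ddir (snd z, 0) g z + ddir (0, -2 *\<^sub>R G z) g z"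
    by (rule ddir_split[OF d])
  also have "ddir (0, -2 *\<^sub>R G z) g z = -2 *\<^sub>R ddir (0, G z) g z"
    using ddir_scale_dir[OF d, of "-2" "(0, G z)"] by simp
  finally have 1: "u \<bullet> (ddir (snd z, -2 *\<^sub>R G z) g z *v v)
      = u \<bullet> (ddir (snd z, 0) g z *v v) - 2 * (u \<bullet> (ddir (0, G z) g z *v v))"
    by (simp add: matrix_vector_mult_add_rdistrib matrix_vector_mult_diff_rdistrib
        scaleR_matrix_vector_assoc[symmetric] inner_simps)
  have 2: "u \<bullet> (ddir (0, v) g z *v G z) = u \<bullet> (ddir (0, G z) g z *v v)"
    "v \<bullet> (ddir (0, u) g z *v G z) = u \<bullet> (ddir (0, G z) g z *v v)"
    using ddir_vert_g_swap[OF z] ddir_g_sym[OF z] by metis+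
  have 3: "v \<bullet> (ddir (snd z, 0) g z *v u) = u \<bullet> (ddir (snd z, 0) g z *v v)"
    by (rule ddir_g_sym[OF z])
  show ?thesis
    using spray_derivative[OF z, of u v] spray_derivative[OF z, of v u] unfolding 1 2 3 by argo
qed

abbreviation hder :: "real^'n \<Rightarrow> 'n tpoint \<Rightarrow> real^'n^'n" where
  "hder u z \<equiv> ddir (u, - N z u) g z"

lemma nonlin_axis: "z \<in> W \<Longrightarrow> nonlin L r i z = N z (axis i 1) $ r"
  unfolding nonlin_def dy_def nonlin_op_def ddir_def[symmetric]
  using ddir_bounded_linear[OF bounded_linear_vec_nth diff_W[OF smooth_G], of z "(0, axis i 1)" r]
  by (simp add: spray_vec_def)

lemma nonlin_sum: "z \<in> W \<Longrightarrow> (\<Sum>j\<in>UNIV. nonlin L r j z * u $ j) = N z u $ r"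
proof -
  assume z: "z \<in> W"
  have "N z u = N z (\<Sum>j\<in>UNIV. u $ j *\<^sub>R axis j 1)" by (simp add: vec_axis_sum[symmetric])
  also have "\<dots> = (\<Sum>j\<in>UNIV. u $ j *\<^sub>R N z (axis j 1))"
    using linear_sum[OF linear_nonlin[OF z], of "\<lambda>j. u $ j *\<^sub>R axis j 1" UNIV]
      linear_scale[OF linear_nonlin[OF z]] by simp
  finally show ?thesis by (simp add: nonlin_axis[OF z] mult.commute)
qed

lemma delta_g:
  assumes z: "z \<in> W"
  shows "delta L i (\<lambda>z. g z $ j $ l) z = hder (axis i 1) z $ j $ l"
proof -
  have bl: "bounded_linear (\<lambda>A :: real^'n^'n. A $ j $ l)"
    by (rule bounded_linear_compose[OF bounded_linear_vec_nth bounded_linear_vec_nth])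
  have nth: "ddir w (\<lambda>z. g z $ j $ l) z = ddir w g z $ j $ l" for w
    by (rule ddir_bounded_linear[OF bl diff_W[OF smooth_g z]])
  note d = diff_W[OF smooth_g z]
  have "ddir (0, - N z (axis i 1)) g z = - ddir (0, N z (axis i 1)) g z"
    using ddir_minus_dir[OF d, of "(0, N z (axis i 1))"] by simp
  then have "hder (axis i 1) z = ddir (axis i 1, 0) g z - ddir (0, N z (axis i 1)) g z"
    using ddir_split[OF d, of "axis i 1" "- N z (axis i 1)"] by simp
  also have "ddir (0, N z (axis i 1)) g z = (\<Sum>r\<in>UNIV. nonlin L r i z *\<^sub>R ddir (0, axis r 1) g z)"
    using ddir_axis_snd[OF d, of "N z (axis i 1)"] nonlin_axis[OF z] by simp
  finally show ?thesis
    unfolding delta_def dx_def dy_def ddir_def[symmetric] nth by simp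
qed

lemma hder_sum:
  assumes z: "z \<in> W"
  shows "hder u z = (\<Sum>i\<in>UNIV. u $ i *\<^sub>R hder (axis i 1) z)"
proof -
  have lin: "linear (\<lambda>u. (u, - N z u))"
    using linear_nonlin[OF z] by (intro linearI) (auto simp: linear_add linear_scale)
  have l: "linear (\<lambda>u. hder u z)"
    using linear_compose[OF lin linear_ddir[OF diff_W[OF smooth_g z]]] by (simp add: o_def)
  have "hder u z = hder (\<Sum>i\<in>UNIV. u $ i *\<^sub>R axis i 1) z" by (simp add: vec_axis_sum[symmetric])
  also have "\<dots> = (\<Sum>i\<in>UNIV. hder (u $ i *\<^sub>R axis i 1) z)"
    by (rule linear_sum[OF l])
  also have "\<dots> = (\<Sum>i\<in>UNIV. u $ i *\<^sub>R hder (axis i 1) z)"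
    by (intro sum.cong refl linear_scale[OF l])
  finally show ?thesis .
qed

lemma inner_hder_sum:
  assumes z: "z \<in> W"
  shows "a \<bullet> (hder u z *v b) = (\<Sum>i\<in>UNIV. u $ i * (a \<bullet> (hder (axis i 1) z *v b)))"
proof -
  have bl: "linear (\<lambda>A :: real^'n^'n. a \<bullet> (A *v b))"
    by (intro linearI) (simp_all add: matrix_vector_mult_add_rdistrib inner_simps scaleR_matrix_vector_assoc[symmetric])
  have "a \<bullet> (hder u z *v b) = a \<bullet> ((\<Sum>i\<in>UNIV. u $ i *\<^sub>R hder (axis i 1) z) *v b)"
    using hder_sum[OF z, of u] by simp
  also have "\<dots> = (\<Sum>i\<in>UNIV. a \<bullet> ((u $ i *\<^sub>R hder (axis i 1) z) *v b))"
    by (rule linear_sum[OF bl])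
  also have "\<dots> = (\<Sum>i\<in>UNIV. u $ i * (a \<bullet> (hder (axis i 1) z *v b)))"
    by (simp add: scaleR_matrix_vector_assoc[symmetric])
  finally show ?thesis .
qed

lemma g_chern:
  assumes z: "z \<in> W"
  shows "2 * (w \<bullet> (g z *v chern L z u v))
    = v \<bullet> (hder u z *v w) + u \<bullet> (hder v z *v w) - u \<bullet> (hder w z *v v)"
proof -
  define D where "D i = hder (axis i 1) z" for i
  define b where "b = (\<chi> l. \<Sum>i\<in>UNIV. \<Sum>j\<in>UNIV. u $ i * v $ j * (D i $ j $ l + D j $ i $ l - D l $ i $ j))"
  have "chern L z u v = (1/2) *\<^sub>R (fund_inv L z *v b)"
  proof (rule vec_eq_iff[THEN iffD2], rule)
    fix k
    have "chern L z u v $ k = (\<Sum>i\<in>UNIV. \<Sum>j\<in>UNIV. \<Sum>l\<in>UNIV.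
        1/2 * (fund_inv L z $ k $ l * (u $ i * v $ j * (D i $ j $ l + D j $ i $ l - D l $ i $ j))))"
      unfolding chern_def Gam_def delta_g[OF z] D_def[symmetric]
      by (simp add: sum_distrib_left mult_ac)
    also have "\<dots> = (\<Sum>i\<in>UNIV. \<Sum>l\<in>UNIV. \<Sum>j\<in>UNIV.
        1/2 * (fund_inv L z $ k $ l * (u $ i * v $ j * (D i $ j $ l + D j $ i $ l - D l $ i $ j))))"
      by (intro sum.cong refl sum.swap)
    also have "\<dots> = (\<Sum>l\<in>UNIV. \<Sum>i\<in>UNIV. \<Sum>j\<in>UNIV.
        1/2 * (fund_inv L z $ k $ l * (u $ i * v $ j * (D i $ j $ l + D j $ i $ l - D l $ i $ j))))"
      by (rule sum.swap)
    also have "\<dots> = ((1/2) *\<^sub>R (fund_inv L z *v b)) $ k"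
      by (simp add: matrix_vector_mult_def b_def sum_distrib_left)
    finally show "chern L z u v $ k = ((1/2) *\<^sub>R (fund_inv L z *v b)) $ k" .
  qed
  then have "2 * (w \<bullet> (g z *v chern L z u v)) = w \<bullet> b"
    by (simp add: matrix_vector_mult_scaleR g_inv[OF z])
  also have "\<dots> = (\<Sum>l\<in>UNIV. \<Sum>i\<in>UNIV. \<Sum>j\<in>UNIV. w $ l * (u $ i * v $ j * D i $ j $ l))
     + (\<Sum>l\<in>UNIV. \<Sum>i\<in>UNIV. \<Sum>j\<in>UNIV. w $ l * (u $ i * v $ j * D j $ i $ l))
     - (\<Sum>l\<in>UNIV. \<Sum>i\<in>UNIV. \<Sum>j\<in>UNIV. w $ l * (u $ i * v $ j * D l $ i $ j))"
    by (simp add: inner_vec_def b_def sum_distrib_left ring_distribs sum.distrib sum_subtractf)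
  also have "(\<Sum>l\<in>UNIV. \<Sum>i\<in>UNIV. \<Sum>j\<in>UNIV. w $ l * (u $ i * v $ j * D i $ j $ l)) = v \<bullet> (hder u z *v w)"
  proof -
    have "v \<bullet> (hder u z *v w) = (\<Sum>i\<in>UNIV. \<Sum>j\<in>UNIV. \<Sum>l\<in>UNIV. w $ l * (u $ i * v $ j * D i $ j $ l))"
      by (subst inner_hder_sum[OF z]) (simp add: inner_matrix_sum D_def sum_distrib_left mult_ac)
    also have "\<dots> = (\<Sum>i\<in>UNIV. \<Sum>l\<in>UNIV. \<Sum>j\<in>UNIV. w $ l * (u $ i * v $ j * D i $ j $ l))"
      by (intro sum.cong refl sum.swap)
    also have "\<dots> = (\<Sum>l\<in>UNIV. \<Sum>i\<in>UNIV. \<Sum>j\<in>UNIV. w $ l * (u $ i * v $ j * D i $ j $ l))"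
      by (rule sum.swap)
    finally show ?thesis by simp
  qed
  also have "(\<Sum>l\<in>UNIV. \<Sum>i\<in>UNIV. \<Sum>j\<in>UNIV. w $ l * (u $ i * v $ j * D j $ i $ l)) = u \<bullet> (hder v z *v w)"
  proof -
    have "u \<bullet> (hder v z *v w) = (\<Sum>j\<in>UNIV. \<Sum>i\<in>UNIV. \<Sum>l\<in>UNIV. w $ l * (u $ i * v $ j * D j $ i $ l))"
      by (subst inner_hder_sum[OF z]) (simp add: inner_matrix_sum D_def sum_distrib_left mult_ac)
    also have "\<dots> = (\<Sum>i\<in>UNIV. \<Sum>j\<in>UNIV. \<Sum>l\<in>UNIV. w $ l * (u $ i * v $ j * D j $ i $ l))"
      by (rule sum.swap)
    also have "\<dots> = (\<Sum>i\<in>UNIV. \<Sum>l\<in>UNIV. \<Sum>j\<in>UNIV. w $ l * (u $ i * v $ j * D j $ i $ l))"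
      by (intro sum.cong refl sum.swap)
    also have "\<dots> = (\<Sum>l\<in>UNIV. \<Sum>i\<in>UNIV. \<Sum>j\<in>UNIV. w $ l * (u $ i * v $ j * D j $ i $ l))"
      by (rule sum.swap)
    finally show ?thesis by simp
  qed
  also have "(\<Sum>l\<in>UNIV. \<Sum>i\<in>UNIV. \<Sum>j\<in>UNIV. w $ l * (u $ i * v $ j * D l $ i $ j)) = u \<bullet> (hder w z *v v)"
    by (subst inner_hder_sum[OF z]) (simp add: inner_matrix_sum D_def sum_distrib_left mult_ac)
  finally show ?thesis .
qed

lemma hder_sym: "z \<in> W \<Longrightarrow> a \<bullet> (hder u z *v b) = b \<bullet> (hder u z *v a)"
  by (rule ddir_g_sym)

lemma chern_sym: "z \<in> W \<Longrightarrow> chern L z u v = chern L z v u"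
proof (rule g_nondeg)
  fix w assume z: "z \<in> W"
  show "w \<bullet> (g z *v chern L z u v) = w \<bullet> (g z *v chern L z v u)"
    using g_chern[OF z, of w u v] g_chern[OF z, of w v u] hder_sym[OF z, of u w v] by linarith
qed

text \<open>The horizontal part of the connection is metrical.\<close>

lemma g_hder:
  assumes "z \<in> W"
  shows "v \<bullet> (hder u z *v w) = v \<bullet> (g z *v chern L z u w) + w \<bullet> (g z *v chern L z u v)"
  using g_chern[OF assms, of v u w] g_chern[OF assms, of w u v] hder_sym[OF assms, of v u w]
    hder_sym[OF assms, of u w v] hder_sym[OF assms, of u v w] by linarith

lemma g_frozen_snd:
  assumes z: "z \<in> W"
  shows "snd z \<bullet> (ddir (u, q) g z *v w) = 1/2 * ddir (u, 0) (ddir (0, w) E) z"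
proof -
  note sE = smooth_on_ddir[OF smooth_E] and d = diff_W[OF smooth_g z]
  have dgw: "(\<lambda>z. g z *v w) differentiable (at z)"
    by (rule diff_W[OF _ z]) (intro smooth_on_matrix_vector smooth_g smooth_on_const open_W)
  have "ddir (u, 0) (\<lambda>z. snd z \<bullet> (g z *v w)) z
      = snd z \<bullet> ddir (u, 0) (\<lambda>z. g z *v w) z + ddir (u, 0) snd z \<bullet> (g z *v w)"
    by (rule ddir_inner[OF _ dgw]) (simp add: bounded_linear_imp_differentiable bounded_linear_snd)
  also have "ddir (u, 0) (\<lambda>z. g z *v w) z = ddir (u, 0) g z *v w"
    using ddir_matrix_vector[OF d, of "\<lambda>_. w" "(u, 0)"] by (simp add: ddir_const)
  finally have 1: "snd z \<bullet> (ddir (u, 0) g z *v w) = ddir (u, 0) (\<lambda>z. snd z \<bullet> (g z *v w)) z"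
    by (simp add: ddir_snd)
  also have "\<dots> = ddir (u, 0) (\<lambda>z. 1/2 * ddir (0, w) E z) z"
    by (rule ddir_cong[OF open_W z]) (simp add: ddir_vert_E)
  also have "\<dots> = 1/2 * ddir (u, 0) (ddir (0, w) E) z"
    by (rule ddir_mult_const[OF diff_W[OF sE z]])
  finally have 2: "snd z \<bullet> (ddir (u, 0) g z *v w) = 1/2 * ddir (u, 0) (ddir (0, w) E) z" .
  have "ddir (0, q) g z *v snd z = 0"
    using ddir_vert_g_swap[OF z, of q "snd z"] ddir_snd_g[OF z] by simp
  then have "snd z \<bullet> (ddir (0, q) g z *v w) = 0" using ddir_g_sym[OF z, of "snd z" "(0, q)" w] by simp
  then show ?thesis
    using ddir_split[OF d, of u q] 2 by (simp add: matrix_vector_mult_add_rdistrib inner_simps)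
qed

text \<open>Contracting the Chern coefficients with the line element leaves a term that is metrical along the
  spray and a term antisymmetric in the remaining vectors; both are parts of the derivative of the
  spray, and together they give the nonlinear connection.\<close>

lemma chern_snd:
  assumes z: "z \<in> W"
  shows "chern L z u (snd z) = N z u"
proof (rule g_nondeg[OF z])
  fix w
  have "- N z (snd z) = -2 *\<^sub>R G z" using nonlin_snd[OF z] by simp
  then have 1: "u \<bullet> (hder (snd z) z *v w) = u \<bullet> (g z *v N z w) + w \<bullet> (g z *v N z u)"
    using g_derivative_along_spray[OF z] by simp
  have 2: "snd z \<bullet> (hder u z *v w) = 1/2 * ddir (u, 0) (ddir (0, w) E) z"
    by (rule g_frozen_snd[OF z])
  have 3: "u \<bullet> (hder w z *v snd z) = 1/2 * ddir (w, 0) (ddir (0, u) E) z"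
    using g_frozen_snd[OF z, of w "- N z w" u] hder_sym[OF z] by simp
  have sw: "u \<bullet> (ddir (0, w) g z *v G z) = w \<bullet> (ddir (0, u) g z *v G z)"
    using ddir_vert_g_swap[OF z] ddir_g_sym[OF z] by metis
  have 4: "u \<bullet> (ddir (snd z, 0) g z *v w) = w \<bullet> (ddir (snd z, 0) g z *v u)"
    by (rule ddir_g_sym[OF z])
  show "w \<bullet> (g z *v chern L z u (snd z)) = w \<bullet> (g z *v N z u)"
    using g_chern[OF z, of w u "snd z"] spray_derivative[OF z, of w u] spray_derivative[OF z, of u w]
    unfolding 1 2 3 4 sw by argo
qed

lemma vert_part_eq: "z \<in> W \<Longrightarrow> vert_part L z A = snd A + N z (fst A)"
  by (simp add: vec_eq_iff vert_part_def nonlin_sum)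

lemma cartan_op_sum:
  assumes z: "z \<in> W"
  shows "(\<chi> k. \<Sum>i\<in>UNIV. \<Sum>j\<in>UNIV. u $ i * (w $ j * cartan_up L k i j z)) = C z w u"
proof -
  have bl: "bounded_linear (\<lambda>A :: real^'n^'n. A $ i $ j)" for i j
    by (rule bounded_linear_compose[OF bounded_linear_vec_nth bounded_linear_vec_nth])
  have car: "cartan L i j l z = 1/2 * (ddir (0, axis j 1) g z $ l $ i)" for i j l
  proof -
    have "cartan L i j l z = 1/2 * (ddir (0, axis l 1) g z $ i $ j)"
      unfolding cartan_def dy_def ddir_def[symmetric]
      using ddir_bounded_linear[OF bl diff_W[OF smooth_g z]] by simp
    also have "ddir (0, axis l 1) g z $ i $ j = axis i 1 \<bullet> (ddir (0, axis l 1) g z *v axis j 1)"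
      by (simp add: matrix_vector_mult_basis column_def inner_axis')
    also have "\<dots> = axis l 1 \<bullet> (ddir (0, axis j 1) g z *v axis i 1)"
      using ddir_vert_g_swap[OF z] ddir_g_sym[OF z] by metis
    also have "\<dots> = ddir (0, axis j 1) g z $ l $ i"
      by (simp add: matrix_vector_mult_basis column_def inner_axis')
    finally show ?thesis .
  qed
  have dw: "ddir (0, w) g z = (\<Sum>j\<in>UNIV. w $ j *\<^sub>R ddir (0, axis j 1) g z)"
    by (rule ddir_axis_snd[OF diff_W[OF smooth_g z]])
  show ?thesis
  proof (rule vec_eq_iff[THEN iffD2], rule)
    fix k
    have "C z w u $ k = (\<Sum>l\<in>UNIV. \<Sum>i\<in>UNIV. \<Sum>j\<in>UNIV.
        fund_inv L z $ k $ l * (1/2 * (w $ j * ddir (0, axis j 1) g z $ l $ i * u $ i)))"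
      unfolding cartan_op_def dw
      by (simp add: matrix_vector_mult_def sum_distrib_left sum_distrib_right)
    also have "\<dots> = (\<Sum>i\<in>UNIV. \<Sum>l\<in>UNIV. \<Sum>j\<in>UNIV.
        fund_inv L z $ k $ l * (1/2 * (w $ j * ddir (0, axis j 1) g z $ l $ i * u $ i)))"
      by (rule sum.swap)
    also have "\<dots> = (\<Sum>i\<in>UNIV. \<Sum>j\<in>UNIV. \<Sum>l\<in>UNIV.
        fund_inv L z $ k $ l * (1/2 * (w $ j * ddir (0, axis j 1) g z $ l $ i * u $ i)))"
      by (intro sum.cong refl sum.swap)
    also have "\<dots> = (\<Sum>i\<in>UNIV. \<Sum>j\<in>UNIV. u $ i * (w $ j * cartan_up L k i j z))"
      unfolding cartan_up_def car by (simp add: sum_distrib_left mult_ac)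
    finally show "(\<chi> k. \<Sum>i\<in>UNIV. \<Sum>j\<in>UNIV. u $ i * (w $ j * cartan_up L k i j z)) $ k = C z w u $ k"
      by simp
  qed
qed

lemma conn_form_eq:
  assumes z: "z \<in> W"
  shows "conn_form L z A u = chern L z u (fst A) + C z (snd A + N z (fst A)) u"
  unfolding cartan_op_sum[OF z, symmetric] conn_form_def vert_part_eq[OF z] chern_def
  by (simp add: vec_eq_iff ring_distribs sum.distrib mult_ac)

text \<open>Along a lifted curve the Cartan connection only involves the nonlinear connection and the
  Cartan tensor applied to the acceleration.\<close>

lemma conn_form_lift:
  assumes z: "z \<in> W"
  shows "conn_form L z (snd z, q) u = N z u + C z (q + 2 *\<^sub>R G z) u"
  unfolding conn_form_eq[OF z] by (simp add: chern_snd[OF z] nonlin_snd[OF z])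

lemma hlift_eq: "z \<in> W \<Longrightarrow> hlift L u z = (u, - N z u)"
  by (simp add: hlift_def vec_eq_iff nonlin_sum)

text \<open>This is why geodesic circles keep unit speed and why the parallel transport of a Berwald structure
  preserves the Finsler function.\<close>

lemma ddir_horizontal_E:
  assumes z: "z \<in> W"
  shows "ddir (u, - N z u) E z = 0"
proof -
  note d = diff_W[OF smooth_E z] and dg = diff_W[OF smooth_g z]
  have "ddir (u, 0) E z = ddir (u, 0) (\<lambda>z. snd z \<bullet> (g z *v snd z)) z"
    by (rule ddir_cong[OF open_W z]) (rule E_eq)
  also have "\<dots> = snd z \<bullet> ddir (u, 0) (\<lambda>z. g z *v snd z) z + ddir (u, 0) snd z \<bullet> (g z *v snd z)"
    by (rule ddir_inner, simp add: bounded_linear_imp_differentiable bounded_linear_snd)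
      (rule diff_W[OF _ z], intro smooth_on_matrix_vector smooth_g smooth_on_snd smooth_on_ident open_W)
  also have "ddir (u, 0) (\<lambda>z. g z *v snd z) z = g z *v ddir (u, 0) snd z + ddir (u, 0) g z *v snd z"
    by (rule ddir_matrix_vector[OF dg]) (simp add: bounded_linear_imp_differentiable bounded_linear_snd)
  finally have 1: "ddir (u, 0) E z = snd z \<bullet> (ddir (u, 0) g z *v snd z)" by (simp add: ddir_snd)
  have "snd z \<bullet> (hder u z *v snd z) = snd z \<bullet> (ddir (u, 0) g z *v snd z)"
    using g_frozen_snd[OF z, of u "- N z u" "snd z"] g_frozen_snd[OF z, of u 0 "snd z"] by simp
  moreover have "snd z \<bullet> (hder u z *v snd z) = 2 * (snd z \<bullet> (g z *v N z u))"
    using g_hder[OF z, of "snd z" u "snd z"] chern_snd[OF z] by simp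
  moreover have "ddir (0, - N z u) E z = - 2 * (snd z \<bullet> (g z *v N z u))"
    using ddir_minus_dir[OF d, of "(0, N z u)"] ddir_vert_E[OF z, of "N z u"] by simp
  ultimately show ?thesis using ddir_split[OF d, of u "- N z u"] 1 by simp
qed

end

section \<open>Geodesic circles in a coordinate patch\<close>

abbreviation vel :: "(real \<Rightarrow> 'a::real_normed_vector) \<Rightarrow> real \<Rightarrow> 'a" where
  "vel x t \<equiv> vector_derivative x (at t)"

definition lift :: "(real \<Rightarrow> real^'n) \<Rightarrow> real \<Rightarrow> 'n::finite tpoint" where
  "lift x t = (x t, vel x t)"

text \<open>The covariant acceleration \<open>c''\<close> and the equation \<open>c''' + |c''|^2 c' = 0\<close>, with the Cartan
  connection along the lift written out as in \<open>conn_form_lift\<close>.\<close>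

definition circle_acc :: "('n::finite tpoint \<Rightarrow> real) \<Rightarrow> (real \<Rightarrow> real^'n) \<Rightarrow> real \<Rightarrow> real^'n" where
  "circle_acc L x t = vel (vel x) t + 2 *\<^sub>R spray_vec L (lift x t)"

definition circle_eq :: "('n::finite tpoint \<Rightarrow> real) \<Rightarrow> (real \<Rightarrow> real^'n) \<Rightarrow> real \<Rightarrow> bool" where
  "circle_eq L x t \<longleftrightarrow> vel (circle_acc L x) t + nonlin_op L (lift x t) (circle_acc L x t)
     + cartan_op L (lift x t) (circle_acc L x t) (circle_acc L x t)
     + metric L (lift x t) (circle_acc L x t) (circle_acc L x t) *\<^sub>R vel x t = 0"

definition regular_curve :: "(real^'n::finite) set \<Rightarrow> real set \<Rightarrow> (real \<Rightarrow> real^'n) \<Rightarrow> bool" where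
  "regular_curve U I x \<longleftrightarrow> open I \<and> smooth_on I x \<and> (\<forall>t\<in>I. x t \<in> U \<and> vel x t \<noteq> 0)"

lemma vel_cong:
  assumes "open I" "t \<in> I" "\<And>s. s \<in> I \<Longrightarrow> f s = g s"
  shows "vel f t = vel g t"
proof -
  have "(f has_vector_derivative D) (at t) \<longleftrightarrow> (g has_vector_derivative D) (at t)" for D
    using has_vector_derivative_transform_within_open[where f=f and f'=D, OF _ assms(1,2)]
      has_vector_derivative_transform_within_open[where f=g and f'=D, OF _ assms(1,2)] assms(3) by metis
  then show ?thesis unfolding vector_derivative_def by simp
qed

lemma smooth_on_has_vel:
  assumes "smooth_on I x" "t \<in> I"
  shows "(x has_vector_derivative vel x t) (at t)"
  using smooth_on_differentiable[OF assms] by (simp add: vector_derivative_works)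

lemma smooth_on_vel:
  assumes "open I" "smooth_on I x"
  shows "smooth_on I (vel x)"
proof (rule smooth_on_cong[OF assms(1) _ smooth_on_ddir[OF assms(2), of 1]])
  fix t assume "t \<in> I"
  then show "ddir 1 x t = vel x t"
    using ddir_eq[OF smooth_on_has_vel[OF assms(2), unfolded has_vector_derivative_def]] by simp
qed

lemma ddir_along_curve:
  assumes "f differentiable (at (z t))" "(z has_vector_derivative z') (at t)"
  shows "((\<lambda>t. f (z t)) has_vector_derivative ddir z' f (z t)) (at t)"
proof -
  have "((\<lambda>t. f (z t)) has_derivative (\<lambda>h. ddir (h *\<^sub>R z') f (z t))) (at t)"
    using has_derivative_compose[OF assms(2)[unfolded has_vector_derivative_def] has_derivative_ddir[OF assms(1)]] .
  then show ?thesis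
    unfolding has_vector_derivative_def by (simp add: ddir_scale_dir[OF assms(1)])
qed

lemma regular_curve_lift:
  assumes "regular_curve U I x"
  shows "smooth_on I (lift x)"
    and "t \<in> I \<Longrightarrow> (lift x has_vector_derivative (vel x t, vel (vel x) t)) (at t)"
    and "t \<in> I \<Longrightarrow> lift x t \<in> U \<times> (-{0})"
proof -
  have I: "open I" "smooth_on I x" "smooth_on I (vel x)"
    using assms smooth_on_vel by (auto simp: regular_curve_def)
  show "smooth_on I (lift x)"
    unfolding lift_def[abs_def] by (intro smooth_on_Pair I)
  show "t \<in> I \<Longrightarrow> (lift x has_vector_derivative (vel x t, vel (vel x) t)) (at t)"
    unfolding lift_def[abs_def] by (intro has_vector_derivative_Pair smooth_on_has_vel[of I] I)
  show "t \<in> I \<Longrightarrow> lift x t \<in> U \<times> (-{0})"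
    using assms by (auto simp: regular_curve_def lift_def)
qed

context finsler_patch
begin

lemma smooth_circle_acc:
  assumes "regular_curve U I x"
  shows "smooth_on I (circle_acc L x)"
proof -
  have I: "open I" "smooth_on I x" using assms by (auto simp: regular_curve_def)
  have "smooth_on I (\<lambda>t. G (lift x t))"
    by (rule smooth_on_compose[OF smooth_G regular_curve_lift(1)[OF assms] I(1) open_W
          regular_curve_lift(3)[OF assms]])
  then show ?thesis
    unfolding circle_acc_def[abs_def]
    by (intro smooth_on_add smooth_on_scaleR smooth_on_const smooth_on_vel I)
qed

lemma cov_deriv_lift:
  fixes a :: "('m, 'n) chart" and c :: "real \<Rightarrow> 'm"
  defines "x \<equiv> chart_map a \<circ> c"
  assumes "regular_curve U I x" "t \<in> I"
  shows "cov_deriv L a c \<xi> t = vel \<xi> t + N (lift x t) (\<xi> t) + C (lift x t) (circle_acc L x t) (\<xi> t)"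
proof -
  have cl: "chart_lift a c = lift x"
    by (simp add: fun_eq_iff chart_lift_def lift_def chart_vel_def x_def)
  have "vector_derivative (lift x) (at t) = (snd (lift x t), vel (vel x) t)"
    using vector_derivative_at[OF regular_curve_lift(2)[OF assms(2,3)]] by (simp add: lift_def)
  then show ?thesis
    unfolding cov_deriv_def cl
    by (simp add: conn_form_lift[OF regular_curve_lift(3)[OF assms(2,3)]] circle_acc_def add.assoc)
qed

lemma circle_eq_chart:
  fixes a :: "('m, 'n) chart" and c :: "real \<Rightarrow> 'm"
  defines "x \<equiv> chart_map a \<circ> c"
  assumes "regular_curve U I x" "s \<in> I"
  shows "(let c1 = chart_vel a c; c2 = cov_deriv L a c c1; c3 = cov_deriv L a c c2
      in c3 s + metric L (chart_lift a c s) (c2 s) (c2 s) *\<^sub>R c1 s = 0) \<longleftrightarrow> circle_eq L x s"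
proof -
  have I: "open I" using assms by (simp add: regular_curve_def)
  have c1: "chart_vel a c = vel x" by (simp add: fun_eq_iff chart_vel_def x_def)
  have cl: "chart_lift a c s = lift x s" by (simp add: chart_lift_def lift_def chart_vel_def x_def)
  have c2: "cov_deriv L a c (vel x) t = circle_acc L x t" if "t \<in> I" for t
  proof -
    note z = regular_curve_lift(3)[OF assms(2) that]
    have "snd (lift x t) = vel x t" by (simp add: lift_def)
    then show ?thesis
      using cov_deriv_lift[OF assms(2)[unfolded x_def] that, of "vel x"] nonlin_snd[OF z]
        cartan_snd(2)[OF z, of "circle_acc L x t"]
      by (simp add: circle_acc_def x_def)
  qed
  have "vel (cov_deriv L a c (vel x)) s = vel (circle_acc L x) s"
    by (rule vel_cong[OF I assms(3) c2])
  then show ?thesis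
    using cov_deriv_lift[OF assms(2)[unfolded x_def] assms(3), of "cov_deriv L a c (vel x)"]
    unfolding c1 cl Let_def circle_eq_def
    by (simp add: c2[OF assms(3)] x_def[symmetric])
qed

lemma unit_speed_orth:
  assumes "regular_curve U I x" "\<And>t. t \<in> I \<Longrightarrow> L (lift x t) = 1" "t \<in> I"
  shows "vel x t \<bullet> (g (lift x t) *v circle_acc L x t) = 0"
proof -
  let ?z = "lift x t"
  have I: "open I" using assms by (simp add: regular_curve_def)
  note z = regular_curve_lift(3)[OF assms(1,3)]
  note d = diff_W[OF smooth_E z]
  have sz: "snd ?z = vel x t" by (simp add: lift_def)
  have "((\<lambda>t. E (lift x t)) has_vector_derivative ddir (vel x t, vel (vel x) t) E ?z) (at t)"
    by (rule ddir_along_curve[OF d regular_curve_lift(2)[OF assms(1,3)]])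
  moreover have "((\<lambda>t. E (lift x t)) has_vector_derivative 0) (at t)"
    by (rule has_vector_derivative_transform_within_open[OF has_vector_derivative_const I assms(3)])
      (simp add: energy_def assms(2))
  ultimately have 0: "ddir (vel x t, vel (vel x) t) E ?z = 0"
    by (rule vector_derivative_unique_at)
  have "(vel x t, vel (vel x) t) = (snd ?z, - N ?z (snd ?z)) + (0, circle_acc L x t)"
    using nonlin_snd[OF z] by (simp add: circle_acc_def sz)
  then have "ddir (vel x t, vel (vel x) t) E ?z
      = ddir (snd ?z, - N ?z (snd ?z)) E ?z + ddir (0, circle_acc L x t) E ?z"
    by (simp only: ddir_add_dir[OF d])
  then have "ddir (0, circle_acc L x t) E ?z = 0"
    unfolding 0 ddir_horizontal_E[OF z] by simp
  then show ?thesis using ddir_vert_E[OF z] sz by simp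
qed

end

subsection \<open>Conformal changes\<close>

locale conformal_patch = finsler_patch U L for U :: "(real^'n::finite) set" and L +
  fixes \<sigma> :: "real^'n \<Rightarrow> real"
  assumes smooth_\<sigma>: "smooth_on U \<sigma>"
begin

abbreviation "L' \<equiv> \<lambda>z. exp (\<sigma> (fst z)) * L z"
abbreviation "\<phi> \<equiv> \<lambda>z :: 'n tpoint. exp (2 * \<sigma> (fst z))"

text \<open>The gradient \<open>S\<close> of the conformal factor is taken with the fundamental tensor, so it depends a
  priori on the line element and not only on the point.\<close>

definition ds :: "real^'n \<Rightarrow> real^'n \<Rightarrow> real" where
  "ds x v = ddir v \<sigma> x"

definition S :: "'n tpoint \<Rightarrow> real^'n" where
  "S z = fund_inv L z *v (\<chi> i. ds (fst z) (axis i 1))"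

lemma smooth_\<sigma>_fst: "smooth_on W (\<lambda>z. \<sigma> (fst z))"
  by (rule smooth_on_compose[OF smooth_\<sigma> _ open_W open_U])
    (auto intro!: smooth_on_fst smooth_on_ident open_W)

lemma smooth_\<phi>: "smooth_on W \<phi>"
  by (intro smooth_on_exp smooth_on_mult smooth_on_const smooth_\<sigma>_fst open_W)

lemma ddir_\<phi>: "z \<in> W \<Longrightarrow> ddir w \<phi> z = 2 * \<phi> z * ds (fst z) (fst w)"
proof -
  assume z: "z \<in> W"
  have "\<sigma> differentiable (at (fst z))" using smooth_on_differentiable[OF smooth_\<sigma>] z by auto
  note h = has_derivative_compose[OF has_derivative_fst[OF has_derivative_ident] has_derivative_ddir[OF this]]
  have "((\<lambda>z. 2 * \<sigma> (fst z)) has_derivative (\<lambda>w. 2 * ddir (fst w) \<sigma> (fst z))) (at z)"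
    by (intro has_derivative_mult_right h)
  from ddir_eq[OF has_derivative_exp[OF this], of w] show ?thesis by (simp add: ds_def)
qed

lemma linear_ds: "x \<in> U \<Longrightarrow> linear (ds x)"
  unfolding ds_def[abs_def] using linear_ddir smooth_on_differentiable[OF smooth_\<sigma>] by blast

lemma g_S: "z \<in> W \<Longrightarrow> w \<bullet> (g z *v S z) = ds (fst z) w"
proof -
  assume z: "z \<in> W"
  have "ds (fst z) w = ds (fst z) (\<Sum>i\<in>UNIV. w $ i *\<^sub>R axis i 1)" by (simp add: vec_axis_sum[symmetric])
  also have "\<dots> = (\<Sum>i\<in>UNIV. w $ i *\<^sub>R ds (fst z) (axis i 1))"
    using z linear_sum[OF linear_ds, of "fst z" "\<lambda>i. w $ i *\<^sub>R axis i 1" UNIV] linear_scale[OF linear_ds, of "fst z"] by auto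
  finally show ?thesis by (simp add: S_def g_inv[OF z] inner_vec_def)
qed

lemma smooth_S: "smooth_on W S"
proof -
  have "smooth_on W (\<lambda>z. ds (fst z) (axis i 1))" for i
    unfolding ds_def
    by (rule smooth_on_compose[OF smooth_on_ddir[OF smooth_\<sigma>] _ open_W open_U])
      (auto intro!: smooth_on_fst smooth_on_ident open_W)
  then show ?thesis
    unfolding S_def[abs_def] by (intro smooth_on_matrix_vector smooth_fund_inv smooth_on_vec open_W)
qed

text \<open>The covector \<open>ds\<close> is independent of the direction, so \<open>S\<close> varies only through the inverse of the
  fundamental tensor.\<close>

lemma ddir_vert_S: "z \<in> W \<Longrightarrow> ddir (0, v) S z = - 2 *\<^sub>R C z v (S z)"
proof (rule g_nondeg)
  fix w assume z: "z \<in> W"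
  note d = diff_W[OF smooth_g z] diff_W[OF smooth_S z]
  have dgS: "(\<lambda>z. g z *v S z) differentiable (at z)"
    by (rule diff_W[OF _ z]) (intro smooth_on_matrix_vector smooth_g smooth_S open_W)
  have \<sigma>: "\<sigma> differentiable (at x)" "ddir w \<sigma> differentiable (at x)" if "x \<in> U" for x
    using smooth_on_differentiable[OF smooth_\<sigma> that]
      smooth_on_differentiable[OF smooth_on_ddir[OF smooth_\<sigma>] that] by auto
  have "w \<bullet> (g z *v ddir (0, v) S z + ddir (0, v) g z *v S z) = ddir (0, v) (\<lambda>z. w \<bullet> (g z *v S z)) z"
    unfolding ddir_bounded_linear[OF bounded_linear_inner_right dgS] ddir_matrix_vector[OF d] ..
  also have "\<dots> = ddir (0, v) (\<lambda>z. ddir w \<sigma> (fst z)) z"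
    by (rule ddir_cong[OF open_W z]) (simp add: g_S ds_def)
  also have "\<dots> = ddir (fst (0::real^'n, v)) (ddir w \<sigma>) (fst z)"
    using z by (intro ddir_eq[OF has_derivative_compose[OF has_derivative_fst[OF has_derivative_ident] has_derivative_ddir]] \<sigma>) auto
  also have "\<dots> = 0" using z ddir_zero_dir[OF \<sigma>(2)] by auto
  finally have "w \<bullet> (g z *v ddir (0, v) S z) = - (w \<bullet> (ddir (0, v) g z *v S z))"
    by (simp add: inner_add_right)
  also have "\<dots> = w \<bullet> (g z *v (- 2 *\<^sub>R C z v (S z)))"
    using g_cartan[OF z, of w v "S z"] by (simp add: matrix_vector_mult_scaleR vec.neg)
  finally show "w \<bullet> (g z *v ddir (0, v) S z) = w \<bullet> (g z *v (- 2 *\<^sub>R C z v (S z)))" .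
qed

lemma energy': "energy L' z = \<phi> z * E z"
  by (simp add: energy_def power_mult_distrib exp_double[symmetric] power2_eq_square exp_add[symmetric])

lemma ddir_energy': "z \<in> W \<Longrightarrow> ddir w (energy L') z = \<phi> z * (ddir w E z + 2 * ds (fst z) (fst w) * E z)"
  unfolding energy'[abs_def] ddir_mult[OF diff_W[OF smooth_\<phi>] diff_W[OF smooth_E]] ddir_\<phi>
  by (simp add: algebra_simps)

lemma ddir_vert_energy': "z \<in> W \<Longrightarrow> ddir (0, v) (energy L') z = \<phi> z * ddir (0, v) E z"
  unfolding ddir_energy' using linear_0[OF linear_ds, of "fst z"] by auto

lemma ddir_ddir_vert_energy':
  assumes z: "z \<in> W"
  shows "ddir w (ddir (0, v) (energy L')) z
    = \<phi> z * (ddir w (ddir (0, v) E) z + 2 * ds (fst z) (fst w) * ddir (0, v) E z)"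
proof -
  have "ddir w (ddir (0, v) (energy L')) z = ddir w (\<lambda>z. \<phi> z * ddir (0, v) E z) z"
    by (rule ddir_cong[OF open_W z]) (rule ddir_vert_energy')
  also have "\<dots> = \<phi> z * ddir w (ddir (0, v) E) z + 2 * \<phi> z * ds (fst z) (fst w) * ddir (0, v) E z"
    unfolding ddir_mult[OF diff_W[OF smooth_\<phi> z] diff_W[OF smooth_on_ddir[OF smooth_E] z]] ddir_\<phi>[OF z] ..
  finally show ?thesis by (simp add: algebra_simps)
qed

lemma g'_eq: "z \<in> W \<Longrightarrow> fund_tensor L' z = \<phi> z *\<^sub>R g z"
proof -
  assume z: "z \<in> W"
  have "fund_tensor L' z $ i $ j = 1/2 * ddir (0, axis i 1) (ddir (0, axis j 1) (energy L')) z" for i j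
    by (simp add: fund_tensor_def dy_def[abs_def] ddir_def[abs_def] energy_def[abs_def])
  moreover have "ds (fst z) 0 = 0" using linear_0[OF linear_ds] z by auto
  ultimately show ?thesis
    by (simp add: vec_eq_iff g_nth ddir_ddir_vert_energy'[OF z])
qed

lemma metric'_eq: "z \<in> W \<Longrightarrow> metric L' z u v = \<phi> z * metric L z u v"
  unfolding metric_def g'_eq by (simp add: sum_distrib_left mult_ac)

sublocale bar: finsler_patch U L'
proof
  show "smooth_on W L'"
    by (intro smooth_on_mult smooth_on_exp smooth_\<sigma>_fst smooth_L open_W)
  show "z \<in> W \<Longrightarrow> 0 \<le> L' z" for z using L_nonneg by simp
  show "x \<in> U \<Longrightarrow> y \<noteq> 0 \<Longrightarrow> r > 0 \<Longrightarrow> L' (x, r *\<^sub>R y) = r * L' (x, y)" for x y r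
    by (simp add: L_hom)
  show "z \<in> W \<Longrightarrow> u \<noteq> 0 \<Longrightarrow> 0 < metric L' z u u" for z u
    using metric_pos by (simp add: metric'_eq)
qed (rule open_U)

lemma cartan'_eq: "z \<in> W \<Longrightarrow> cartan_op L' z w u = C z w u"
proof (rule g_nondeg)
  fix a assume z: "z \<in> W"
  have "ddir (0, w) (fund_tensor L') z = ddir (0, w) (\<lambda>z. \<phi> z *\<^sub>R g z) z"
    by (rule ddir_cong[OF open_W z]) (rule g'_eq)
  also have "\<dots> = \<phi> z *\<^sub>R ddir (0, w) g z"
    using linear_0[OF linear_ds, of "fst z"] z
    unfolding ddir_scaleR[OF diff_W[OF smooth_\<phi> z] diff_W[OF smooth_g z]] ddir_\<phi>[OF z] by auto
  finally have "\<phi> z * (a \<bullet> (g z *v cartan_op L' z w u)) = \<phi> z * (a \<bullet> (g z *v C z w u))"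
    using bar.g_cartan[OF z, of a w u] unfolding g'_eq[OF z] g_cartan[OF z]
    by (simp add: scaleR_matrix_vector_assoc[symmetric])
  then show "a \<bullet> (g z *v cartan_op L' z w u) = a \<bullet> (g z *v C z w u)" by simp
qed (assumption)

lemma spray'_eq:
  assumes z: "z \<in> W"
  shows "spray_vec L' z = G z + ds (fst z) (snd z) *\<^sub>R snd z - (1/2 * E z) *\<^sub>R S z"
proof (rule g_nondeg[OF z])
  fix u
  have "\<phi> z * (4 * (u \<bullet> (g z *v spray_vec L' z)))
      = ddir (snd z, 0) (ddir (0, u) (energy L')) z - ddir (u, 0) (energy L') z"
    using bar.g_spray[OF z, of u] unfolding g'_eq[OF z] by (simp add: scaleR_matrix_vector_assoc[symmetric])
  also have "\<dots> = \<phi> z * (4 * (u \<bullet> (g z *v G z)) + 2 * ds (fst z) (snd z) * ddir (0, u) E z - 2 * ds (fst z) u * E z)"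
    unfolding ddir_ddir_vert_energy'[OF z] ddir_energy'[OF z] g_spray[OF z] by (simp add: algebra_simps)
  finally have "4 * (u \<bullet> (g z *v spray_vec L' z))
     = 4 * (u \<bullet> (g z *v G z)) + 2 * ds (fst z) (snd z) * (2 * (snd z \<bullet> (g z *v u))) - 2 * ds (fst z) u * E z"
    unfolding ddir_vert_E[OF z] by simp
  then show "u \<bullet> (g z *v spray_vec L' z)
      = u \<bullet> (g z *v (G z + ds (fst z) (snd z) *\<^sub>R snd z - (1/2 * E z) *\<^sub>R S z))"
    using g_sym[OF z, of "snd z" u] g_S[OF z, of u]
    by (simp add: matrix_vector_right_distrib matrix_vector_mult_diff_distrib matrix_vector_mult_scaleR
        inner_simps field_simps)
qed

text \<open>The vertical derivative of the formula for the spray; the term with the Cartan tensor comes from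
  the dependence of \<open>S\<close> on the direction.\<close>

lemma nonlin'_eq:
  assumes z: "z \<in> W"
  shows "nonlin_op L' z v = N z v + ds (fst z) v *\<^sub>R snd z + ds (fst z) (snd z) *\<^sub>R v
    - (snd z \<bullet> (g z *v v)) *\<^sub>R S z + E z *\<^sub>R C z v (S z)"
proof -
  have zU: "fst z \<in> U" using z by auto
  have X: "((snd :: 'n tpoint \<Rightarrow> real^'n) has_derivative snd) (at z)"
    by (simp add: bounded_linear_imp_has_derivative bounded_linear_snd)
  have P: "((\<lambda>z::'n tpoint. (snd z, 0::real^'n)) has_derivative (\<lambda>w. (snd w, 0))) (at z)"
    by (auto intro!: derivative_eq_intros)
  have s_eq: "ds (fst z) w = ddir (w, 0) (\<lambda>z. \<sigma> (fst z)) z" if "z \<in> W" for z :: "'n tpoint" and w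
  proof -
    have "\<sigma> differentiable (at (fst z))" using smooth_on_differentiable[OF smooth_\<sigma>] that by auto
    from ddir_eq[OF has_derivative_compose[OF has_derivative_fst[OF has_derivative_ident] has_derivative_ddir[OF this]], of "(w, 0)"]
    show ?thesis by (simp add: ds_def)
  qed
  have dds: "((\<lambda>z. ds (fst z) (snd z)) has_derivative
      (\<lambda>w. ds (fst z) (snd w) + ddir w (ddir (snd z, 0) (\<lambda>z. \<sigma> (fst z))) z)) (at z)"
    unfolding s_eq[OF z]
    by (rule has_derivative_transform_within_open[OF has_derivative_ddir_var[OF open_W smooth_\<sigma>_fst z P] open_W z])
      (rule s_eq[symmetric])
  have "ddir (0, v) (ddir (snd z, 0) (\<lambda>z. \<sigma> (fst z))) z = ddir (snd z, 0) (ddir (0, v) (\<lambda>z. \<sigma> (fst z))) z"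
    by (rule ddir_commute[OF open_W smooth_\<sigma>_fst z])
  also have "\<dots> = ddir (snd z, 0) (\<lambda>z. 0) z"
  proof (rule ddir_cong[OF open_W z])
    fix z :: "'n tpoint" assume "z \<in> W"
    then have d: "\<sigma> differentiable (at (fst z))" using smooth_on_differentiable[OF smooth_\<sigma>] by auto
    from ddir_eq[OF has_derivative_compose[OF has_derivative_fst[OF has_derivative_ident] has_derivative_ddir[OF this]], of "(0, v)"]
    show "ddir (0, v) (\<lambda>z. \<sigma> (fst z)) z = 0" using ddir_zero_dir[OF d] by simp
  qed
  finally have 0: "ddir (0, v) (ddir (snd z, 0) (\<lambda>z. \<sigma> (fst z))) z = 0" by (simp add: ddir_const)
  have dE: "(E has_derivative (\<lambda>v. ddir v E z)) (at z)" and dS: "(S has_derivative (\<lambda>v. ddir v S z)) (at z)"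
    and dG: "(G has_derivative (\<lambda>v. ddir v G z)) (at z)"
    by (intro has_derivative_ddir diff_W[OF _ z] smooth_E smooth_S smooth_G)+
  have "((\<lambda>z. G z + ds (fst z) (snd z) *\<^sub>R snd z - (1/2 * E z) *\<^sub>R S z) has_derivative
     (\<lambda>w. ddir w G z + (ds (fst z) (snd z) *\<^sub>R snd w
         + (ds (fst z) (snd w) + ddir w (ddir (snd z, 0) (\<lambda>z. \<sigma> (fst z))) z) *\<^sub>R snd z)
       - ((1/2 * E z) *\<^sub>R ddir w S z + (1/2 * ddir w E z) *\<^sub>R S z))) (at z)"
    by (intro has_derivative_diff has_derivative_add has_derivative_scaleR has_derivative_mult_right dG dds X dE dS)
  from ddir_eq[OF this, of "(0, v)"]
  have "ddir (0, v) (\<lambda>z. G z + ds (fst z) (snd z) *\<^sub>R snd z - (1/2 * E z) *\<^sub>R S z) z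
     = N z v + (ds (fst z) (snd z) *\<^sub>R v + ds (fst z) v *\<^sub>R snd z)
       - ((1/2 * E z) *\<^sub>R (- 2 *\<^sub>R C z v (S z)) + (1/2 * (2 * (snd z \<bullet> (g z *v v)))) *\<^sub>R S z)"
    unfolding ddir_vert_S[OF z] ddir_vert_E[OF z] 0 nonlin_op_def by simp
  moreover have "nonlin_op L' z v = ddir (0, v) (\<lambda>z. G z + ds (fst z) (snd z) *\<^sub>R snd z - (1/2 * E z) *\<^sub>R S z) z"
    unfolding nonlin_op_def by (rule ddir_cong[OF open_W z]) (rule spray'_eq)
  ultimately show ?thesis by (simp add: algebra_simps)
qed


text \<open>Writing the circle equation of the changed metric along a reparametrized circle of the old one,
  all terms cancel except those below: with \<open>q = exp (-\<sigma>)\<close> the new acceleration is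
  \<open>q\<^sup>2 (A + ds(y) y - S)\<close>, and the new connection differs from the old one, along a curve,
  only by terms in \<open>ds\<close>, \<open>S\<close> and \<open>y\<close>.\<close>

lemma circle_preserved_condition:
  assumes x: "regular_curve U I x" and unit: "\<And>t. t \<in> I \<Longrightarrow> L (lift x t) = 1"
    and circ: "\<And>t. t \<in> I \<Longrightarrow> circle_eq L x t"
    and h: "open J" "smooth_on J h" "\<And>s. s \<in> J \<Longrightarrow> h s \<in> I" "\<And>s. s \<in> J \<Longrightarrow> vel h s > 0"
    and unit': "\<And>s. s \<in> J \<Longrightarrow> L' (lift (x \<circ> h) s) = 1"
    and r: "r \<in> J" and circ': "circle_eq L' (x \<circ> h) r"
    and z_def: "z = lift x (h r)" and A_def: "A = circle_acc L x (h r)"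
  shows "\<exists>\<mu>. ddir (snd z, - N z (snd z)) S z + N z (S z) - C z A (S z) - ds (fst z) (snd z) *\<^sub>R S z
    = \<mu> *\<^sub>R snd z"
proof -
  have I: "open I" "smooth_on I x" "smooth_on I (vel x)" and xU: "\<And>t. t \<in> I \<Longrightarrow> x t \<in> U"
    using x smooth_on_vel by (auto simp: regular_curve_def)
  define q where "q t = exp (- \<sigma> (x t))" for t
  define s where "s = vel (\<lambda>t. \<sigma> (x t))"
  define acc where "acc = circle_acc L x"
  define V where "V t = acc t + s t *\<^sub>R vel x t - S (lift x t)" for t
  have q0: "q t > 0" for t by (simp add: q_def)
  have \<sigma>x: "smooth_on I (\<lambda>t. \<sigma> (x t))"
    by (rule smooth_on_compose[OF smooth_\<sigma> I(2,1) open_U xU])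
  have s_eq: "s t = ds (x t) (vel x t)" if "t \<in> I" for t
    unfolding s_def ds_def
    by (rule vector_derivative_at[OF ddir_along_curve[OF _ smooth_on_has_vel[OF I(2) that]]])
      (rule smooth_on_differentiable[OF smooth_\<sigma> xU[OF that]])
  have q': "(q has_vector_derivative - s t * q t) (at t)" if "t \<in> I" for t
  proof -
    have "((\<lambda>t. \<sigma> (x t)) has_real_derivative s t) (at t)"
      using smooth_on_has_vel[OF \<sigma>x that] by (simp add: s_def has_real_derivative_iff_has_vector_derivative)
    then have "(q has_real_derivative - s t * q t) (at t)"
      unfolding q_def by (auto intro!: derivative_eq_intros)
    then show ?thesis by (simp add: has_real_derivative_iff_has_vector_derivative)
  qed
  have s': "(s has_vector_derivative vel s t) (at t)" if "t \<in> I" for t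
    using smooth_on_has_vel[OF smooth_on_vel[OF I(1) \<sigma>x] that] by (simp add: s_def)
  have y': "(vel x has_vector_derivative vel (vel x) t) (at t)" if "t \<in> I" for t
    by (rule smooth_on_has_vel[OF I(3) that])
  have acc': "(acc has_vector_derivative vel acc t) (at t)" if "t \<in> I" for t
    unfolding acc_def by (rule smooth_on_has_vel[OF smooth_circle_acc[OF x] that])
  have S': "((\<lambda>t. S (lift x t)) has_vector_derivative ddir (vel x t, vel (vel x) t) S (lift x t)) (at t)"
    if "t \<in> I" for t
    by (rule ddir_along_curve[OF diff_W[OF smooth_S regular_curve_lift(3)[OF x that]]
          regular_curve_lift(2)[OF x that]])
  have chain0: "(f \<circ> h has_vector_derivative vel h u *\<^sub>R f') (at u)"
    if "u \<in> J" "(f has_vector_derivative f') (at (h u))" for u f' and f :: "real \<Rightarrow> real^'n"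
    by (rule vector_diff_chain_at[OF smooth_on_has_vel[OF h(2) that(1)] that(2)])
  have velxh: "vel (x \<circ> h) u = vel h u *\<^sub>R vel x (h u)" if "u \<in> J" for u
    by (rule vector_derivative_at[OF chain0[OF that smooth_on_has_vel[OF I(2) h(3)[OF that]]]])
  have hq: "vel h u = q (h u)" if "u \<in> J" for u
  proof -
    have "lift (x \<circ> h) u = (x (h u), vel h u *\<^sub>R vel x (h u))" by (simp add: lift_def velxh[OF that])
    moreover have "L (x (h u), vel h u *\<^sub>R vel x (h u)) = vel h u * L (lift x (h u))"
      unfolding lift_def using x h(3,4)[OF that] by (intro L_hom) (auto simp: regular_curve_def)
    ultimately have "exp (\<sigma> (x (h u))) * vel h u = 1" using unit'[OF that] unit[OF h(3)[OF that]] by simp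
    then show ?thesis by (simp add: q_def exp_minus field_simps)
  qed
  note chain = chain0[unfolded hq]
  have chain': "vel F u = q (h u) *\<^sub>R f'"
    if "u \<in> J" "(f has_vector_derivative f') (at (h u))" "\<And>u. u \<in> J \<Longrightarrow> F u = f (h u)"
    for u f' F and f :: "real \<Rightarrow> real^'n"
  proof -
    have "vel F u = vel (f \<circ> h) u" by (rule vel_cong[OF h(1) that(1)]) (simp add: that(3))
    also have "\<dots> = q (h u) *\<^sub>R f'"
      using vector_derivative_at[OF chain0[OF that(1,2)]] hq[OF that(1)] by simp
    finally show ?thesis .
  qed
  have vel1: "vel (x \<circ> h) u = q (h u) *\<^sub>R vel x (h u)" if "u \<in> J" for u
    using velxh[OF that] hq[OF that] by simp
  have vel2: "vel (vel (x \<circ> h)) u = (q (h u))\<^sup>2 *\<^sub>R (vel (vel x) (h u) - s (h u) *\<^sub>R vel x (h u))" if "u \<in> J" for u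
  proof -
    have "((\<lambda>t. q t *\<^sub>R vel x t) has_vector_derivative
        q (h u) *\<^sub>R vel (vel x) (h u) + (- s (h u) * q (h u)) *\<^sub>R vel x (h u)) (at (h u))"
      using has_vector_derivative_scaleR[OF q'[unfolded has_real_derivative_iff_has_vector_derivative[symmetric]] y']
        h(3)[OF that] by blast
    from chain'[OF that this vel1] show ?thesis
      by (simp add: power2_eq_square algebra_simps)
  qed
  have liftxh: "lift (x \<circ> h) u = (fst (lift x (h u)), q (h u) *\<^sub>R snd (lift x (h u)))" if "u \<in> J" for u
    by (simp add: lift_def vel1[OF that])
  have E1: "E (lift x t) = 1" if "t \<in> I" for t by (simp add: energy_def unit[OF that])
  have accxh: "circle_acc L' (x \<circ> h) u = (q (h u))\<^sup>2 *\<^sub>R V (h u)" if "u \<in> J" for u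
  proof -
    note t = h(3)[OF that]
    note zz = regular_curve_lift(3)[OF x t]
    have "spray_vec L' (lift (x \<circ> h) u) = (q (h u))\<^sup>2 *\<^sub>R spray_vec L' (lift x (h u))"
      unfolding liftxh[OF that] by (rule bar.G_hom[OF zz q0])
    also have "spray_vec L' (lift x (h u))
        = G (lift x (h u)) + s (h u) *\<^sub>R vel x (h u) - (1/2) *\<^sub>R S (lift x (h u))"
      unfolding spray'_eq[OF zz] E1[OF t] by (simp add: s_eq[OF t] lift_def)
    finally have sp: "spray_vec L' (lift (x \<circ> h) u)
      = (q (h u))\<^sup>2 *\<^sub>R (G (lift x (h u)) + s (h u) *\<^sub>R vel x (h u) - (1/2) *\<^sub>R S (lift x (h u)))" .
    show ?thesis
      unfolding circle_acc_def V_def acc_def vel2[OF that] sp by (simp add: vec_eq_iff algebra_simps)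
  qed
  define t where "t = h r"
  have tI: "t \<in> I" using h(3)[OF r] by (simp add: t_def)
  have zt: "z = lift x t" and At: "A = acc t" by (simp_all add: z_def A_def t_def acc_def)
  have z: "z \<in> W" using regular_curve_lift(3)[OF x tI] zt by simp
  define y where "y = snd z"
  have yt: "vel x t = y" and xt: "fst z = x t" by (simp_all add: y_def zt lift_def)
  define V' where "V' = vel acc t + (s t *\<^sub>R vel (vel x) t + vel s t *\<^sub>R y) - ddir (y, vel (vel x) t) S z"
  have V': "(V has_vector_derivative V') (at t)"
    unfolding V_def V'_def zt yt[symmetric]
    by (intro has_vector_derivative_diff has_vector_derivative_add acc' S' tI
        has_vector_derivative_scaleR y' s'[unfolded has_real_derivative_iff_has_vector_derivative[symmetric]])
  have velacc: "vel (circle_acc L' (x \<circ> h)) r = q t ^ 3 *\<^sub>R (V' - (2 * s t) *\<^sub>R V t)"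
  proof -
    have "((\<lambda>t. (q t)\<^sup>2) has_real_derivative - 2 * s t * (q t)\<^sup>2) (at t)"
      using q'[OF tI] unfolding has_real_derivative_iff_has_vector_derivative[symmetric]
      by (auto intro!: derivative_eq_intros simp: power2_eq_square)
    from has_vector_derivative_scaleR[OF this V']
    have "((\<lambda>t. (q t)\<^sup>2 *\<^sub>R V t) has_vector_derivative
        (q t)\<^sup>2 *\<^sub>R V' + (- 2 * s t * (q t)\<^sup>2) *\<^sub>R V t) (at (h r))" by (simp add: t_def)
    from chain'[OF r this accxh] show ?thesis
      by (simp add: t_def power2_eq_square power3_eq_cube algebra_simps)
  qed
  have non: "nonlin_op L' (lift (x \<circ> h) r) (circle_acc L' (x \<circ> h) r) = q t ^ 3 *\<^sub>R nonlin_op L' z (V t)"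
    unfolding liftxh[OF r] accxh[OF r] t_def[symmetric] zt[symmetric] bar.nonlin_hom[OF z q0]
      linear_scale[OF bar.linear_nonlin[OF z]]
    by (simp add: power2_eq_square power3_eq_cube)
  have car: "cartan_op L' (lift (x \<circ> h) r) (circle_acc L' (x \<circ> h) r) (circle_acc L' (x \<circ> h) r)
      = q t ^ 3 *\<^sub>R C z (V t) (V t)"
  proof -
    have "cartan_op L' (fst z, q t *\<^sub>R snd z) ((q t)\<^sup>2 *\<^sub>R V t) ((q t)\<^sup>2 *\<^sub>R V t)
        = (1 / q t * (q t)\<^sup>2 * (q t)\<^sup>2) *\<^sub>R C z (V t) (V t)"
      unfolding bar.cartan_hom[OF z q0] cartan'_eq[OF z] by (simp add: cartan_scale_left[OF z] cartan_scale_right)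
    also have "1 / q t * (q t)\<^sup>2 * (q t)\<^sup>2 = q t ^ 3"
      using q0[of t] by (simp add: power2_eq_square power3_eq_cube)
    finally show ?thesis
      unfolding liftxh[OF r] accxh[OF r] t_def[symmetric] zt[symmetric] .
  qed
  obtain m where "q t ^ 3 *\<^sub>R (V' - (2 * s t) *\<^sub>R V t) + q t ^ 3 *\<^sub>R nonlin_op L' z (V t)
      + q t ^ 3 *\<^sub>R C z (V t) (V t) + m *\<^sub>R (q t *\<^sub>R y) = 0"
    using circ' unfolding circle_eq_def velacc non car vel1[OF r] t_def[symmetric] yt by blast
  then have "q t ^ 3 *\<^sub>R ((V' - (2 * s t) *\<^sub>R V t) + nonlin_op L' z (V t) + C z (V t) (V t)
      + (m * q t / q t ^ 3) *\<^sub>R y) = 0"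
    using q0[of t] by (simp add: scaleR_add_right)
  then have main: "(V' - (2 * s t) *\<^sub>R V t) + nonlin_op L' z (V t) + C z (V t) (V t)
      + (m * q t / q t ^ 3) *\<^sub>R y = 0"
    using q0[of t] by simp
  have orth: "y \<bullet> (g z *v A) = 0"
    using unit_speed_orth[OF x unit tI] by (simp add: yt zt At acc_def)
  have st: "s t = ds (fst z) y" using s_eq[OF tI] by (simp add: xt yt)
  have Ez: "y \<bullet> (g z *v y) = 1" "E z = 1"
    using E1[OF tI] E_eq[OF z] by (simp_all add: zt[symmetric] y_def)
  have Vt: "V t = A + s t *\<^sub>R y - S z" by (simp add: V_def At yt zt)
  have yV: "y \<bullet> (g z *v V t) = 0"
    unfolding Vt using orth Ez g_S[OF z, of y] st
    by (simp add: matrix_vector_right_distrib matrix_vector_mult_diff_distrib matrix_vector_mult_scaleR inner_simps)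
  have nonV: "nonlin_op L' z (V t) = N z (V t) + ds (fst z) (V t) *\<^sub>R y + s t *\<^sub>R V t + C z (V t) (S z)"
    using nonlin'_eq[OF z, of "V t"] yV Ez st by (simp add: y_def)
  have NV: "N z (V t) = N z A + s t *\<^sub>R N z y - N z (S z)"
    unfolding Vt using linear_nonlin[OF z] by (simp add: linear_add linear_diff linear_scale)
  have CV: "C z (V t) (V t) + C z (V t) (S z) = C z A A - C z A (S z)"
  proof -
    have "C z (V t) (V t) + C z (V t) (S z) = C z (V t) (A + s t *\<^sub>R y)"
      unfolding cartan_add_right[symmetric] Vt by simp
    also have "\<dots> = C z (V t) A"
      using cartan_snd(2)[OF z] unfolding cartan_add_right cartan_scale_right y_def by simp
    also have "\<dots> = C z A (V t)" by (rule cartan_swap[OF z])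
    also have "\<dots> = C z A (V t + S z) - C z A (S z)" by (simp add: cartan_add_right)
    also have "V t + S z = A + s t *\<^sub>R y" by (simp add: Vt)
    also have "C z A (A + s t *\<^sub>R y) = C z A A"
      using cartan_snd(2)[OF z] unfolding cartan_add_right cartan_scale_right y_def by simp
    finally show ?thesis .
  qed
  have yy: "vel (vel x) t = A - N z y"
    using nonlin_snd[OF z] by (simp add: At acc_def circle_acc_def zt[symmetric] y_def)
  have acct: "vel acc t = - N z A - C z A A - metric L z A A *\<^sub>R y"
  proof -
    have "(vel acc t + N z A + C z A A) + metric L z A A *\<^sub>R y = 0"
      using circ[OF tI] unfolding circle_eq_def acc_def[symmetric] zt[symmetric] At[symmetric] yt .
    then have "vel acc t $ i = (- N z A - C z A A - metric L z A A *\<^sub>R y) $ i" for i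
      by (auto simp: vec_eq_iff add_eq_0_iff dest!: spec[where x=i])
    then show ?thesis by (simp add: vec_eq_iff)
  qed
  have St: "ddir (y, vel (vel x) t) S z = ddir (y, - N z y) S z - 2 *\<^sub>R C z A (S z)"
  proof -
    have "(y, vel (vel x) t) = (y, - N z y) + (0, A)" by (simp add: yy)
    then have "ddir (y, vel (vel x) t) S z = ddir (y, - N z y) S z + ddir (0, A) S z"
      by (simp only: ddir_add_dir[OF diff_W[OF smooth_S z]])
    then show ?thesis by (simp add: ddir_vert_S[OF z])
  qed
  define m' where "m' = m * q t / q t ^ 3"
  have ring: "D + NS - CAS - s * Si = (s' - m1 - s * s + dV + m2) * y"
    if "- NA - CAA - m1 * y + (s * (Ai - Ny) + s' * y) - (D - 2 * CAS) - 2 * s * Vi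
         + (NV + dV * y + s * Vi + CVS) + CVV + m2 * y = 0"
      "NV = NA + s * Ny - NS" "CVV + CVS = CAA - CAS" "Vi = Ai + s * y - Si"
    for D NS CAS s Si s' m1 dV m2 y NA CAA Ai Ny NV CVS CVV Vi :: real
    using that by algebra
  have "(ddir (y, - N z y) S z + N z (S z) - C z A (S z) - s t *\<^sub>R S z) $ i
    = ((vel s t - metric L z A A - s t * s t + ds (fst z) (V t) + m') *\<^sub>R y) $ i" for i
    using ring[of "N z A $ i" "C z A A $ i" "metric L z A A" "y $ i" "s t" "A $ i" "N z y $ i" "vel s t"
        "ddir (y, - N z y) S z $ i" "C z A (S z) $ i" "V t $ i" "N z (V t) $ i" "ds (fst z) (V t)"
        "C z (V t) (S z) $ i" "C z (V t) (V t) $ i" m' "N z (S z) $ i" "S z $ i"]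
      arg_cong[OF main[unfolded nonV V'_def acct St, unfolded yy m'_def[symmetric]], of "\<lambda>v. v $ i"]
      arg_cong[OF NV, of "\<lambda>v. v $ i"] arg_cong[OF CV, of "\<lambda>v. v $ i"] arg_cong[OF Vt, of "\<lambda>v. v $ i"]
    by simp
  then have "ddir (y, - N z y) S z + N z (S z) - C z A (S z) - s t *\<^sub>R S z
    = (vel s t - metric L z A A - s t * s t + ds (fst z) (V t) + m') *\<^sub>R y"
    unfolding vec_eq_iff by blast
  then show ?thesis unfolding y_def st by blast
qed

end

section \<open>Changes of coordinates\<close>

lemma ddir_comp_fst:
  assumes "f differentiable (at (fst z))"
  shows "ddir w (\<lambda>z. f (fst z)) z = ddir (fst w) f (fst z)"
  using ddir_eq[OF has_derivative_compose[OF has_derivative_fst[OF has_derivative_ident]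
        has_derivative_ddir[OF assms]]] .

lemma has_derivative_ddir_pair:
  fixes h :: "'a::euclidean_space \<Rightarrow> 'b::real_normed_vector"
  assumes "open S" "smooth_on S h" "fst q \<in> S"
  shows "((\<lambda>q. ddir (snd q) h (fst q)) has_derivative
    (\<lambda>w. ddir (snd w) h (fst q) + ddir (fst w) (ddir (snd q) h) (fst q))) (at q)"
proof -
  let ?T = "S \<times> (UNIV :: 'a set)" and ?h = "\<lambda>q :: 'a \<times> 'a. h (fst q)"
  have T: "open ?T" "q \<in> ?T" using assms by (auto intro: open_Times simp: mem_Times_iff)
  have sm: "smooth_on ?T ?h"
    by (rule smooth_on_compose[OF assms(2) _ T(1) assms(1)]) (auto intro!: smooth_on_fst smooth_on_ident T)
  have d: "h differentiable (at (fst r))" "ddir v h differentiable (at (fst r))" if "r \<in> ?T" for r v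
    using that smooth_on_differentiable[OF assms(2)] smooth_on_differentiable[OF smooth_on_ddir[OF assms(2)]] by auto
  have X: "((\<lambda>q :: 'a \<times> 'a. (snd q, 0 :: 'a)) has_derivative (\<lambda>w. (snd w, 0))) (at q)"
    by (auto intro!: derivative_eq_intros)
  have eq: "ddir (v, 0) ?h r = ddir v h (fst r)" if "r \<in> ?T" for r v
    using ddir_comp_fst[OF d(1)[OF that], of "(v, 0)"] by simp
  have 1: "ddir w (ddir (snd q, 0) ?h) q = ddir (fst w) (ddir (snd q) h) (fst q)" for w
  proof -
    have "ddir w (ddir (snd q, 0) ?h) q = ddir w (\<lambda>r. ddir (snd q) h (fst r)) q"
      by (rule ddir_cong[OF T]) (rule eq)
    also have "\<dots> = ddir (fst w) (ddir (snd q) h) (fst q)"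
      by (rule ddir_comp_fst[OF d(2)[OF T(2)]])
    finally show ?thesis .
  qed
  show ?thesis
    using has_derivative_transform_within_open[OF has_derivative_ddir_var[OF T(1) sm T(2) X] T, of "\<lambda>q. ddir (snd q) h (fst q)"]
    unfolding 1 eq[OF T(2)] by (simp add: eq)
qed

lemma has_derivative_ddir_comp:
  fixes h :: "'a::euclidean_space \<Rightarrow> 'b::real_normed_vector"
  assumes "open S" "smooth_on S h" "p z \<in> S" "(p has_derivative p') (at z)" "(X has_derivative X') (at z)"
  shows "((\<lambda>z. ddir (X z) h (p z)) has_derivative
    (\<lambda>w. ddir (X' w) h (p z) + ddir (p' w) (ddir (X z) h) (p z))) (at z)"
proof -
  have q: "fst (p z, X z) \<in> S" using assms(3) by simp
  show ?thesis
    using has_derivative_compose[OF has_derivative_Pair[OF assms(4,5)]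
        has_derivative_ddir_pair[OF assms(1,2) q]] by simp
qed

text \<open>Two coordinate expressions of one Finsler function, related by a transition map \<open>\<theta>\<close> with
  invertible Jacobian. The aim is that the equation of geodesic circles does not depend on the chart.\<close>

locale chart_change = a: finsler_patch Ua La + b: finsler_patch Ub Lb
  for Ua :: "(real^'n::finite) set" and La and Ub :: "(real^'n) set" and Lb +
  fixes D :: "(real^'n) set" and \<theta> :: "real^'n \<Rightarrow> real^'n"
  assumes open_D: "open D" and D_sub: "D \<subseteq> Ua"
    and smooth_\<theta>: "smooth_on D \<theta>" and \<theta>_in: "\<And>x. x \<in> D \<Longrightarrow> \<theta> x \<in> Ub"
    and L_eq: "\<And>x y. x \<in> D \<Longrightarrow> y \<noteq> 0 \<Longrightarrow> La (x, y) = Lb (\<theta> x, ddir y \<theta> x)"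
    and \<theta>_inj: "\<And>x v. x \<in> D \<Longrightarrow> ddir v \<theta> x = 0 \<Longrightarrow> v = 0"
begin

abbreviation "J \<equiv> \<lambda>x v. ddir v \<theta> x"
abbreviation "H \<equiv> \<lambda>x u v. ddir u (ddir v \<theta>) x"
abbreviation "WD \<equiv> D \<times> (-{0::real^'n})"

text \<open>The tangent map of \<open>\<theta>\<close>.\<close>

definition \<Theta> :: "'n tpoint \<Rightarrow> 'n tpoint" where
  "\<Theta> z = (\<theta> (fst z), J (fst z) (snd z))"

lemma open_WD: "open WD"
  by (intro open_Times open_D open_Compl) simp

lemma WD_sub: "z \<in> WD \<Longrightarrow> z \<in> Ua \<times> (-{0})"
  using D_sub by auto

lemma \<Theta>_in: "z \<in> WD \<Longrightarrow> \<Theta> z \<in> Ub \<times> (-{0})"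
  using \<theta>_in \<theta>_inj by (auto simp: \<Theta>_def)

lemma diff_\<theta>: "x \<in> D \<Longrightarrow> \<theta> differentiable (at x)" "x \<in> D \<Longrightarrow> ddir v \<theta> differentiable (at x)"
  using smooth_on_differentiable[OF smooth_\<theta>] smooth_on_differentiable[OF smooth_on_ddir[OF smooth_\<theta>]] by auto

lemma linear_J: "x \<in> D \<Longrightarrow> linear (J x)"
  by (rule linear_ddir[OF diff_\<theta>(1)])

lemma J_surj: "x \<in> D \<Longrightarrow> \<exists>v. J x v = w"
proof -
  assume x: "x \<in> D"
  have "inj (J x)" unfolding linear_injective_0[OF linear_J[OF x]] using \<theta>_inj[OF x] by blast
  then have "surj (J x)" using linear_injective_imp_surjective[OF linear_J[OF x]] by simp
  then obtain v where "w = J x v" by (rule surjE)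
  then show ?thesis by blast
qed

lemma H_sym: "x \<in> D \<Longrightarrow> H x u v = H x v u"
  by (rule ddir_commute[OF open_D smooth_\<theta>])

lemma linear_H_left: "x \<in> D \<Longrightarrow> linear (\<lambda>u. H x u v)"
  by (rule linear_ddir[OF diff_\<theta>(2)])

lemma J_add: "x \<in> D \<Longrightarrow> J x (u + v) = J x u + J x v"
  and J_scale: "x \<in> D \<Longrightarrow> J x (r *\<^sub>R u) = r *\<^sub>R J x u"
  by (simp_all add: ddir_add_dir ddir_scale_dir diff_\<theta>)

lemma H_add: "x \<in> D \<Longrightarrow> H x (u + v) w = H x u w + H x v w"
    "x \<in> D \<Longrightarrow> H x w (u + v) = H x w u + H x w v"
  and H_scale: "x \<in> D \<Longrightarrow> H x (r *\<^sub>R u) w = r *\<^sub>R H x u w"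
    "x \<in> D \<Longrightarrow> H x w (r *\<^sub>R u) = r *\<^sub>R H x w u"
  by (simp_all add: ddir_add_dir ddir_scale_dir diff_\<theta> H_sym[of x w])

lemma \<Theta>_derivative:
  assumes z: "z \<in> WD"
  shows "(\<Theta> has_derivative (\<lambda>w. (J (fst z) (fst w), J (fst z) (snd w) + H (fst z) (fst w) (snd z)))) (at z)"
proof -
  have x: "fst z \<in> D" using z by auto
  have "((\<lambda>z. \<theta> (fst z)) has_derivative (\<lambda>w. J (fst z) (fst w))) (at z)"
    by (rule has_derivative_compose[OF has_derivative_fst[OF has_derivative_ident] has_derivative_ddir[OF diff_\<theta>(1)[OF x]]])
  then show ?thesis
    unfolding \<Theta>_def[abs_def] by (intro has_derivative_Pair has_derivative_ddir_pair[OF open_D smooth_\<theta> x])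
qed

lemma E_change: "z \<in> WD \<Longrightarrow> a.E z = b.E (\<Theta> z)"
  using L_eq[of "fst z" "snd z"] by (cases z) (simp add: energy_def \<Theta>_def)

lemma ddir_E_change:
  assumes z: "z \<in> WD"
  shows "ddir w a.E z = ddir (J (fst z) (fst w), J (fst z) (snd w) + H (fst z) (fst w) (snd z)) b.E (\<Theta> z)"
proof -
  have "ddir w a.E z = ddir w (\<lambda>z. b.E (\<Theta> z)) z"
    by (rule ddir_cong[OF open_WD z]) (rule E_change)
  also have "\<dots> = ddir (J (fst z) (fst w), J (fst z) (snd w) + H (fst z) (fst w) (snd z)) b.E (\<Theta> z)"
    by (rule ddir_eq[OF has_derivative_compose[OF \<Theta>_derivative[OF z] has_derivative_ddir[OF
            b.diff_W[OF b.smooth_E \<Theta>_in[OF z]]]]])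
  finally show ?thesis .
qed

lemma ddir_vert_E_change: "z \<in> WD \<Longrightarrow> ddir (0, v) a.E z = ddir (0, J (fst z) v) b.E (\<Theta> z)"
  using ddir_E_change[of z "(0, v)"] linear_0[OF linear_J, of "fst z"] linear_0[OF linear_H_left, of "fst z"]
  by (cases z) simp

lemma ddir_ddir_vert_E_change:
  assumes z: "z \<in> WD"
  shows "ddir w (ddir (0, v) a.E) z = ddir (0, H (fst z) (fst w) v) b.E (\<Theta> z)
    + ddir (J (fst z) (fst w), J (fst z) (snd w) + H (fst z) (fst w) (snd z)) (ddir (0, J (fst z) v) b.E) (\<Theta> z)"
proof -
  have x: "fst z \<in> D" using z by auto
  have "((\<lambda>z. J (fst z) v) has_derivative (\<lambda>w. H (fst z) (fst w) v)) (at z)"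
    by (rule has_derivative_compose[OF has_derivative_fst[OF has_derivative_ident] has_derivative_ddir[OF diff_\<theta>(2)[OF x]]])
  then have X: "((\<lambda>z. (0 :: real^'n, J (fst z) v)) has_derivative (\<lambda>w. (0, H (fst z) (fst w) v))) (at z)"
    by (intro has_derivative_Pair has_derivative_const)
  have "ddir w (ddir (0, v) a.E) z = ddir w (\<lambda>z. ddir (0, J (fst z) v) b.E (\<Theta> z)) z"
    by (rule ddir_cong[OF open_WD z]) (rule ddir_vert_E_change)
  also have "\<dots> = ddir (0, H (fst z) (fst w) v) b.E (\<Theta> z)
    + ddir (J (fst z) (fst w), J (fst z) (snd w) + H (fst z) (fst w) (snd z)) (ddir (0, J (fst z) v) b.E) (\<Theta> z)"
    by (rule ddir_eq[OF has_derivative_ddir_comp[OF b.open_W b.smooth_E \<Theta>_in[OF z] \<Theta>_derivative[OF z] X]])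
  finally show ?thesis .
qed

lemma g_change: "z \<in> WD \<Longrightarrow> u \<bullet> (a.g z *v v) = J (fst z) u \<bullet> (b.g (\<Theta> z) *v J (fst z) v)"
proof -
  assume z: "z \<in> WD"
  then have x: "fst z \<in> D" by auto
  have "ddir (0, 0 :: real^'n) b.E (\<Theta> z) = 0"
    using ddir_zero_dir[OF b.diff_W[OF b.smooth_E \<Theta>_in[OF z]]] by (simp add: zero_prod_def)
  then show ?thesis
    using ddir_ddir_vert_E_change[OF z, of "(0, u)" v] linear_0[OF linear_J[OF x]] linear_0[OF linear_H_left[OF x]]
    by (simp add: a.g_apply[OF WD_sub[OF z]] b.g_apply[OF \<Theta>_in[OF z]])
qed

lemma metric_change: "z \<in> WD \<Longrightarrow> metric La z u v = metric Lb (\<Theta> z) (J (fst z) u) (J (fst z) v)"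
  by (simp add: a.metric_eq b.metric_eq g_change)

lemma b_nondeg:
  assumes z: "z \<in> WD" and eq: "\<And>u. J (fst z) u \<bullet> (b.g (\<Theta> z) *v p) = J (fst z) u \<bullet> (b.g (\<Theta> z) *v q)"
  shows "p = q"
proof (rule b.g_nondeg[OF \<Theta>_in[OF z]])
  have x: "fst z \<in> D" using z by auto
  fix w
  obtain u where "J (fst z) u = w" using J_surj[OF x] by blast
  then show "w \<bullet> (b.g (\<Theta> z) *v p) = w \<bullet> (b.g (\<Theta> z) *v q)" using eq[of u] by simp
qed

text \<open>The inhomogeneous term is the one by which the second derivative of a curve transforms, so that
  \<open>x'' + 2 G\<close> transforms as a vector.\<close>

lemma spray_change:
  assumes z: "z \<in> WD"
  shows "J (fst z) (a.G z) = b.G (\<Theta> z) + (1/2) *\<^sub>R H (fst z) (snd z) (snd z)"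
proof (rule b_nondeg[OF z])
  fix u
  have x: "fst z \<in> D" using z by auto
  let ?y = "snd z" and ?x = "fst z"
  note dE = b.diff_W[OF b.smooth_E \<Theta>_in[OF z]] and ddE = b.diff_W[OF smooth_on_ddir[OF b.smooth_E] \<Theta>_in[OF z]]
  have J0: "J ?x 0 = 0" using linear_0[OF linear_J[OF x]] .
  have y\<Theta>: "snd (\<Theta> z) = J ?x ?y" by (simp add: \<Theta>_def)
  have "4 * (J ?x u \<bullet> (b.g (\<Theta> z) *v J ?x (a.G z))) = 4 * (u \<bullet> (a.g z *v a.G z))"
    using g_change[OF z] by simp
  also have "\<dots> = ddir (?y, 0) (ddir (0, u) a.E) z - ddir (u, 0) a.E z"
    by (rule a.g_spray[OF WD_sub[OF z]])
  also have "\<dots> = ddir (0, H ?x ?y u) b.E (\<Theta> z) + ddir (J ?x ?y, H ?x ?y ?y) (ddir (0, J ?x u) b.E) (\<Theta> z)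
      - ddir (J ?x u, H ?x u ?y) b.E (\<Theta> z)"
    unfolding ddir_ddir_vert_E_change[OF z] ddir_E_change[OF z] by (simp add: J0)
  also have "\<dots> = (ddir (J ?x ?y, 0) (ddir (0, J ?x u) b.E) (\<Theta> z) - ddir (J ?x u, 0) b.E (\<Theta> z))
      + ddir (0, H ?x ?y ?y) (ddir (0, J ?x u) b.E) (\<Theta> z)"
    using ddir_split[OF ddE, where u="J ?x ?y" and v="H ?x ?y ?y"] ddir_split[OF dE, of "J ?x u" "H ?x u ?y"]
    by (simp add: H_sym[OF x, of u ?y])
  also have "\<dots> = 4 * (J ?x u \<bullet> (b.g (\<Theta> z) *v b.G (\<Theta> z))) + 2 * (H ?x ?y ?y \<bullet> (b.g (\<Theta> z) *v J ?x u))"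
    unfolding b.g_spray[OF \<Theta>_in[OF z], unfolded y\<Theta>] b.g_apply[OF \<Theta>_in[OF z], of "H ?x ?y ?y"] by simp
  also have "H ?x ?y ?y \<bullet> (b.g (\<Theta> z) *v J ?x u) = J ?x u \<bullet> (b.g (\<Theta> z) *v H ?x ?y ?y)"
    by (rule b.g_sym[OF \<Theta>_in[OF z]])
  finally show "J ?x u \<bullet> (b.g (\<Theta> z) *v J ?x (a.G z))
      = J ?x u \<bullet> (b.g (\<Theta> z) *v (b.G (\<Theta> z) + (1/2) *\<^sub>R H ?x ?y ?y))"
    by (simp add: matrix_vector_right_distrib matrix_vector_mult_scaleR inner_simps)
qed

lemma vertical_line:
  assumes "f differentiable (at z)"
  shows "((\<lambda>t. f (fst z, snd z + t *\<^sub>R v)) has_vector_derivative ddir (0, v) f z) (at 0)"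
  using ddir_along_line[of f z 0 "(0, v)"] assms by (simp add: plus_prod_def)

lemma \<Theta>_line:
  "fst z \<in> D \<Longrightarrow> \<Theta> (fst z, snd z + t *\<^sub>R v) = (fst (\<Theta> z), snd (\<Theta> z) + t *\<^sub>R J (fst z) v)"
  by (simp add: \<Theta>_def J_add J_scale)

lemma eventually_line_in_WD:
  assumes z: "z \<in> WD"
  obtains T where "open T" "0 \<in> T" "\<And>t. t \<in> T \<Longrightarrow> (fst z, snd z + t *\<^sub>R v) \<in> WD"
proof
  show "open ((\<lambda>t. (fst z, snd z + t *\<^sub>R v)) -` WD)"
    by (rule open_vimage[OF open_WD]) (intro continuous_intros)
qed (use z in auto)

text \<open>Along a vertical line the base point and hence the Jacobian are constant, so the law for the spray
  can be differentiated there with only the quadratic term to watch.\<close>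

lemma nonlin_change:
  assumes z: "z \<in> WD"
  shows "J (fst z) (a.N z v) = b.N (\<Theta> z) (J (fst z) v) + H (fst z) (snd z) v"
proof -
  have x: "fst z \<in> D" using z by auto
  let ?y = "snd z" and ?x = "fst z"
  obtain T where T: "open T" "0 \<in> T" "\<And>t. t \<in> T \<Longrightarrow> (?x, ?y + t *\<^sub>R v) \<in> WD"
    using eventually_line_in_WD[OF z] by blast
  have bl: "bounded_linear (J ?x)" using linear_J[OF x] linear_conv_bounded_linear by blast
  have 1: "((\<lambda>t. J ?x (a.G (?x, ?y + t *\<^sub>R v))) has_vector_derivative J ?x (a.N z v)) (at 0)"
    unfolding nonlin_op_def
    by (rule bounded_linear.has_vector_derivative[OF bl vertical_line[OF a.diff_W[OF a.smooth_G WD_sub[OF z]]]])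
  have 2: "((\<lambda>t. b.G (fst (\<Theta> z), snd (\<Theta> z) + t *\<^sub>R J ?x v)) has_vector_derivative b.N (\<Theta> z) (J ?x v)) (at 0)"
    unfolding nonlin_op_def by (rule vertical_line[OF b.diff_W[OF b.smooth_G \<Theta>_in[OF z]]])
  have Hexp: "H ?x (?y + t *\<^sub>R v) (?y + t *\<^sub>R v) = H ?x ?y ?y + (2 * t) *\<^sub>R H ?x ?y v + (t * t) *\<^sub>R H ?x v v" for t
    by (simp add: H_add[OF x] H_scale[OF x] H_sym[OF x, of v ?y] vec_eq_iff algebra_simps)
  have 3: "((\<lambda>t. (1/2) *\<^sub>R H ?x (?y + t *\<^sub>R v) (?y + t *\<^sub>R v)) has_vector_derivative H ?x ?y v) (at 0)"
    unfolding Hexp by (auto intro!: derivative_eq_intros)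
  have "((\<lambda>t. b.G (fst (\<Theta> z), snd (\<Theta> z) + t *\<^sub>R J ?x v) + (1/2) *\<^sub>R H ?x (?y + t *\<^sub>R v) (?y + t *\<^sub>R v))
      has_vector_derivative b.N (\<Theta> z) (J ?x v) + H ?x ?y v) (at 0)"
    by (rule has_vector_derivative_add[OF 2 3])
  then have "((\<lambda>t. J ?x (a.G (?x, ?y + t *\<^sub>R v))) has_vector_derivative b.N (\<Theta> z) (J ?x v) + H ?x ?y v) (at 0)"
  proof (rule has_vector_derivative_transform_within_open[OF _ T(1,2)])
    fix t assume "t \<in> T"
    from spray_change[OF T(3)[OF this]]
    show "b.G (fst (\<Theta> z), snd (\<Theta> z) + t *\<^sub>R J ?x v) + (1/2) *\<^sub>R H ?x (?y + t *\<^sub>R v) (?y + t *\<^sub>R v)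
        = J ?x (a.G (?x, ?y + t *\<^sub>R v))"
      by (simp add: \<Theta>_line[OF x])
  qed
  from vector_derivative_unique_at[OF 1 this] show ?thesis .
qed

lemma cartan_change:
  assumes z: "z \<in> WD"
  shows "J (fst z) (a.C z w u) = b.C (\<Theta> z) (J (fst z) w) (J (fst z) u)"
proof (rule b_nondeg[OF z])
  fix v
  have x: "fst z \<in> D" using z by auto
  let ?y = "snd z" and ?x = "fst z"
  obtain T where T: "open T" "0 \<in> T" "\<And>t. t \<in> T \<Longrightarrow> (?x, ?y + t *\<^sub>R w) \<in> WD"
    using eventually_line_in_WD[OF z] by blast
  have bl: "bounded_linear (\<lambda>A :: real^'n^'n. p \<bullet> (A *v q))" for p q
    using bounded_linear_compose[OF bounded_linear_inner_right
        bounded_bilinear.bounded_linear_left[OF bounded_bilinear_matrix_vector]] by blast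
  have 1: "((\<lambda>t. v \<bullet> (a.g (?x, ?y + t *\<^sub>R w) *v u)) has_vector_derivative v \<bullet> (ddir (0, w) a.g z *v u)) (at 0)"
    by (rule bounded_linear.has_vector_derivative[OF bl vertical_line[OF a.diff_W[OF a.smooth_g WD_sub[OF z]]]])
  have 2: "((\<lambda>t. J ?x v \<bullet> (b.g (fst (\<Theta> z), snd (\<Theta> z) + t *\<^sub>R J ?x w) *v J ?x u))
      has_vector_derivative J ?x v \<bullet> (ddir (0, J ?x w) b.g (\<Theta> z) *v J ?x u)) (at 0)"
    by (rule bounded_linear.has_vector_derivative[OF bl vertical_line[OF b.diff_W[OF b.smooth_g \<Theta>_in[OF z]]]])
  have "((\<lambda>t. v \<bullet> (a.g (?x, ?y + t *\<^sub>R w) *v u))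
      has_vector_derivative J ?x v \<bullet> (ddir (0, J ?x w) b.g (\<Theta> z) *v J ?x u)) (at 0)"
    by (rule has_vector_derivative_transform_within_open[OF 2 T(1,2)])
      (use g_change[OF T(3), of _ v u] \<Theta>_line[OF x] in simp)
  from vector_derivative_unique_at[OF 1 this]
  have "v \<bullet> (ddir (0, w) a.g z *v u) = J ?x v \<bullet> (ddir (0, J ?x w) b.g (\<Theta> z) *v J ?x u)" .
  then have "v \<bullet> (a.g z *v a.C z w u) = J ?x v \<bullet> (b.g (\<Theta> z) *v b.C (\<Theta> z) (J ?x w) (J ?x u))"
    by (simp add: a.g_cartan[OF WD_sub[OF z]] b.g_cartan[OF \<Theta>_in[OF z]])
  then show "J ?x v \<bullet> (b.g (\<Theta> z) *v J ?x (a.C z w u)) = J ?x v \<bullet> (b.g (\<Theta> z) *v b.C (\<Theta> z) (J ?x w) (J ?x u))"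
    using g_change[OF z, of v "a.C z w u"] by simp
qed

lemma circle_eq_change:
  assumes x: "regular_curve D I x" and t: "t \<in> I" and circ: "circle_eq La x t"
  shows "circle_eq Lb (\<theta> \<circ> x) t"
proof -
  have I: "open I" "smooth_on I x" "smooth_on I (vel x)" and xD: "\<And>t. t \<in> I \<Longrightarrow> x t \<in> D"
    using x smooth_on_vel by (auto simp: regular_curve_def)
  have xa: "regular_curve Ua I x" using x D_sub by (auto simp: regular_curve_def)
  have z: "lift x t \<in> WD" if "t \<in> I" for t using regular_curve_lift(3)[OF x that] .
  have deriv: "((\<lambda>t. J (x t) (f t)) has_vector_derivative J (x t) f' + H (x t) (vel x t) (f t)) (at t)"
    if "t \<in> I" "(f has_vector_derivative f') (at t)" for t f f'
  proof -
    note h = has_derivative_ddir_comp[OF open_D smooth_\<theta> xD[OF that(1)]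
        smooth_on_has_vel[OF I(2) that(1), unfolded has_vector_derivative_def]
        that(2)[unfolded has_vector_derivative_def]]
    have "ddir (r *\<^sub>R f') \<theta> (x t) + ddir (r *\<^sub>R vel x t) (ddir (f t) \<theta>) (x t)
        = r *\<^sub>R (J (x t) f' + H (x t) (vel x t) (f t))" for r
      using ddir_scale_dir[OF diff_\<theta>(1)[OF xD[OF that(1)]]] ddir_scale_dir[OF diff_\<theta>(2)[OF xD[OF that(1)]]]
      by (simp add: scaleR_add_right)
    then show ?thesis using h unfolding has_vector_derivative_def by simp
  qed
  have vel1: "vel (\<theta> \<circ> x) t = J (x t) (vel x t)" if "t \<in> I" for t
    unfolding o_def
    by (rule vector_derivative_at[OF ddir_along_curve[OF diff_\<theta>(1)[OF xD[OF that]] smooth_on_has_vel[OF I(2) that]]])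
  have lift: "lift (\<theta> \<circ> x) t = \<Theta> (lift x t)" if "t \<in> I" for t
    unfolding lift_def \<Theta>_def by (simp add: vel1[OF that])
  have vel2: "vel (vel (\<theta> \<circ> x)) t = J (x t) (vel (vel x) t) + H (x t) (vel x t) (vel x t)" if "t \<in> I" for t
  proof -
    have "vel (vel (\<theta> \<circ> x)) t = vel (\<lambda>t. J (x t) (vel x t)) t"
      by (rule vel_cong[OF I(1) that vel1])
    also have "\<dots> = J (x t) (vel (vel x) t) + H (x t) (vel x t) (vel x t)"
      by (rule vector_derivative_at[OF deriv[OF that smooth_on_has_vel[OF I(3) that]]])
    finally show ?thesis .
  qed
  have acc: "circle_acc Lb (\<theta> \<circ> x) t = J (x t) (circle_acc La x t)" if "t \<in> I" for t
    using spray_change[OF z[OF that]]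
    unfolding circle_acc_def lift[OF that] vel2[OF that]
    by (simp add: lift_def J_add[OF xD[OF that]] J_scale[OF xD[OF that]] scaleR_add_right)
  let ?A = "circle_acc La x t" and ?z = "lift x t"
  have zx: "fst ?z = x t" "snd ?z = vel x t" by (simp_all add: lift_def)
  have vacc: "vel (circle_acc Lb (\<theta> \<circ> x)) t = J (x t) (vel (circle_acc La x) t) + H (x t) (vel x t) ?A"
  proof -
    have "vel (circle_acc Lb (\<theta> \<circ> x)) t = vel (\<lambda>t. J (x t) (circle_acc La x t)) t"
      by (rule vel_cong[OF I(1) t acc])
    also have "\<dots> = J (x t) (vel (circle_acc La x) t) + H (x t) (vel x t) ?A"
      by (rule vector_derivative_at[OF deriv[OF t smooth_on_has_vel[OF a.smooth_circle_acc[OF xa] t]]])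
    finally show ?thesis .
  qed
  have "vel (circle_acc Lb (\<theta> \<circ> x)) t + b.N (\<Theta> ?z) (J (x t) ?A) + b.C (\<Theta> ?z) (J (x t) ?A) (J (x t) ?A)
      + metric La ?z ?A ?A *\<^sub>R J (x t) (vel x t)
    = J (x t) (vel (circle_acc La x) t + a.N ?z ?A + a.C ?z ?A ?A + metric La ?z ?A ?A *\<^sub>R vel x t)"
    using nonlin_change[OF z[OF t], of ?A] cartan_change[OF z[OF t], of ?A ?A]
    unfolding vacc zx by (simp add: J_add[OF xD[OF t]] J_scale[OF xD[OF t]])
  also have "\<dots> = 0" using circ linear_0[OF linear_J[OF xD[OF t]]] unfolding circle_eq_def by simp
  finally show ?thesis
    unfolding circle_eq_def acc[OF t] lift[OF t] vel1[OF t] metric_change[OF z[OF t]] zx .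
qed

end

section \<open>Existence of geodesic circles\<close>

context finsler_patch
begin

text \<open>The circle equation as a first-order system for line element and acceleration.\<close>

definition circle_field :: "'n tpoint \<times> (real^'n) \<Rightarrow> 'n tpoint \<times> (real^'n)" where
  "circle_field w = (let z = fst w; A = snd w in
     ((snd z, A - 2 *\<^sub>R G z), - N z A - C z A A - (A \<bullet> (g z *v A) / E z) *\<^sub>R snd z))"

lemma smooth_circle_field: "smooth_on (W \<times> UNIV) circle_field"
proof -
  let ?T = "W \<times> (UNIV :: (real^'n) set)"
  have T: "open ?T" by (intro open_Times open_W open_UNIV)
  have inW: "fst w \<in> W" if "w \<in> ?T" for w using that by auto
  have f: "smooth_on ?T (\<lambda>w. fst w)" and A: "smooth_on ?T (\<lambda>w. snd w)"
    by (intro smooth_on_fst smooth_on_snd smooth_on_ident T)+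
  have comp: "smooth_on ?T (\<lambda>w. h (fst w))" if "smooth_on W h" for h :: "'n tpoint \<Rightarrow> 'z::real_normed_vector"
    by (rule smooth_on_compose[OF that f T open_W inW])
  have vert: "smooth_on ?T (\<lambda>w. ddir (0, snd w) h (fst w))" if "smooth_on W h" for h :: "'n tpoint \<Rightarrow> 'z::real_normed_vector"
  proof (rule smooth_on_cong[OF T])
    show "smooth_on ?T (\<lambda>w. ddir ((0, snd w), 0) (\<lambda>w. h (fst w)) w)"
      by (rule smooth_on_ddir_var[OF T comp[OF that]]) (intro smooth_on_Pair smooth_on_const A T)
    show "ddir ((0, snd w), 0) (\<lambda>w. h (fst w)) w = ddir (0, snd w) h (fst w)" if "w \<in> ?T" for w
      using ddir_comp_fst[OF diff_W[OF \<open>smooth_on W h\<close> inW[OF that]], of "((0, snd w), 0)"] by simp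
  qed
  have y: "smooth_on ?T (\<lambda>w. snd (fst w))" by (intro smooth_on_snd f T)
  have E0: "E (fst w) \<noteq> 0" if "w \<in> ?T" for w using E_pos[OF inW[OF that]] by simp
  show ?thesis
    unfolding circle_field_def[abs_def] Let_def nonlin_op_def cartan_op_def
    by (intro smooth_on_Pair smooth_on_diff smooth_on_minus smooth_on_scaleR smooth_on_const
        smooth_on_matrix_vector smooth_on_divide smooth_on_inner T y A E0
        vert[OF smooth_G] vert[OF smooth_g] comp[OF smooth_fund_inv] comp[OF smooth_g] comp[OF smooth_E]
        comp[OF smooth_G])
qed

text \<open>With the division by the energy in \<open>circle_field\<close> the inner product of velocity and acceleration
  is constant along every solution. Hence it stays \<open>0\<close>, then the energy stays \<open>1\<close>, and the division has
  no effect on the solution.\<close>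

lemma circle_exists:
  assumes z0: "z0 \<in> W" "L z0 = 1" and A0: "snd z0 \<bullet> (g z0 *v A0) = 0"
  obtains d x where "d > 0" "regular_curve U {-d<..<d} x" "lift x 0 = z0" "circle_acc L x 0 = A0"
    "\<And>t. t \<in> {-d<..<d} \<Longrightarrow> L (lift x t) = 1" "\<And>t. t \<in> {-d<..<d} \<Longrightarrow> circle_eq L x t"
proof -
  let ?T = "W \<times> (UNIV :: (real^'n) set)"
  have T: "open ?T" by (intro open_Times open_W open_UNIV)
  have w0: "(z0, A0) \<in> ?T" using z0 by simp
  obtain d r where d: "d > 0" "r > 0" and sol: "\<And>w. w \<in> cball (z0, A0) r \<Longrightarrow> \<exists>u. u 0 = w \<and>
    (\<forall>t\<in>{-d<..<d}. u t \<in> ?T \<and> (u has_vector_derivative circle_field (u t)) (at t))"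
    using ode_local_solutions[OF T smooth_circle_field w0] by metis
  obtain u where u0: "u 0 = (z0, A0)" and
    u: "\<And>t. t \<in> {-d<..<d} \<Longrightarrow> u t \<in> ?T \<and> (u has_vector_derivative circle_field (u t)) (at t)"
    using sol[of "(z0, A0)"] d by auto
  let ?I = "{-d<..<d}"
  define z where "z t = fst (u t)" for t
  define A where "A t = snd (u t)" for t
  define x where "x t = fst (z t)" for t
  define y where "y t = snd (z t)" for t
  have I: "open ?I" "0 \<in> ?I" using d by auto
  have zW: "z t \<in> W" if "t \<in> ?I" for t
  proof -
    have "u t \<in> ?T" using u[OF that] by blast
    then show ?thesis unfolding z_def by (simp add: mem_Times_iff)
  qed
  have zd: "(z has_vector_derivative (y t, A t - 2 *\<^sub>R G (z t))) (at t)" if "t \<in> ?I" for t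
    using bounded_linear.has_vector_derivative[OF bounded_linear_fst conjunct2[OF u[OF that]]]
    by (simp add: z_def[abs_def] A_def y_def circle_field_def Let_def)
  have Ad: "(A has_vector_derivative - N (z t) (A t) - C (z t) (A t) (A t)
      - (A t \<bullet> (g (z t) *v A t) / E (z t)) *\<^sub>R y t) (at t)" if "t \<in> ?I" for t
    using bounded_linear.has_vector_derivative[OF bounded_linear_snd conjunct2[OF u[OF that]]]
    by (simp add: z_def A_def[abs_def] y_def circle_field_def Let_def)
  have xd: "(x has_vector_derivative y t) (at t)" if "t \<in> ?I" for t
    using bounded_linear.has_vector_derivative[OF bounded_linear_fst zd[OF that]] by (simp add: x_def[abs_def])
  have yd: "(y has_vector_derivative A t - 2 *\<^sub>R G (z t)) (at t)" if "t \<in> ?I" for t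
    using bounded_linear.has_vector_derivative[OF bounded_linear_snd zd[OF that]] by (simp add: y_def[abs_def])
  have velx: "vel x t = y t" if "t \<in> ?I" for t by (rule vector_derivative_at[OF xd[OF that]])
  have lift: "lift x t = z t" if "t \<in> ?I" for t by (simp add: lift_def velx[OF that] x_def y_def)
  have vely: "vel (vel x) t = A t - 2 *\<^sub>R G (z t)" if "t \<in> ?I" for t
    using vel_cong[OF I(1) that velx] vector_derivative_at[OF yd[OF that]] by simp
  have acc: "circle_acc L x t = A t" if "t \<in> ?I" for t
    unfolding circle_acc_def vely[OF that] lift[OF that] by simp
  have velacc: "vel (circle_acc L x) t = - N (z t) (A t) - C (z t) (A t) (A t)
      - (A t \<bullet> (g (z t) *v A t) / E (z t)) *\<^sub>R y t" if "t \<in> ?I" for t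
    using vel_cong[OF I(1) that acc] vector_derivative_at[OF Ad[OF that]] by simp
  have "smooth_on ?I u" by (rule ode_solution_smooth[OF I(1) T smooth_circle_field]) (use u in auto)
  then have "smooth_on ?I x" unfolding x_def z_def by (intro smooth_on_fst I)
  moreover have "x t \<in> U \<and> vel x t \<noteq> 0" if "t \<in> ?I" for t
    using zW[OF that] velx[OF that] by (auto simp: x_def y_def mem_Times_iff)
  ultimately have reg: "regular_curve U ?I x" using I by (simp add: regular_curve_def)
  have snd_split: "(y t, A t - 2 *\<^sub>R G (z t)) = (y t, -2 *\<^sub>R G (z t)) + (0, A t)" for t by simp
  have md: "((\<lambda>t. y t \<bullet> (g (z t) *v A t)) has_vector_derivative 0) (at t)" if "t \<in> ?I" for t
  proof -
    note zt = zW[OF that]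
    note dg = diff_W[OF smooth_g zt]
    have yz: "snd (z t) = y t" by (simp add: y_def)
    have gd: "((\<lambda>t. g (z t)) has_vector_derivative ddir (y t, A t - 2 *\<^sub>R G (z t)) g (z t)) (at t)"
      by (rule ddir_along_curve[OF dg zd[OF that]])
    let ?A' = "- N (z t) (A t) - C (z t) (A t) (A t) - (A t \<bullet> (g (z t) *v A t) / E (z t)) *\<^sub>R y t"
    let ?g' = "ddir (y t, -2 *\<^sub>R G (z t)) g (z t) + ddir (0, A t) g (z t)"
    have "ddir (y t, A t - 2 *\<^sub>R G (z t)) g (z t) = ?g'"
      unfolding snd_split by (rule ddir_add_dir[OF dg])
    from bounded_bilinear.has_vector_derivative[OF bounded_bilinear_inner yd[OF that]
        bounded_bilinear.has_vector_derivative[OF bounded_bilinear_matrix_vector gd[unfolded this] Ad[OF that]]]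
    have "((\<lambda>t. y t \<bullet> (g (z t) *v A t)) has_vector_derivative
        y t \<bullet> (g (z t) *v ?A' + ?g' *v A t) + (A t - 2 *\<^sub>R G (z t)) \<bullet> (g (z t) *v A t)) (at t)" .
    moreover have "y t \<bullet> (g (z t) *v ?A' + ?g' *v A t) + (A t - 2 *\<^sub>R G (z t)) \<bullet> (g (z t) *v A t) = 0"
    proof -
      have 1: "y t \<bullet> (ddir (y t, -2 *\<^sub>R G (z t)) g (z t) *v A t)
          = y t \<bullet> (g (z t) *v N (z t) (A t)) + 2 * (G (z t) \<bullet> (g (z t) *v A t))"
        using g_derivative_along_spray[OF zt, of "y t" "A t"] nonlin_snd[OF zt] g_sym[OF zt, of "G (z t)" "A t"]
        by (simp add: yz matrix_vector_mult_scaleR)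
      have 2: "y t \<bullet> (ddir (0, A t) g (z t) *v A t) = 0" "y t \<bullet> (g (z t) *v C (z t) (A t) (A t)) = 0"
        using cartan_orth[OF zt, of "A t" "A t"] g_cartan[OF zt, of "y t" "A t" "A t"] by (simp_all add: yz)
      have 3: "y t \<bullet> (g (z t) *v y t) = E (z t)" "E (z t) \<noteq> 0"
        using E_eq[OF zt] E_pos[OF zt] by (simp_all add: yz)
      show ?thesis
        using 1 2 3
        by (simp add: matrix_vector_mult_add_rdistrib matrix_vector_right_distrib matrix_vector_mult_diff_distrib
            matrix_vector_mult_scaleR vec.neg inner_simps)
    qed
    ultimately show ?thesis by simp
  qed
  have conv: "convex ?I" by simp
  have m0: "y t \<bullet> (g (z t) *v A t) = 0" if "t \<in> ?I" for t
  proof -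
    obtain c where c: "\<And>t. t \<in> ?I \<Longrightarrow> y t \<bullet> (g (z t) *v A t) = c"
      using has_vector_derivative_zero_constant[OF conv has_vector_derivative_at_within[OF md]] by blast
    have "y 0 \<bullet> (g (z 0) *v A 0) = 0" using A0 by (simp add: y_def z_def A_def u0)
    then show ?thesis using c[OF I(2)] c[OF that] by simp
  qed
  have Ed: "((\<lambda>t. E (z t)) has_vector_derivative 0) (at t)" if "t \<in> ?I" for t
  proof -
    note zt = zW[OF that]
    note dE = diff_W[OF smooth_E zt]
    have "ddir (y t, A t - 2 *\<^sub>R G (z t)) E (z t) = ddir (y t, -2 *\<^sub>R G (z t)) E (z t) + ddir (0, A t) E (z t)"
      unfolding snd_split by (rule ddir_add_dir[OF dE])
    also have "\<dots> = 0"
      using ddir_horizontal_E[OF zt, of "y t"] ddir_vert_E[OF zt, of "A t"] m0[OF that] nonlin_snd[OF zt]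
      by (simp add: y_def)
    finally show ?thesis using ddir_along_curve[OF dE zd[OF that]] by simp
  qed
  have E1: "E (z t) = 1" if "t \<in> ?I" for t
  proof -
    obtain c where c: "\<And>t. t \<in> ?I \<Longrightarrow> E (z t) = c"
      using has_vector_derivative_zero_constant[OF conv has_vector_derivative_at_within[OF Ed]] by blast
    have "E (z 0) = 1" using z0 by (simp add: z_def u0 energy_def)
    then show ?thesis using c[OF I(2)] c[OF that] by simp
  qed
  show thesis
  proof (rule that[OF d(1) reg])
    show "lift x 0 = z0" "circle_acc L x 0 = A0" using lift[OF I(2)] acc[OF I(2)] by (simp_all add: z_def A_def u0)
    show "L (lift x t) = 1" if "t \<in> ?I" for t
      using E1[OF that] L_nonneg[OF zW[OF that]] unfolding lift[OF that] energy_def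
      by (simp add: power2_eq_1_iff)
    show "circle_eq L x t" if "t \<in> ?I" for t
      unfolding circle_eq_def velacc[OF that] lift[OF that] acc[OF that] velx[OF that] E1[OF that] metric_eq
      by simp
  qed
qed

end

section \<open>Geodesic circles on the manifold\<close>

lemma circle_eq_cong:
  assumes "open I" "t \<in> I" "\<And>s. s \<in> I \<Longrightarrow> x s = x' s"
  shows "lift x t = lift x' t" "circle_eq L x t \<longleftrightarrow> circle_eq L x' t"
proof -
  have v: "vel x s = vel x' s" if "s \<in> I" for s by (rule vel_cong[OF assms(1) that assms(3)])
  have l: "lift x s = lift x' s" if "s \<in> I" for s by (simp add: lift_def v[OF that] assms(3)[OF that])
  have a: "circle_acc L x s = circle_acc L x' s" if "s \<in> I" for s
    using vel_cong[OF assms(1) that v] l[OF that] by (simp add: circle_acc_def)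
  show "lift x t = lift x' t" by (rule l[OF assms(2)])
  show "circle_eq L x t \<longleftrightarrow> circle_eq L x' t"
    using l[OF assms(2)] a[OF assms(2)] v[OF assms(2)] vel_cong[OF assms(1,2) a] by (simp add: circle_eq_def)
qed

locale atlas =
  fixes \<A> :: "('m::topological_space, 'n::finite) chart set"
  assumes atlas: "smooth_atlas \<A>"
begin

lemma chart:
  assumes "a \<in> \<A>"
  shows open_dom: "open (chart_dom a)" and open_img: "open (chart_img a)"
    and homeo: "homeomorphism (chart_dom a) (chart_img a) (chart_map a) (chart_inv a)"
  using atlas assms unfolding smooth_atlas_def by blast+

lemma cover: obtains a where "a \<in> \<A>" "p \<in> chart_dom a"
  using atlas unfolding smooth_atlas_def by blast

lemma chart_inv_map: "a \<in> \<A> \<Longrightarrow> p \<in> chart_dom a \<Longrightarrow> chart_inv a (chart_map a p) = p"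
  using homeomorphism_apply1[OF homeo] by blast

lemma chart_map_inv: "a \<in> \<A> \<Longrightarrow> x \<in> chart_img a \<Longrightarrow> chart_map a (chart_inv a x) = x"
  using homeomorphism_apply2[OF homeo] by blast

lemma chart_inv_dom: "a \<in> \<A> \<Longrightarrow> x \<in> chart_img a \<Longrightarrow> chart_inv a x \<in> chart_dom a"
  using homeomorphism_image2[OF homeo] by blast

lemma chart_map_img: "p \<in> chart_dom a \<Longrightarrow> chart_map a p \<in> chart_img a"
  unfolding chart_img_def by blast

definition overlap :: "('m, 'n) chart \<Rightarrow> ('m, 'n) chart \<Rightarrow> (real^'n) set" where
  "overlap a b = chart_map a ` (chart_dom a \<inter> chart_dom b)"

lemma overlap_iff:
  assumes a: "a \<in> \<A>"
  shows "x \<in> overlap a b \<longleftrightarrow> x \<in> chart_img a \<and> chart_inv a x \<in> chart_dom b"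
proof
  show "x \<in> chart_img a \<and> chart_inv a x \<in> chart_dom b" if "x \<in> overlap a b"
    using that chart_inv_map[OF a] chart_map_img[where a=a] unfolding overlap_def by auto
next
  assume x: "x \<in> chart_img a \<and> chart_inv a x \<in> chart_dom b"
  then have "x = chart_map a (chart_inv a x)" "chart_inv a x \<in> chart_dom a \<inter> chart_dom b"
    using chart_map_inv[OF a] chart_inv_dom[OF a] by auto
  then show "x \<in> overlap a b" unfolding overlap_def by (rule image_eqI)
qed

lemma open_overlap:
  assumes "a \<in> \<A>" "b \<in> \<A>" shows "open (overlap a b)"
proof -
  have "openin (top_of_set (chart_dom a)) (chart_dom a \<inter> chart_dom b)"
    using open_dom[OF assms(2)] by (simp add: openin_open_Int)
  then have "openin (top_of_set (chart_img a)) (overlap a b)"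
    unfolding overlap_def by (rule homeomorphism_imp_open_map[OF homeo[OF assms(1)]])
  then show ?thesis using open_img[OF assms(1)] openin_open_trans by blast
qed

lemma smooth_transition: "a \<in> \<A> \<Longrightarrow> b \<in> \<A> \<Longrightarrow> smooth_on (overlap a b) (transition a b)"
  using atlas unfolding smooth_atlas_def overlap_def by blast

lemma transition_in: "a \<in> \<A> \<Longrightarrow> b \<in> \<A> \<Longrightarrow> x \<in> overlap a b \<Longrightarrow> transition a b x \<in> chart_img b"
  by (simp add: overlap_iff transition_def chart_map_img)

lemma chart_inv_transition:
  "a \<in> \<A> \<Longrightarrow> b \<in> \<A> \<Longrightarrow> x \<in> overlap a b \<Longrightarrow> chart_inv b (transition a b x) = chart_inv a x"
  by (simp add: overlap_iff transition_def chart_inv_map)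

lemma diff_transition:
  "a \<in> \<A> \<Longrightarrow> b \<in> \<A> \<Longrightarrow> x \<in> overlap a b \<Longrightarrow> transition a b differentiable (at x)"
  by (rule smooth_on_differentiable[OF smooth_transition])

lemma transition_cocycle:
  assumes "a \<in> \<A>" "b \<in> \<A>" "c \<in> \<A>" "x \<in> overlap a b" "x \<in> overlap a c"
  shows "ddir y (transition a c) x = ddir (ddir y (transition a b) x) (transition b c) (transition a b x)"
proof -
  have 1: "transition a b x \<in> overlap b c"
    using assms transition_in chart_inv_transition[OF assms(1,2,4)] by (simp add: overlap_iff)
  have "ddir y (transition a c) x = ddir y (\<lambda>x. transition b c (transition a b x)) x"
  proof (rule ddir_cong[OF open_overlap[OF assms(1,2)] assms(4)])
    fix w assume "w \<in> overlap a b"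
    from chart_inv_transition[OF assms(1,2) this]
    show "transition a c w = transition b c (transition a b w)" by (simp add: transition_def)
  qed
  also have "\<dots> = ddir (ddir y (transition a b) x) (transition b c) (transition a b x)"
    by (rule ddir_eq[OF has_derivative_compose[OF has_derivative_ddir[OF diff_transition[OF assms(1,2,4)]]
            has_derivative_ddir[OF diff_transition[OF assms(2,3) 1]]]])
  finally show ?thesis .
qed

lemma ddir_transition_self: "a \<in> \<A> \<Longrightarrow> x \<in> chart_img a \<Longrightarrow> ddir y (transition a a) x = y"
proof -
  assume a: "a \<in> \<A>" "x \<in> chart_img a"
  have "ddir y (transition a a) x = ddir y (\<lambda>x. x) x"
    by (rule ddir_cong[OF open_img[OF a(1)] a(2)]) (simp add: transition_def chart_map_inv a(1))
  also have "\<dots> = y" by (rule ddir_eq) (rule has_derivative_ident)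
  finally show ?thesis .
qed

lemma tvec_of_eq: "tvec_of \<A> a p y = (\<lambda>b. if b \<in> \<A> \<and> p \<in> chart_dom b
    then ddir y (transition a b) (chart_map a p) else 0)"
  unfolding tvec_of_def ddir_def ..

lemma in_overlap: "p \<in> chart_dom a \<Longrightarrow> p \<in> chart_dom b \<Longrightarrow> chart_map a p \<in> overlap a b"
  by (simp add: overlap_def)

lemma transition_point: "a \<in> \<A> \<Longrightarrow> p \<in> chart_dom a \<Longrightarrow> transition a b (chart_map a p) = chart_map b p"
  by (simp add: transition_def chart_inv_map)

lemma tvec_of_tangent:
  assumes "a \<in> \<A>" "p \<in> chart_dom a"
  shows "tvec_of \<A> a p y \<in> tangent_space \<A> p"
proof -
  have cocycle: "ddir y (transition a c) (chart_map a p)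
      = ddir (ddir y (transition a b) (chart_map a p)) (transition b c) (chart_map b p)"
    if "b \<in> \<A>" "c \<in> \<A>" "p \<in> chart_dom b" "p \<in> chart_dom c" for b c
    using transition_cocycle[OF assms(1) that(1,2) in_overlap[OF assms(2) that(3)] in_overlap[OF assms(2) that(4)]]
    by (simp add: transition_point[OF assms])
  show ?thesis
    unfolding tangent_space_def
  proof (intro CollectI conjI allI impI ballI)
    fix b assume "\<not> (b \<in> \<A> \<and> p \<in> chart_dom b)"
    then show "tvec_of \<A> a p y b = 0" unfolding tvec_of_eq by auto
  next
    fix b c assume "b \<in> \<A>" "c \<in> \<A>" "p \<in> chart_dom b \<inter> chart_dom c"
    then show "tvec_of \<A> a p y c
        = frechet_derivative (transition b c) (at (chart_map b p)) (tvec_of \<A> a p y b)"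
      using cocycle[of b c] unfolding tvec_of_eq ddir_def by simp
  qed
qed

lemma tvec_of_scale:
  assumes "a \<in> \<A>" "p \<in> chart_dom a"
  shows "tvec_of \<A> a p (r *\<^sub>R y) = (\<lambda>b. r *\<^sub>R tvec_of \<A> a p y b)"
  unfolding tvec_of_eq
  using ddir_scale_dir[OF diff_transition[OF assms(1) _ in_overlap[OF assms(2)]]] by auto

lemma tvec_of_change:
  assumes "a \<in> \<A>" "b \<in> \<A>" "p \<in> chart_dom a" "p \<in> chart_dom b"
  shows "tvec_of \<A> a p y = tvec_of \<A> b p (ddir y (transition a b) (chart_map a p))"
proof
  fix c
  show "tvec_of \<A> a p y c = tvec_of \<A> b p (ddir y (transition a b) (chart_map a p)) c"
    using transition_cocycle[OF assms(1,2) _ in_overlap[OF assms(3,4)] in_overlap[OF assms(3)], of c y]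
    unfolding tvec_of_eq transition_point[OF assms(1,3)] by simp
qed

lemma tvec_of_self: "a \<in> \<A> \<Longrightarrow> p \<in> chart_dom a \<Longrightarrow> tvec_of \<A> a p y a = y"
  by (simp add: tvec_of_eq ddir_transition_self chart_map_img)

lemma velocity_eq:
  assumes a: "a \<in> \<A>" and J: "open J" "s \<in> J" "\<And>t. t \<in> J \<Longrightarrow> c t \<in> chart_dom a"
    and d: "(chart_map a \<circ> c) differentiable (at s)"
  shows "velocity \<A> c s = tvec_of \<A> a (c s) (chart_vel a c s)"
proof -
  have "chart_vel b c s = ddir (chart_vel a c s) (transition a b) (chart_map a (c s))"
    if b: "b \<in> \<A>" "c s \<in> chart_dom b" for b
  proof -
    have x: "((chart_map a \<circ> c) has_vector_derivative chart_vel a c s) (at s)"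
      using d by (simp add: chart_vel_def vector_derivative_works)
    have "transition a b differentiable (at ((chart_map a \<circ> c) s))"
      using diff_transition[OF a b(1) in_overlap[OF J(3)[OF J(2)] b(2)]] by simp
    from ddir_along_curve[OF this x]
    have "vel (\<lambda>t. transition a b ((chart_map a \<circ> c) t)) s
        = ddir (chart_vel a c s) (transition a b) (chart_map a (c s))"
      by (simp add: vector_derivative_at)
    moreover have "vel (chart_map b \<circ> c) s = vel (\<lambda>t. transition a b ((chart_map a \<circ> c) t)) s"
      by (rule vel_cong[OF J(1,2)]) (simp add: transition_point[OF a J(3)])
    ultimately show ?thesis by (simp add: chart_vel_def)
  qed
  then show ?thesis unfolding velocity_def tvec_of_eq by auto
qed

end

locale finsler_manifold = atlas \<A> for \<A> :: "('m::topological_space, 'n::finite) chart set" +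
  fixes F :: "('m, 'n) finsler_fun"
  assumes finsler: "finsler_structure \<A> F"
begin

abbreviation "rep a \<equiv> loc_rep \<A> F a"

lemma finsler_patch:
  assumes a: "a \<in> \<A>" shows "finsler_patch (chart_img a) (rep a)"
proof
  show "open (chart_img a)" by (rule open_img[OF a])
  show "smooth_on (chart_img a \<times> (-{0})) (rep a)"
    using finsler a unfolding finsler_structure_def slit_def by blast
  show "0 < metric (rep a) z u u" if "z \<in> chart_img a \<times> (-{0})" "u \<noteq> 0" for z u
    using finsler a that unfolding finsler_structure_def slit_def by blast
  show "0 \<le> rep a z" if "z \<in> chart_img a \<times> (-{0})" for z
  proof -
    have "chart_inv a (fst z) \<in> chart_dom a" using that chart_inv_dom[OF a] by auto
    from tvec_of_tangent[OF a this] show ?thesis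
      using finsler unfolding finsler_structure_def loc_rep_def by blast
  qed
  show "rep a (x, r *\<^sub>R y) = r * rep a (x, y)" if "x \<in> chart_img a" "y \<noteq> 0" "r > 0" for x y r
  proof -
    note p = chart_inv_dom[OF a that(1)]
    show ?thesis
      using finsler tvec_of_tangent[OF a p, of y] that(3)
      unfolding finsler_structure_def loc_rep_def by (simp add: tvec_of_scale[OF a p])
  qed
qed

lemma chart_change:
  assumes a: "a \<in> \<A>" and b: "b \<in> \<A>"
  shows "chart_change (chart_img a) (rep a) (chart_img b) (rep b) (overlap a b) (transition a b)"
proof (intro chart_change.intro finsler_patch a b chart_change_axioms.intro)
  show "open (overlap a b)" by (rule open_overlap[OF a b])
  show "overlap a b \<subseteq> chart_img a" using overlap_iff[OF a] by blast
  show "smooth_on (overlap a b) (transition a b)" by (rule smooth_transition[OF a b])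
  show "transition a b x \<in> chart_img b" if "x \<in> overlap a b" for x by (rule transition_in[OF a b that])
  show "rep a (x, y) = rep b (transition a b x, ddir y (transition a b) x)" if "x \<in> overlap a b" for x y
  proof -
    have x: "x \<in> chart_img a" "chart_inv a x \<in> chart_dom b" using that overlap_iff[OF a] by auto
    show ?thesis
      using tvec_of_change[OF a b chart_inv_dom[OF a x(1)] x(2), of y]
      by (simp add: loc_rep_def chart_inv_transition[OF a b that] chart_map_inv[OF a x(1)])
  qed
  show "v = 0" if x: "x \<in> overlap a b" and 0: "ddir v (transition a b) x = 0" for x v
  proof -
    have xa: "x \<in> chart_img a" using x overlap_iff[OF a] by auto
    then have xaa: "x \<in> overlap a a" using overlap_iff[OF a] chart_inv_dom[OF a] by blast
    have "transition a b x \<in> overlap b a"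
      using x xa transition_in[OF a b x] chart_inv_transition[OF a b x] chart_inv_dom[OF a]
      by (simp add: overlap_iff[OF b])
    then have "ddir 0 (transition b a) (transition a b x) = 0"
      by (rule ddir_zero_dir[OF diff_transition[OF b a]])
    then show ?thesis
      using transition_cocycle[OF a b a x xaa, of v] ddir_transition_self[OF a xa, of v] 0 by simp
  qed
qed

text \<open>The curve lies in one chart, but the definition tests it in every chart that it meets; this is
  where the chart independence of the circle equation is used.\<close>

lemma geodesic_circle_from_chart:
  assumes a: "a \<in> \<A>" and x: "regular_curve (chart_img a) I x"
    and unit: "\<And>t. t \<in> I \<Longrightarrow> rep a (lift x t) = 1" and circ: "\<And>t. t \<in> I \<Longrightarrow> circle_eq (rep a) x t"
  shows "geodesic_circle \<A> F I (chart_inv a \<circ> x)"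
proof -
  let ?c = "chart_inv a \<circ> x"
  have I: "open I" "smooth_on I x" and xa: "\<And>t. t \<in> I \<Longrightarrow> x t \<in> chart_img a"
    using x by (auto simp: regular_curve_def)
  have ca: "?c t \<in> chart_dom a" if "t \<in> I" for t using chart_inv_dom[OF a xa[OF that]] by simp
  have xc: "chart_map a (?c t) = x t" if "t \<in> I" for t using chart_map_inv[OF a xa[OF that]] by simp
  have eq: "chart_map b \<circ> ?c = transition a b \<circ> x" for b by (simp add: transition_def comp_assoc)
  have Ib: "open {t \<in> I. ?c t \<in> chart_dom b}"
    and inov: "\<And>t. t \<in> {t \<in> I. ?c t \<in> chart_dom b} \<Longrightarrow> x t \<in> overlap a b" if b: "b \<in> \<A>" for b
  proof -
    have "{t \<in> I. ?c t \<in> chart_dom b} = I \<inter> x -` overlap a b"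
      using xa overlap_iff[OF a, of _ b] by auto
    moreover have "open (I \<inter> x -` overlap a b)"
      using continuous_open_preimage[OF smooth_on_continuous[OF I(2)] I(1) open_overlap[OF a b]] .
    ultimately show "open {t \<in> I. ?c t \<in> chart_dom b}" by simp
    show "\<And>t. t \<in> {t \<in> I. ?c t \<in> chart_dom b} \<Longrightarrow> x t \<in> overlap a b"
      using xa overlap_iff[OF a, of _ b] by auto
  qed
  have sm: "smooth_on {t \<in> I. ?c t \<in> chart_dom b} (transition a b \<circ> x)" if b: "b \<in> \<A>" for b
    unfolding o_def
    by (rule smooth_on_compose[OF smooth_transition[OF a b] _ Ib[OF b, unfolded o_def] open_overlap[OF a b]
          inov[OF b, unfolded o_def]])
      (use smooth_on_subset[OF I(2)] in auto)
  have cont: "continuous_on I ?c"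
    using continuous_on_compose[OF smooth_on_continuous[OF I(2)]]
      continuous_on_subset[OF homeomorphism_cont2[OF homeo[OF a]]] xa by (metis image_subsetI)
  have curve: "smooth_curve \<A> I ?c"
    unfolding smooth_curve_def using cont sm by (simp add: eq)
  have speed: "F (?c s) (velocity \<A> ?c s) = 1" if s: "s \<in> I" for s
  proof -
    have d: "(chart_map a \<circ> ?c) differentiable (at s)"
      by (rule differentiable_cong_open[OF I(1) s _ smooth_on_differentiable[OF I(2) s]]) (use xc in simp)
    have v: "chart_vel a ?c s = vel x s"
      unfolding chart_vel_def by (rule vel_cong[OF I(1) s]) (use xc in simp)
    show ?thesis
      using velocity_eq[OF a I(1) s ca d] unit[OF s] by (simp add: v loc_rep_def lift_def)
  qed
  have chart: "circle_eq (rep b) (chart_map b \<circ> ?c) s \<and> regular_curve (chart_img b) {t \<in> I. ?c t \<in> chart_dom b} (chart_map b \<circ> ?c)"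
    if b: "b \<in> \<A>" and s: "s \<in> I" "?c s \<in> chart_dom b" for b s
  proof
    interpret cc: chart_change "chart_img a" "rep a" "chart_img b" "rep b" "overlap a b" "transition a b"
      by (rule chart_change[OF a b])
    let ?I = "{t \<in> I. ?c t \<in> chart_dom b}"
    have xI: "regular_curve (overlap a b) ?I x"
      using x Ib[OF b] inov[OF b] smooth_on_subset[OF I(2), of ?I] by (auto simp: regular_curve_def)
    have s': "s \<in> ?I" using s by simp
    show "circle_eq (rep b) (chart_map b \<circ> ?c) s"
      unfolding eq by (rule cc.circle_eq_change[OF xI s' circ[OF s(1)]])
    have "vel (transition a b \<circ> x) t = ddir (vel x t) (transition a b) (x t)" if t: "t \<in> ?I" for t
      unfolding o_def
      by (rule vector_derivative_at[OF ddir_along_curve[OF diff_transition[OF a b inov[OF b t]] smooth_on_has_vel[OF I(2)]]])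
        (use t in simp)
    then have "vel (transition a b \<circ> x) t \<noteq> 0" if t: "t \<in> ?I" for t
      using cc.\<theta>_inj[OF inov[OF b t], of "vel x t"] x t by (auto simp: regular_curve_def)
    then show "regular_curve (chart_img b) ?I (chart_map b \<circ> ?c)"
      unfolding eq regular_curve_def using Ib[OF b] sm[OF b] transition_in[OF a b inov[OF b]] by auto
  qed
  have "let c1 = chart_vel b ?c; c2 = cov_deriv (rep b) b ?c c1; c3 = cov_deriv (rep b) b ?c c2
      in c3 s + metric (rep b) (chart_lift b ?c s) (c2 s) (c2 s) *\<^sub>R c1 s = 0"
    if b: "b \<in> \<A>" and s: "s \<in> I" "?c s \<in> chart_dom b" for b s
    using finsler_patch.circle_eq_chart[OF finsler_patch[OF b] conjunct2[OF chart[OF b s]], of s]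
      conjunct1[OF chart[OF b s]] s by blast
  then show ?thesis
    unfolding geodesic_circle_def Let_def using curve speed by blast
qed

end

text \<open>All that remains of the preservation of circles is a condition on single line elements, with a
  free parameter \<open>A\<close> for the initial acceleration of the circle.\<close>

locale circle_patch = conformal_patch U L \<sigma> for U :: "(real^'n::finite) set" and L and \<sigma> +
  assumes circle_cond: "\<And>z A. z \<in> U \<times> (-{0}) \<Longrightarrow> L z = 1 \<Longrightarrow> snd z \<bullet> (fund_tensor L z *v A) = 0 \<Longrightarrow>
    \<exists>\<mu>. ddir (snd z, - nonlin_op L z (snd z)) S z + nonlin_op L z (S z) - cartan_op L z A (S z)
      - ds (fst z) (snd z) *\<^sub>R S z = \<mu> *\<^sub>R snd z"

locale circle_preserving = finsler_manifold \<A> F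
  for \<A> :: "('m::topological_space, 'n::finite) chart set" and F +
  fixes \<sigma> :: "'m \<Rightarrow> real"
  assumes preserving: "conformal_circle_preserving \<A> F \<sigma>"
begin

lemma smooth_factor: "a \<in> \<A> \<Longrightarrow> smooth_on (chart_img a) (\<sigma> \<circ> chart_inv a)"
  using preserving unfolding conformal_circle_preserving_def smooth_function_def by blast

lemma conformal_patch: "a \<in> \<A> \<Longrightarrow> conformal_patch (chart_img a) (rep a) (\<sigma> \<circ> chart_inv a)"
  by (intro conformal_patch.intro finsler_patch conformal_patch_axioms.intro smooth_factor)

lemma rep_conformal: "loc_rep \<A> (conformal_change \<sigma> F) a = (\<lambda>z. exp ((\<sigma> \<circ> chart_inv a) (fst z)) * rep a z)"
  by (simp add: fun_eq_iff loc_rep_def conformal_change_def)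

lemma circle_patch:
  assumes a: "a \<in> \<A>"
  shows "circle_patch (chart_img a) (rep a) (\<sigma> \<circ> chart_inv a)"
proof -
  interpret c: conformal_patch "chart_img a" "rep a" "\<sigma> \<circ> chart_inv a" by (rule conformal_patch[OF a])
  show ?thesis
  proof (intro circle_patch.intro conformal_patch a circle_patch_axioms.intro)
    fix z A assume z: "z \<in> c.W" "rep a z = 1" and A: "snd z \<bullet> (c.g z *v A) = 0"
    obtain d x where d: "d > 0" and x: "regular_curve (chart_img a) {-d<..<d} x" "lift x 0 = z" "circle_acc (rep a) x 0 = A"
      "\<And>t. t \<in> {-d<..<d} \<Longrightarrow> rep a (lift x t) = 1" "\<And>t. t \<in> {-d<..<d} \<Longrightarrow> circle_eq (rep a) x t"
      using c.circle_exists[OF z A] by blast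
    let ?I = "{-d<..<d}" and ?c = "chart_inv a \<circ> x" and ?L' = "loc_rep \<A> (conformal_change \<sigma> F) a"
    have "geodesic_circle \<A> F ?I ?c"
      by (rule geodesic_circle_from_chart[OF a x(1,4,5)])
    moreover have "open_interval ?I" using d by (auto simp: open_interval_def is_interval_def)
    ultimately obtain J h where J: "open_interval J" "smooth_on J h" "bij_betw h J ?I" "\<forall>s\<in>J. deriv h s > 0"
      and circ': "geodesic_circle \<A> (conformal_change \<sigma> F) J (?c \<circ> h)"
      using preserving unfolding conformal_circle_preserving_def by blast
    have oJ: "open J" using J(1) by (simp add: open_interval_def)
    have hI: "h s \<in> ?I" if "s \<in> J" for s using J(3) that by (auto simp: bij_betw_def)
    have xh: "x (h s) \<in> chart_img a" if "s \<in> J" for s using x(1) hI[OF that] by (simp add: regular_curve_def)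
    have ch: "(?c \<circ> h) s \<in> chart_dom a" if "s \<in> J" for s using chart_inv_dom[OF a xh[OF that]] by simp
    have eq: "(chart_map a \<circ> (?c \<circ> h)) s = (x \<circ> h) s" if "s \<in> J" for s using chart_map_inv[OF a xh[OF that]] by simp
    have hpos: "vel h s > 0" if "s \<in> J" for s
      using J(4) that by (simp add: field_derivative_eq_vector_derivative)
    have sm: "smooth_on J (x \<circ> h)"
      unfolding o_def using x(1) by (intro smooth_on_compose[OF _ J(2) oJ _ hI]) (auto simp: regular_curve_def)
    have velxh: "vel (x \<circ> h) s \<noteq> 0" if "s \<in> J" for s
    proof -
      have "vel (x \<circ> h) s = vel h s *\<^sub>R vel x (h s)"
        using x(1) hI[OF that]
        by (intro vector_derivative_at[OF vector_diff_chain_at] smooth_on_has_vel[OF J(2) that]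
            smooth_on_has_vel[of ?I x]) (auto simp: regular_curve_def)
      then show ?thesis using hpos[OF that] x(1) hI[OF that] by (simp add: regular_curve_def)
    qed
    have reg: "regular_curve (chart_img a) J (chart_map a \<circ> (?c \<circ> h))"
    proof -
      have "smooth_on J (chart_map a \<circ> (?c \<circ> h))" by (rule smooth_on_cong[OF oJ eq[symmetric] sm])
      moreover have "vel (chart_map a \<circ> (?c \<circ> h)) s \<noteq> 0" if "s \<in> J" for s
      proof -
        have "vel (chart_map a \<circ> (?c \<circ> h)) s = vel (x \<circ> h) s" by (rule vel_cong[OF oJ that eq])
        then show ?thesis using velxh[OF that] by metis
      qed
      moreover have "(chart_map a \<circ> (?c \<circ> h)) s \<in> chart_img a" if "s \<in> J" for s
        using xh[OF that] eq[OF that] by simp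
      ultimately show ?thesis unfolding regular_curve_def using oJ by blast
    qed
    have unit': "?L' (lift (x \<circ> h) s) = 1" if s: "s \<in> J" for s
    proof -
      have d: "(chart_map a \<circ> (?c \<circ> h)) differentiable (at s)"
        using reg s by (intro smooth_on_differentiable[of J]) (auto simp: regular_curve_def)
      have "?L' (lift (chart_map a \<circ> (?c \<circ> h)) s)
          = conformal_change \<sigma> F ((?c \<circ> h) s) (velocity \<A> (?c \<circ> h) s)"
      proof -
        have "velocity \<A> (?c \<circ> h) s = tvec_of \<A> a ((?c \<circ> h) s) (chart_vel a (?c \<circ> h) s)"
          by (rule velocity_eq[OF a oJ s ch d])
        then show ?thesis
          using chart_inv_map[OF a ch[OF s]] unfolding loc_rep_def lift_def chart_vel_def fst_conv snd_conv o_apply[of "chart_map a"]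
          by simp
      qed
      moreover have "conformal_change \<sigma> F ((?c \<circ> h) s) (velocity \<A> (?c \<circ> h) s) = 1"
        using circ' s unfolding geodesic_circle_def by blast
      moreover have "lift (chart_map a \<circ> (?c \<circ> h)) s = lift (x \<circ> h) s"
        by (rule circle_eq_cong(1)[OF oJ s eq])
      ultimately show ?thesis by metis
    qed
    obtain r where r: "r \<in> J" "h r = 0"
    proof -
      have "0 \<in> h ` J" using J(3) d by (simp add: bij_betw_def)
      then show ?thesis using that by (metis imageE)
    qed
    have "circle_eq ?L' (chart_map a \<circ> (?c \<circ> h)) r"
      using circ' r(1) a ch[OF r(1)] c.bar.circle_eq_chart[OF reg r(1)]
      unfolding geodesic_circle_def rep_conformal Let_def by blast
    moreover have "circle_eq ?L' (chart_map a \<circ> (?c \<circ> h)) r \<longleftrightarrow> circle_eq ?L' (x \<circ> h) r"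
      by (rule circle_eq_cong(2)[OF oJ r(1) eq])
    ultimately have circ_r: "circle_eq ?L' (x \<circ> h) r" by blast
    show "\<exists>\<mu>. ddir (snd z, - c.N z (snd z)) c.S z + c.N z (c.S z) - c.C z A (c.S z)
      - c.ds (fst z) (snd z) *\<^sub>R c.S z = \<mu> *\<^sub>R snd z"
      by (rule c.circle_preserved_condition[OF x(1,4,5) oJ J(2) hI hpos unit'[unfolded rep_conformal] r(1)
            circ_r[unfolded rep_conformal]]) (simp_all add: r(2) x(2,3))
  qed
qed

end

section \<open>Berwald structures in a patch\<close>

text \<open>If \<open>u\<close> and \<open>v\<close> are independent, comparing coefficients in the value at \<open>u + v\<close> shows that their
  eigenvalues agree.\<close>

lemma linear_all_eigenvectors:
  fixes f :: "'a::real_vector \<Rightarrow> 'a"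
  assumes "linear f" "\<And>u. \<exists>\<mu>. f u = \<mu> *\<^sub>R u"
  obtains k where "\<And>u. f u = k *\<^sub>R u"
proof -
  obtain \<mu> where \<mu>: "\<And>u. f u = \<mu> u *\<^sub>R u" using assms(2) by metis
  have "\<mu> u *\<^sub>R u = \<mu> v *\<^sub>R u" if "v \<noteq> 0" for u v
  proof (cases "\<exists>c. u = c *\<^sub>R v")
    case True
    then obtain c where c: "u = c *\<^sub>R v" by blast
    have "\<mu> u *\<^sub>R u = c *\<^sub>R f v" using \<mu>[of u] linear_scale[OF assms(1), of c v] c by simp
    also have "\<dots> = \<mu> v *\<^sub>R u" unfolding \<mu>[of v] c by simp
    finally show ?thesis .
  next
    case False
    have "\<mu> (u + v) *\<^sub>R (u + v) = \<mu> u *\<^sub>R u + \<mu> v *\<^sub>R v"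
      using \<mu> linear_add[OF assms(1), of u v] by metis
    then have *: "(\<mu> (u + v) - \<mu> u) *\<^sub>R u = (\<mu> v - \<mu> (u + v)) *\<^sub>R v" by (simp add: algebra_simps)
    have "\<mu> (u + v) = \<mu> u"
    proof (rule ccontr)
      assume ne: "\<mu> (u + v) \<noteq> \<mu> u"
      have "u = (1 / (\<mu> (u + v) - \<mu> u)) *\<^sub>R ((\<mu> (u + v) - \<mu> u) *\<^sub>R u)" using ne by simp
      also have "\<dots> = ((\<mu> v - \<mu> (u + v)) / (\<mu> (u + v) - \<mu> u)) *\<^sub>R v" unfolding * by simp
      finally show False using False by blast
    qed
    then have "(\<mu> v - \<mu> (u + v)) *\<^sub>R v = 0" using * by simp
    then show ?thesis using \<open>\<mu> (u + v) = \<mu> u\<close> that by simp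
  qed
  then show thesis
  proof (cases "\<exists>v::'a. v \<noteq> 0")
    case True
    then obtain v :: 'a where "v \<noteq> 0" by blast
    then show thesis using that[of "\<mu> v"] \<mu> \<open>\<And>u v. v \<noteq> 0 \<Longrightarrow> \<mu> u *\<^sub>R u = \<mu> v *\<^sub>R u\<close> by metis
  next
    case False
    then show thesis using that[of 0] \<mu> by (metis scaleR_zero_right)
  qed
qed

lemma uminus_matrix_vector: "(- A) *v x = - (A *v x)" for A :: "real^'n^'m"
  by (simp add: vec_eq_iff matrix_vector_mult_def sum_negf)

locale berwald_patch = finsler_patch U L for U :: "(real^'n::finite) set" and L +
  assumes berwald: "\<And>x y y' k i j. x \<in> U \<Longrightarrow> y \<noteq> 0 \<Longrightarrow> y' \<noteq> 0 \<Longrightarrow> Gam L k i j (x, y) = Gam L k i j (x, y')"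
    and dim: "CARD('n) \<ge> 2"
begin

text \<open>The coefficients of the affine connection of a Berwald structure. They may be evaluated at any
  direction; the vector \<open>1\<close> is an arbitrary choice of a nonzero one. The matrix \<open>M x u\<close> of \<open>B x u\<close> is
  written with the nonlinear connection, whose smoothness is known.\<close>

definition B :: "real^'n \<Rightarrow> real^'n \<Rightarrow> real^'n \<Rightarrow> real^'n" where
  "B x u v = chern L (x, 1) u v"

definition M :: "real^'n \<Rightarrow> real^'n \<Rightarrow> real^'n^'n" where
  "M x u = (\<chi> k j. N (x, axis j 1) u $ k)"

lemma chern_eq: "z \<in> W \<Longrightarrow> chern L z u v = B (fst z) u v"
  using berwald[of "fst z" "snd z" 1] unfolding B_def chern_def by (cases z) simp

lemma one_in_W: "x \<in> U \<Longrightarrow> (x, 1) \<in> W"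
  by simp

lemma N_eq: "z \<in> W \<Longrightarrow> N z u = B (fst z) u (snd z)"
  using chern_snd chern_eq by metis

lemma B_sym: "x \<in> U \<Longrightarrow> B x u v = B x v u"
  unfolding B_def by (rule chern_sym[OF one_in_W])

lemma B_add: "B x u (v + w) = B x u v + B x u w"
  and B_scale: "B x u (r *\<^sub>R v) = r *\<^sub>R B x u v"
  by (simp_all add: B_def chern_def vec_eq_iff sum.distrib algebra_simps sum_distrib_left)

lemma B_diff: "B x u (v - w) = B x u v - B x u w"
  using B_add[of x u v "-1 *\<^sub>R w"] B_scale[of x u "-1" w] by simp

lemma axis_nonzero: "axis j (1::real) \<noteq> (0 :: real^'n)"
  by (auto simp: vec_eq_iff axis_def)

lemma B_M: "x \<in> U \<Longrightarrow> B x u v = M x u *v v"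
proof -
  assume x: "x \<in> U"
  have l: "linear (B x u)" by (intro linearI B_add B_scale)
  have "B x u v = B x u (\<Sum>j\<in>UNIV. v $ j *\<^sub>R axis j 1)" by (simp add: vec_axis_sum[symmetric])
  also have "\<dots> = (\<Sum>j\<in>UNIV. v $ j *\<^sub>R B x u (axis j 1))"
    using linear_sum[OF l, of "\<lambda>j. v $ j *\<^sub>R axis j 1" UNIV] by (simp add: B_scale)
  also have "\<dots> = M x u *v v"
  proof -
    have "N (x, axis j 1) u = B x u (axis j 1)" for j
      using N_eq[of "(x, axis j 1)" u] x axis_nonzero by simp
    then show ?thesis by (simp add: vec_eq_iff matrix_vector_mult_def M_def mult.commute)
  qed
  finally show ?thesis .
qed

lemma smooth_vert_at:
  fixes p :: "'a::euclidean_space \<Rightarrow> real^'n"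
  assumes "open T" "smooth_on T p" "\<And>w. w \<in> T \<Longrightarrow> p w \<in> U" "smooth_on T v" "e \<noteq> 0"
  shows "smooth_on T (\<lambda>w. N (p w, e) (v w))"
proof -
  have eq: "N (p w, e) (v w) = (\<Sum>i\<in>UNIV. v w $ i *\<^sub>R ddir (0, axis i 1) G (p w, e))" if "w \<in> T" for w
    unfolding nonlin_op_def using assms(3)[OF that] assms(5) by (intro ddir_axis_snd diff_W[OF smooth_G]) auto
  have "smooth_on T (\<lambda>w. ddir (0, axis i 1) G (p w, e))" for i
    by (rule smooth_on_compose[OF smooth_on_ddir[OF smooth_G] _ assms(1) open_W])
      (use assms in \<open>auto intro!: smooth_on_Pair smooth_on_const\<close>)
  then have "smooth_on T (\<lambda>w. \<Sum>i\<in>UNIV. v w $ i *\<^sub>R ddir (0, axis i 1) G (p w, e))"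
    using assms by (intro smooth_on_sum smooth_on_scaleR smooth_on_nth) auto
  then show ?thesis by (rule smooth_on_cong[OF assms(1) eq[symmetric], rotated])
qed

lemma smooth_M:
  fixes p :: "'a::euclidean_space \<Rightarrow> real^'n"
  assumes "open T" "smooth_on T p" "\<And>w. w \<in> T \<Longrightarrow> p w \<in> U" "smooth_on T v"
  shows "smooth_on T (\<lambda>w. M (p w) (v w))"
  unfolding M_def by (intro smooth_on_vec smooth_on_nth smooth_vert_at assms axis_nonzero)

subsection \<open>Propagation of the Riemannian property\<close>

definition quadratic_at :: "real^'n \<Rightarrow> bool" where
  "quadratic_at x \<longleftrightarrow> (\<forall>y y'. y \<noteq> 0 \<longrightarrow> y' \<noteq> 0 \<longrightarrow> g (x, y) = g (x, y'))"

lemma open_not_quadratic: "open {x \<in> U. \<not> quadratic_at x}"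
proof (rule openI)
  fix x assume "x \<in> {x \<in> U. \<not> quadratic_at x}"
  then obtain y y' where x: "x \<in> U" and y: "y \<noteq> 0" "y' \<noteq> 0" "g (x, y) \<noteq> g (x, y')"
    unfolding quadratic_at_def by blast
  have c: "continuous_on U (\<lambda>x. g (x, e))" if "e \<noteq> 0" for e
    by (rule continuous_on_compose2[OF smooth_on_continuous[OF smooth_g]])
      (use that in \<open>auto intro!: continuous_intros\<close>)
  have "open {x \<in> U. g (x, y) - g (x, y') \<in> - {0}}"
  proof -
    have "open (U \<inter> (\<lambda>x. g (x, y) - g (x, y')) -` (- {0}))"
      by (rule continuous_open_preimage[OF _ open_U]) (auto intro!: continuous_intros c y)
    then show ?thesis by (simp add: Int_def vimage_def)
  qed
  moreover have "x \<in> {x \<in> U. g (x, y) - g (x, y') \<in> - {0}}" using x y by simp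
  ultimately obtain e where "e > 0" "ball x e \<subseteq> {x \<in> U. g (x, y) - g (x, y') \<in> - {0}}"
    by (meson open_contains_ball)
  moreover have "{x \<in> U. g (x, y) - g (x, y') \<in> - {0}} \<subseteq> {x \<in> U. \<not> quadratic_at x}"
    using y unfolding quadratic_at_def by auto
  ultimately show "\<exists>e>0. ball x e \<subseteq> {x \<in> U. \<not> quadratic_at x}" by blast
qed

text \<open>Two vertical derivatives recover the fundamental tensor from the energy.\<close>

lemma quadratic_atI:
  assumes x: "x \<in> U" and E: "\<And>y. y \<noteq> 0 \<Longrightarrow> E (x, y) = y \<bullet> (K *v y)"
  shows "quadratic_at x"
proof -
  define q where "q u v = (u \<bullet> (K *v v) + v \<bullet> (K *v u)) / 2" for u v
  have line: "open {t. y + t *\<^sub>R v \<noteq> 0}" "0 \<in> {t. y + t *\<^sub>R v \<noteq> 0}" if "y \<noteq> 0" for y v :: "real^'n"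
  proof -
    have "open ((\<lambda>t. y + t *\<^sub>R v) -` (- {0}))"
      by (rule open_vimage) (auto intro!: continuous_intros)
    then show "open {t. y + t *\<^sub>R v \<noteq> 0}" by (simp add: vimage_def)
  qed (use that in simp)
  have vline: "((\<lambda>t. f (x, y + t *\<^sub>R v)) has_vector_derivative ddir (0, v) f (x, y)) (at 0)"
    if "smooth_on W f" "y \<noteq> 0" for f y v
    using ddir_along_line[of f "(x, y)" 0 "(0, v)"] diff_W[OF that(1), of "(x, y)"] that(2) x
    by (simp add: plus_prod_def)
  have 1: "ddir (0, v) E (x, y) = 2 * q y v" if y: "y \<noteq> 0" for y v
  proof -
    have "((\<lambda>t. (y + t *\<^sub>R v) \<bullet> (K *v (y + t *\<^sub>R v))) has_vector_derivative 2 * q y v) (at 0)"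
      unfolding matrix_vector_right_distrib matrix_vector_mult_scaleR inner_add_left inner_add_right
        inner_scaleR_left inner_scaleR_right q_def
        has_real_derivative_iff_has_vector_derivative[symmetric]
      by (auto intro!: derivative_eq_intros)
    then have "((\<lambda>t. E (x, y + t *\<^sub>R v)) has_vector_derivative 2 * q y v) (at 0)"
      by (rule has_vector_derivative_transform_within_open[OF _ line[where v=v, OF y]]) (use E in auto)
    from vector_derivative_unique_at[OF vline[OF smooth_E y] this] show ?thesis .
  qed
  have "ddir (0, u) (ddir (0, v) E) (x, y) = 2 * q u v" if y: "y \<noteq> 0" for y u v
  proof -
    have "((\<lambda>t. 2 * q (y + t *\<^sub>R u) v) has_vector_derivative 2 * q u v) (at 0)"
      unfolding q_def matrix_vector_right_distrib matrix_vector_mult_scaleR inner_add_left inner_add_right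
        inner_scaleR_left inner_scaleR_right
        has_real_derivative_iff_has_vector_derivative[symmetric]
      by (auto intro!: derivative_eq_intros simp: field_simps)
    then have "((\<lambda>t. ddir (0, v) E (x, y + t *\<^sub>R u)) has_vector_derivative 2 * q u v) (at 0)"
      by (rule has_vector_derivative_transform_within_open[OF _ line[where v=u, OF y]]) (use 1 in auto)
    from vector_derivative_unique_at[OF vline[OF smooth_on_ddir[OF smooth_E] y] this] show ?thesis .
  qed
  then show ?thesis unfolding quadratic_at_def by (simp add: vec_eq_iff g_nth)
qed

text \<open>Base point, direction of the segment and transport matrix are one autonomous system. Varying the
  direction, which stays constant along a solution, reaches all nearby end points at the same time.\<close>

definition transport_field :: "(real^'n) \<times> (real^'n) \<times> (real^'n^'n) \<Rightarrow> (real^'n) \<times> (real^'n) \<times> (real^'n^'n)" where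
  "transport_field w = (fst (snd w), 0, - (M (fst w) (fst (snd w)) ** snd (snd w)))"

text \<open>Parallel transport of a Berwald structure along straight segments is linear, by an invertible
  matrix, and preserves the energy. Hence it carries a quadratic energy to a quadratic energy.\<close>

lemma quadratic_near:
  assumes x0: "x0 \<in> U" and q0: "quadratic_at x0"
  obtains e where "e > 0" "ball x0 e \<subseteq> {x \<in> U. quadratic_at x}"
proof -
  let ?T = "U \<times> (UNIV :: (real^'n) set) \<times> {Y :: real^'n^'n. det Y \<noteq> 0}"
  have "open {Y :: real^'n^'n. det Y \<noteq> 0}"
  proof -
    have "continuous_on UNIV (\<lambda>Y :: real^'n^'n. det Y)"
      by (rule smooth_on_continuous) (intro smooth_on_det smooth_on_ident open_UNIV)
    from open_vimage[OF open_Compl[OF closed_singleton[of 0]] this] show ?thesis by (simp add: vimage_def)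
  qed
  then have T: "open ?T" by (intro open_Times open_U open_UNIV)
  have sm: "smooth_on ?T transport_field"
  proof -
    have id: "smooth_on ?T (\<lambda>w. w)" by (rule smooth_on_ident[OF T])
    have p: "smooth_on ?T (\<lambda>w. fst w)" "smooth_on ?T (\<lambda>w. fst (snd w))" "smooth_on ?T (\<lambda>w. snd (snd w))"
      by (intro smooth_on_fst smooth_on_snd id T)+
    have "smooth_on ?T (\<lambda>w. M (fst w) (fst (snd w)))"
      by (rule smooth_M[OF T p(1) _ p(2)]) auto
    then show ?thesis
      unfolding transport_field_def[abs_def] matrix_matrix_mult_def
      by (intro smooth_on_Pair smooth_on_const smooth_on_minus smooth_on_vec smooth_on_sum smooth_on_mult
          smooth_on_nth p T)
  qed
  have w0: "(x0, 0, mat 1) \<in> ?T" using x0 by simp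
  obtain d r where d: "d > 0" "r > 0" and sol: "\<And>w. w \<in> cball (x0, 0, mat 1) r \<Longrightarrow> \<exists>u. u 0 = w \<and>
    (\<forall>t\<in>{-d<..<d}. u t \<in> ?T \<and> (u has_vector_derivative transport_field (u t)) (at t))"
    by (rule ode_local_solutions[OF T sm w0]) blast
  let ?I = "{-d<..<d}"
  define s where "s = d / 2"
  have s: "s > 0" "s \<in> ?I" "0 \<in> ?I" using d by (auto simp: s_def)
  have conv: "convex ?I" by simp
  have "x \<in> U \<and> quadratic_at x" if x: "x \<in> ball x0 (s * r)" for x
  proof -
    define v where "v = (1 / s) *\<^sub>R (x - x0)"
    have "norm v = norm (x - x0) / s" using s by (simp add: v_def)
    also have "\<dots> \<le> r" using x s by (simp add: dist_norm norm_minus_commute field_simps less_imp_le)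
    finally have "(x0, v, mat 1 :: real^'n^'n) \<in> cball (x0, 0, mat 1) r"
      by (simp add: dist_prod_def)
    then obtain w where w0: "w 0 = (x0, v, mat 1)"
      and w: "\<And>t. t \<in> ?I \<Longrightarrow> w t \<in> ?T \<and> (w has_vector_derivative transport_field (w t)) (at t)"
      using sol by blast
    define p where "p t = fst (w t)" for t
    define Y where "Y t = snd (snd (w t))" for t
    have vd: "((\<lambda>t. fst (snd (w t))) has_vector_derivative 0) (at t)" if "t \<in> ?I" for t
      using bounded_linear.has_vector_derivative[OF bounded_linear_fst
          bounded_linear.has_vector_derivative[OF bounded_linear_snd conjunct2[OF w[OF that]]]]
      by (simp add: transport_field_def)
    have v: "fst (snd (w t)) = v" if "t \<in> ?I" for t
    proof -
      obtain c where "\<And>t. t \<in> ?I \<Longrightarrow> fst (snd (w t)) = c"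
        using has_vector_derivative_zero_constant[OF conv has_vector_derivative_at_within[OF vd]] by blast
      from this[OF that] this[OF s(3)] show ?thesis by (simp add: w0)
    qed
    have pd: "(p has_vector_derivative v) (at t)" if "t \<in> ?I" for t
      using bounded_linear.has_vector_derivative[OF bounded_linear_fst conjunct2[OF w[OF that]]]
      by (simp add: p_def[abs_def] transport_field_def v[OF that])
    have Yd: "(Y has_vector_derivative - (M (p t) v ** Y t)) (at t)" if "t \<in> ?I" for t
      using bounded_linear.has_vector_derivative[OF bounded_linear_snd
          bounded_linear.has_vector_derivative[OF bounded_linear_snd conjunct2[OF w[OF that]]]]
      by (simp add: p_def Y_def[abs_def] transport_field_def v[OF that])
    have pT: "p t \<in> U" "det (Y t) \<noteq> 0" if "t \<in> ?I" for t
      using w[OF that] by (auto simp: p_def Y_def mem_Times_iff)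
    have p: "p s = x"
    proof -
      have "((\<lambda>t. p t - t *\<^sub>R v) has_vector_derivative 0) (at t)" if "t \<in> ?I" for t
        using pd[OF that] by (auto intro!: derivative_eq_intros)
      then obtain c where c: "\<And>t. t \<in> ?I \<Longrightarrow> p t - t *\<^sub>R v = c"
        using has_vector_derivative_zero_constant[OF conv has_vector_derivative_at_within] by blast
      have "p s - s *\<^sub>R v = p 0" using c[OF s(2)] c[OF s(3)] by simp
      then show ?thesis using s by (simp add: v_def p_def w0)
    qed
    have transport: "E (x, Y s *v y) = E (x0, y)" if y: "y \<noteq> 0" for y
    proof -
      let ?z = "\<lambda>t. (p t, Y t *v y)"
      have zW: "?z t \<in> W" if "t \<in> ?I" for t
      proof -
        have "Y t *v y \<noteq> 0"
          using pT(2)[OF that] y unfolding invertible_det_nz[symmetric] invertible_left_inverse matrix_left_invertible_ker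
          by blast
        then show ?thesis using pT(1)[OF that] by simp
      qed
      have "((\<lambda>t. E (?z t)) has_vector_derivative 0) (at t)" if "t \<in> ?I" for t
      proof -
        have "((\<lambda>t. Y t *v y) has_vector_derivative - (M (p t) v ** Y t) *v y) (at t)"
          by (rule bounded_linear.has_vector_derivative[OF
                bounded_bilinear.bounded_linear_left[OF bounded_bilinear_matrix_vector] Yd[OF that]])
        moreover have "- (M (p t) v ** Y t) *v y = - N (?z t) v"
          using N_eq[OF zW[OF that], of v] B_M[OF pT(1)[OF that]]
          by (simp add: matrix_vector_mul_assoc[symmetric] uminus_matrix_vector)
        ultimately have "(?z has_vector_derivative (v, - N (?z t) v)) (at t)"
          by (intro has_vector_derivative_Pair pd that) simp
        from ddir_along_curve[OF diff_W[OF smooth_E zW[OF that]] this]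
        show ?thesis by (simp add: ddir_horizontal_E[OF zW[OF that]])
      qed
      then obtain c where c: "\<And>t. t \<in> ?I \<Longrightarrow> E (?z t) = c"
        using has_vector_derivative_zero_constant[OF conv has_vector_derivative_at_within] by blast
      show ?thesis using c[OF s(2)] c[OF s(3)] p by (simp add: p_def Y_def w0)
    qed
    define Q where "Q = matrix_inv (Y s)"
    have YQ: "Y s ** Q = mat 1"
      using pT(2)[OF s(2)] unfolding invertible_det_nz[symmetric] Q_def matrix_inv_def invertible_def
      by (rule someI2_ex) blast
    have xU: "x \<in> U" using pT(1)[OF s(2)] p by simp
    have "E (x, y) = y \<bullet> ((transpose Q ** g (x0, 1) ** Q) *v y)" if y: "y \<noteq> 0" for y
    proof -
      have YQy: "Y s *v (Q *v y) = y" by (simp add: matrix_vector_mul_assoc YQ)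
      then have Qy: "Q *v y \<noteq> 0" using y by auto
      have "E (x, y) = E (x0, Q *v y)" using transport[OF Qy] YQy by simp
      also have "\<dots> = (Q *v y) \<bullet> (g (x0, Q *v y) *v (Q *v y))"
        using E_eq[of "(x0, Q *v y)"] x0 Qy by simp
      also have "g (x0, Q *v y) = g (x0, 1)" using q0 Qy zero_neq_one[symmetric] unfolding quadratic_at_def by blast
      also have "(Q *v y) \<bullet> (g (x0, 1) *v (Q *v y)) = y \<bullet> (transpose Q *v (g (x0, 1) *v (Q *v y)))"
        using dot_lmul_matrix[of "g (x0, 1) *v (Q *v y)" Q y]
        by (simp add: transpose_matrix_vector inner_commute[of y] inner_commute[of "Q *v y"])
      finally show ?thesis by (simp add: matrix_vector_mul_assoc matrix_mul_assoc)
    qed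
    from quadratic_atI[OF xU this] xU show ?thesis by blast
  qed
  then have "ball x0 (s * r) \<subseteq> {x \<in> U. quadratic_at x}" by blast
  then show thesis using that[of "s * r"] s(1) d(2) by simp
qed

lemma open_quadratic: "open {x \<in> U. quadratic_at x}"
  by (rule openI) (use quadratic_near in blast)

end

subsection \<open>Consequences of the circle condition\<close>

locale berwald_circle_patch = berwald_patch U L + circle_patch U L \<sigma>
  for U :: "(real^'n::finite) set" and L and \<sigma>
begin

lemma S_hom: "z \<in> W \<Longrightarrow> r > 0 \<Longrightarrow> S (fst z, r *\<^sub>R snd z) = S z"
  by (simp add: S_def fund_inv_def g_hom)

lemma normalize:
  assumes "z \<in> W"
  obtains r where "r > 0" "(fst z, r *\<^sub>R snd z) \<in> W" "L (fst z, r *\<^sub>R snd z) = 1"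
proof -
  have "L z \<noteq> 0" using E_pos[OF assms] by (auto simp: energy_def)
  then have L: "L z > 0" using L_nonneg[OF assms] by simp
  have "L (fst z, (1 / L z) *\<^sub>R snd z) = 1"
    using L_hom[of "fst z" "snd z" "1 / L z"] assms L by (cases z) simp
  then show thesis using that[of "1 / L z"] scaled_in_W[OF assms, of "1 / L z"] L by simp
qed

text \<open>Only one term of the circle condition contains the acceleration, so comparing \<open>A\<close> with \<open>0\<close> shows
  that \<open>C(A, S)\<close> is a multiple of the line element. It is also orthogonal to the line element, hence
  \<open>0\<close>.\<close>

lemma cartan_S:
  assumes z: "z \<in> W"
  shows "C z v (S z) = 0"
proof -
  have unit: "C z v (S z) = 0" if z: "z \<in> W" and L: "L z = 1" for z v
  proof -
    define c where "c = snd z \<bullet> (g z *v v)"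
    define A where "A = v - c *\<^sub>R snd z"
    have E1: "snd z \<bullet> (g z *v snd z) = 1" using E_eq[OF z] L by (simp add: energy_def)
    have A: "snd z \<bullet> (g z *v A) = 0"
      by (simp add: A_def matrix_vector_mult_diff_distrib matrix_vector_mult_scaleR inner_diff_right E1 c_def)
    obtain \<mu> where \<mu>: "ddir (snd z, - N z (snd z)) S z + N z (S z) - C z A (S z) - ds (fst z) (snd z) *\<^sub>R S z
        = \<mu> *\<^sub>R snd z" using circle_cond[OF z L A] by blast
    have C0: "C z 0 (S z) = 0" using cartan_scale_left[OF z, of 0 0 "S z"] by simp
    obtain \<nu> where \<nu>: "ddir (snd z, - N z (snd z)) S z + N z (S z) - ds (fst z) (snd z) *\<^sub>R S z
        = \<nu> *\<^sub>R snd z" using circle_cond[OF z L, of 0] C0 by auto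
    have CA: "C z A (S z) = (\<nu> - \<mu>) *\<^sub>R snd z"
      using \<mu> \<nu> by (simp add: scaleR_diff_left algebra_simps)
    have "snd z \<bullet> (g z *v C z A (S z)) = 0" by (rule cartan_orth[OF z])
    then have "\<nu> - \<mu> = 0" unfolding CA by (simp add: matrix_vector_mult_scaleR E1)
    then have "C z A (S z) = 0" using CA by simp
    moreover have "C z v (S z) = C z A (S z) + c *\<^sub>R C z (snd z) (S z)"
      unfolding cartan_scale_left[OF z, symmetric] cartan_add_left[OF z, symmetric] by (simp add: A_def)
    ultimately show ?thesis by (simp add: cartan_snd(1)[OF z])
  qed
  obtain r where r: "r > 0" "(fst z, r *\<^sub>R snd z) \<in> W" "L (fst z, r *\<^sub>R snd z) = 1" by (rule normalize[OF z])
  show ?thesis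
    using unit[OF r(2,3), of v] unfolding cartan_hom[OF z r(1)] S_hom[OF z r(1)] using r(1) by simp
qed

text \<open>By \<open>cartan_S\<close> the vertical derivative of \<open>S\<close> vanishes, and the slit tangent spaces are connected in
  dimension at least two. So \<open>S\<close> is a vector field \<open>P\<close> on the base.\<close>

definition P :: "real^'n \<Rightarrow> real^'n" where
  "P x = S (x, 1)"

lemma S_eq:
  assumes z: "z \<in> W"
  shows "S z = P (fst z)"
proof -
  let ?f = "\<lambda>y. S (fst z, y)"
  have x: "fst z \<in> U" and y: "snd z \<in> - {0}" using z by auto
  have "connected (- {0 :: real^'n})"
    using connected_punctured_universe[of "0 :: real^'n"] dim by simp
  moreover have "open (- {0 :: real^'n})" by (intro open_Compl) simp
  moreover have der: "(?f has_derivative (\<lambda>v. 0)) (at y)" if "y \<in> - {0}" for y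
  proof -
    have zy: "(fst z, y) \<in> W" using x that by simp
    have "((\<lambda>y. (fst z, y)) has_derivative (\<lambda>v. (0, v))) (at y)"
      by (auto intro!: derivative_eq_intros)
    from has_derivative_compose[OF this has_derivative_ddir[OF diff_W[OF smooth_S zy]]]
    show ?thesis by (simp add: ddir_vert_S[OF zy] cartan_S[OF zy])
  qed
  ultimately have "?f (snd z) = ?f 1"
    using has_derivative_zero_unique_connected[of "- {0}" ?f 1 "snd z"] y by auto
  then show ?thesis by (simp add: P_def)
qed

lemma smooth_P: "smooth_on U P"
  unfolding P_def[abs_def]
  by (rule smooth_on_compose[OF smooth_S _ open_U open_W])
    (auto intro!: smooth_on_Pair smooth_on_ident smooth_on_const open_U)

lemma diff_P: "x \<in> U \<Longrightarrow> P differentiable (at x)"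
  by (rule smooth_on_differentiable[OF smooth_P])

lemma ddir_S:
  assumes z: "z \<in> W"
  shows "ddir w S z = ddir (fst w) P (fst z)"
proof -
  have "ddir w S z = ddir w (\<lambda>z. P (fst z)) z" by (rule ddir_cong[OF open_W z]) (rule S_eq)
  also have "\<dots> = ddir (fst w) P (fst z)" using z by (intro ddir_comp_fst diff_P) auto
  finally show ?thesis .
qed

lemma g_P: "(x, y) \<in> W \<Longrightarrow> w \<bullet> (g (x, y) *v P x) = ds x w"
  using g_S[of "(x, y)" w] S_eq[of "(x, y)"] by simp

text \<open>Up to the factor \<open>exp (-\<sigma>)\<close> this is the covariant derivative of \<open>exp (-\<sigma>) P\<close>, the negative of
  the gradient of \<open>exp (-\<sigma>)\<close>.\<close>

definition hess :: "real^'n \<Rightarrow> real^'n \<Rightarrow> real^'n" where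
  "hess x u = ddir u P x + B x u (P x) - ds x u *\<^sub>R P x"

lemma linear_hess: "x \<in> U \<Longrightarrow> linear (hess x)"
  using linear_ds[of x] B_sym[of x _ "P x"] unfolding hess_def
  by (intro linearI) (simp_all add: ddir_add_dir ddir_scale_dir diff_P B_add B_scale linear_add linear_scale
      scaleR_left_distrib algebra_simps)

lemma hess_eigen:
  assumes x: "x \<in> U"
  obtains k where "\<And>u. hess x u = k *\<^sub>R u"
proof -
  have unit: "\<exists>\<mu>. hess x y = \<mu> *\<^sub>R y" if z: "(x, y) \<in> W" "L (x, y) = 1" for y
  proof -
    have "C (x, y) 0 (S (x, y)) = 0" by (rule cartan_S[OF z(1)])
    then obtain \<mu> where "ddir (y, - N (x, y) y) S (x, y) + N (x, y) (S (x, y)) - ds x y *\<^sub>R S (x, y) = \<mu> *\<^sub>R y"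
      using circle_cond[OF z, of 0] by auto
    then have "hess x y = \<mu> *\<^sub>R y"
      using ddir_S[OF z(1)] S_eq[OF z(1)] N_eq[OF z(1)] B_sym[OF x] by (simp add: hess_def)
    then show ?thesis by blast
  qed
  have "\<exists>\<mu>. hess x u = \<mu> *\<^sub>R u" for u
  proof (cases "u = 0")
    case True
    then show ?thesis using linear_0[OF linear_hess[OF x]] by simp
  next
    case False
    then have "(x, u) \<in> W" using x by simp
    from normalize[OF this] obtain r where r: "r > 0" "(x, r *\<^sub>R u) \<in> W" "L (x, r *\<^sub>R u) = 1" by auto
    obtain \<mu> where "hess x (r *\<^sub>R u) = \<mu> *\<^sub>R (r *\<^sub>R u)" using unit[OF r(2,3)] by blast
    then have "r *\<^sub>R hess x u = r *\<^sub>R (\<mu> *\<^sub>R u)" using linear_scale[OF linear_hess[OF x]] by (simp add: mult.commute)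
    then show ?thesis using r(1) scaleR_left_imp_eq[of r] by blast
  qed
  from linear_all_eigenvectors[OF linear_hess[OF x] this] that show thesis by blast
qed

text \<open>The horizontal derivative of \<open>g(P, w) = ds(w)\<close>. The point is that the right-hand side does not
  involve the direction \<open>y\<close>.\<close>

lemma g_hess:
  assumes z: "(x, y) \<in> W"
  shows "w \<bullet> (g (x, y) *v hess x u) = ddir u (ddir w \<sigma>) x - ds x (B x u w) - ds x u * ds x w"
proof -
  have x: "x \<in> U" using z by simp
  let ?z = "(x, y)"
  let ?h = "(u, - N ?z u)"
  note dg = diff_W[OF smooth_g z] and dS = diff_W[OF smooth_S z]
  have dgS: "(\<lambda>z. g z *v S z) differentiable (at ?z)"
    by (rule diff_W[OF _ z]) (intro smooth_on_matrix_vector smooth_g smooth_S open_W)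
  have "w \<bullet> (g ?z *v ddir ?h S ?z + hder u ?z *v S ?z) = ddir ?h (\<lambda>z. w \<bullet> (g z *v S z)) ?z"
    unfolding ddir_bounded_linear[OF bounded_linear_inner_right dgS] ddir_matrix_vector[OF dg dS] ..
  also have "\<dots> = ddir ?h (\<lambda>z. ddir w \<sigma> (fst z)) ?z"
    by (rule ddir_cong[OF open_W z]) (simp add: g_S ds_def)
  also have "\<dots> = ddir u (ddir w \<sigma>) x"
    using ddir_comp_fst[of "ddir w \<sigma>" ?z ?h] smooth_on_differentiable[OF smooth_on_ddir[OF smooth_\<sigma>] x] by simp
  finally have 1: "w \<bullet> (g ?z *v ddir u P x) + w \<bullet> (hder u ?z *v P x) = ddir u (ddir w \<sigma>) x"
    using ddir_S[OF z] S_eq[OF z] by (simp add: inner_add_right)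
  have 2: "w \<bullet> (hder u ?z *v P x) = w \<bullet> (g ?z *v B x u (P x)) + ds x (B x u w)"
    using g_hder[OF z, of w u "P x"] chern_eq[OF z] g_P[OF z, of "B x u w"] g_sym[OF z, of "P x" "B x u w"]
    by simp
  show ?thesis
    using 1 2 g_P[OF z, of w] unfolding hess_def
    by (simp add: matrix_vector_right_distrib matrix_vector_mult_diff_distrib matrix_vector_mult_scaleR
        inner_simps)
qed

lemma hess_nonzero_quadratic:
  assumes x: "x \<in> U" and u: "hess x u \<noteq> 0"
  shows "quadratic_at x"
proof -
  obtain k where k: "\<And>u. hess x u = k *\<^sub>R u" using hess_eigen[OF x] by blast
  then have k0: "k \<noteq> 0" using u by auto
  have "g (x, y) $ i $ j = g (x, y') $ i $ j" if "y \<noteq> 0" "y' \<noteq> 0" for y y' i j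
  proof -
    have "k * (axis i 1 \<bullet> (g (x, y) *v axis j 1)) = k * (axis i 1 \<bullet> (g (x, y') *v axis j 1))"
      using g_hess[of x y "axis i 1" "axis j 1"] g_hess[of x y' "axis i 1" "axis j 1"] x that
      unfolding k by (simp add: matrix_vector_mult_scaleR)
    then show ?thesis using k0 by (simp add: matrix_vector_mult_basis column_def inner_axis')
  qed
  then show ?thesis unfolding quadratic_at_def vec_eq_iff by blast
qed

subsection \<open>Vanishing flag curvature\<close>

lemma smooth_B: "smooth_on U (\<lambda>x. B x u w)"
proof -
  have "smooth_on U (\<lambda>x. M x u *v w)"
    by (intro smooth_on_matrix_vector smooth_M smooth_on_const smooth_on_ident open_U)
  then show ?thesis by (rule smooth_on_cong[OF open_U B_M[symmetric], rotated])
qed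

text \<open>The curvature of the Cartan connection is that of the affine connection \<open>B\<close>, up to a term in which
  the Cartan tensor is applied to \<open>w\<close>.\<close>

lemma riem_eq:
  assumes z: "z \<in> W" and q: "\<And>q. C z q w = 0"
  shows "riem L z u v w = ddir u (\<lambda>x. B x w v) (fst z) - ddir v (\<lambda>x. B x w u) (fst z)
    + B (fst z) (B (fst z) w v) u - B (fst z) (B (fst z) w u) v"
proof -
  let ?x = "fst z"
  have x: "?x \<in> U" using z by auto
  have inner: "conn L (hlift L v) (\<lambda>_. w) z' = B (fst z') w v" if z': "z' \<in> W" for z' v
  proof -
    have "C z' (- N z' v + N z' v) w = 0" using cartan_scale_left[OF z', of 0 0 w] by simp
    then show ?thesis
      unfolding conn_def conn_form_eq[OF z'] hlift_eq[OF z'] by (simp add: chern_eq[OF z'])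
  qed
  have dB: "(\<lambda>x. B x w v) differentiable (at ?x)" for v by (rule smooth_on_differentiable[OF smooth_B x])
  have outer: "conn L (hlift L u) (conn L (hlift L v) (\<lambda>_. w)) z = ddir u (\<lambda>x. B x w v) ?x + B ?x (B ?x w v) u" for u v
  proof -
    have "ddir (hlift L u z) (conn L (hlift L v) (\<lambda>_. w)) z = ddir (hlift L u z) (\<lambda>z. B (fst z) w v) z"
      by (rule ddir_cong[OF open_W z]) (rule inner)
    also have "\<dots> = ddir u (\<lambda>x. B x w v) ?x"
      using ddir_comp_fst[OF dB] by (simp add: hlift_eq[OF z])
    finally have "ddir (hlift L u z) (conn L (hlift L v) (\<lambda>_. w)) z = ddir u (\<lambda>x. B x w v) ?x" .
    moreover have "conn_form L z (hlift L u z) (B ?x w v) = B ?x (B ?x w v) u"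
      using cartan_scale_left[OF z, of 0 0 "B ?x w v"]
      unfolding conn_form_eq[OF z] hlift_eq[OF z] by (simp add: chern_eq[OF z])
    moreover have "conn L (hlift L u) (conn L (hlift L v) (\<lambda>_. w)) z
        = ddir (hlift L u z) (conn L (hlift L v) (\<lambda>_. w)) z
          + conn_form L z (hlift L u z) (conn L (hlift L v) (\<lambda>_. w) z)"
      by (simp only: conn_def[of L "hlift L u" "conn L (hlift L v) (\<lambda>_. w)" z] ddir_def)
    ultimately show ?thesis by (simp only: inner[OF z])
  qed
  have br: "fst (bracket (hlift L u) (hlift L v) z) = 0"
  proof -
    have "fst (ddir w' (hlift L v) z) = 0" for v w'
    proof -
      have "smooth_on W (\<lambda>z. (v, - N z v))"
        unfolding nonlin_op_def by (intro smooth_on_Pair smooth_on_const smooth_on_minus smooth_on_ddir smooth_G open_W)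
      then have "smooth_on W (hlift L v)" by (rule smooth_on_cong[OF open_W hlift_eq[symmetric], rotated])
      from ddir_bounded_linear[OF bounded_linear_fst diff_W[OF this z], of w']
      have "fst (ddir w' (hlift L v) z) = ddir w' (\<lambda>z. fst (hlift L v z)) z" by simp
      also have "\<dots> = ddir w' (\<lambda>z. v) z" by (rule ddir_cong[OF open_W z]) (simp add: hlift_def)
      finally show ?thesis by (simp add: ddir_const)
    qed
    then show ?thesis unfolding bracket_def ddir_def[symmetric] by simp
  qed
  have N0: "N z 0 = 0" by (rule linear_0[OF linear_nonlin[OF z]])
  have B0: "B ?x w 0 = 0" using B_scale[of ?x w 0 0] by simp
  have "conn L (bracket (hlift L u) (hlift L v)) (\<lambda>_. w) z = 0"
    unfolding conn_def conn_form_eq[OF z] br by (simp add: chern_eq[OF z] B0 N0 q)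
  then show ?thesis unfolding riem_def curvature_def outer by simp
qed

text \<open>If \<open>hess\<close> vanishes, then \<open>exp (-\<sigma>) P\<close> is parallel, and a parallel field is annihilated by the
  curvature. The computation uses \<open>P\<close> itself: the symmetry of its second derivatives and of those of
  \<open>\<sigma>\<close> leaves exactly the curvature expression.\<close>

lemma zero_flag:
  assumes V: "open V" "V \<subseteq> U" and h: "\<And>x u. x \<in> V \<Longrightarrow> hess x u = 0" and x: "x \<in> V"
    and v: "v \<noteq> 0"
  shows "flag_curv_loc L x v (P x) = 0"
proof -
  have xU: "x \<in> U" using V x by blast
  have z: "(x, v) \<in> W" using xU v by simp
  have DP: "ddir u P x = ds x u *\<^sub>R P x - B x u (P x)" if "x \<in> V" for x u
    using h[OF that, of u] by (simp add: hess_def algebra_simps)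
  have dP: "P differentiable (at x)" by (rule diff_P[OF xU])
  have smooth_ds: "smooth_on U (\<lambda>x. ds x w)" for w
    unfolding ds_def by (rule smooth_on_ddir[OF smooth_\<sigma>])
  have dM: "(\<lambda>x. M x u) differentiable (at x)" for u
    by (rule smooth_on_differentiable[OF smooth_M xU]) (auto intro!: smooth_on_ident smooth_on_const open_U)
  have dds: "(\<lambda>x. ds x w) differentiable (at x)" for w
    by (rule smooth_on_differentiable[OF smooth_ds xU])
  have sec: "ddir u (ddir w P) x = ddir u (ddir w \<sigma>) x *\<^sub>R P x + ds x w *\<^sub>R ddir u P x
      - (B x w (ddir u P x) + ddir u (\<lambda>y. B y w (P x)) x)" for u w
  proof -
    have "ddir u (ddir w P) x = ddir u (\<lambda>x. ds x w *\<^sub>R P x - M x w *v P x) x"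
      by (rule ddir_cong[OF V(1) x]) (use DP B_M V(2) in auto)
    also have "\<dots> = ddir u (\<lambda>x. ds x w *\<^sub>R P x) x - ddir u (\<lambda>x. M x w *v P x) x"
      by (rule ddir_diff)
        (rule smooth_on_differentiable[OF _ xU], intro smooth_on_scaleR smooth_on_matrix_vector
          smooth_P smooth_M smooth_ds smooth_on_ident smooth_on_const open_U, assumption?)+
    also have "ddir u (\<lambda>x. ds x w *\<^sub>R P x) x = ds x w *\<^sub>R ddir u P x + ddir u (\<lambda>x. ds x w) x *\<^sub>R P x"
      by (rule ddir_scaleR[OF dds dP])
    also have "ddir u (\<lambda>x. M x w *v P x) x = M x w *v ddir u P x + ddir u (\<lambda>x. M x w) x *v P x"
      by (rule ddir_matrix_vector[OF dM dP])
    also have "ddir u (\<lambda>x. M x w) x *v P x = ddir u (\<lambda>y. M y w *v P x) x"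
      by (rule ddir_bounded_linear[OF bounded_bilinear.bounded_linear_left[OF bounded_bilinear_matrix_vector] dM, symmetric])
    also have "\<dots> = ddir u (\<lambda>y. B y w (P x)) x"
      by (rule ddir_cong[OF open_U xU]) (simp add: B_M)
    finally show ?thesis by (simp add: ds_def B_M[OF xU])
  qed
  let ?s = "ds x" and ?p = "P x"
  have swap: "B y a ?p = B y ?p a" if "y \<in> U" for y a by (rule B_sym[OF that])
  have riem: "riem L (x, v) v ?p ?p = 0"
  proof -
    have q: "C (x, v) q ?p = 0" for q using cartan_S[OF z, of q] S_eq[OF z] by simp
    have d: "ddir ?p (\<lambda>y. B y v ?p) x = ddir ?p (\<lambda>y. B y ?p v) x"
      by (rule ddir_cong[OF open_U xU]) (rule swap)
    have comm: "ddir v (ddir ?p P) x = ddir ?p (ddir v P) x" "ddir v (ddir ?p \<sigma>) x = ddir ?p (ddir v \<sigma>) x"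
      by (rule ddir_commute[OF open_U smooth_P xU], rule ddir_commute[OF open_U smooth_\<sigma> xU])
    have "B x ?p (B x v ?p) - ddir v (\<lambda>y. B y ?p ?p) x = B x v (B x ?p ?p) - ddir ?p (\<lambda>y. B y v ?p) x"
      using comm(1) unfolding sec comm(2) DP[OF x] by (simp add: B_diff B_scale algebra_simps)
    then have "ddir v (\<lambda>y. B y ?p ?p) x - ddir ?p (\<lambda>y. B y ?p v) x + B x v (B x ?p ?p) - B x ?p (B x v ?p) = 0"
      unfolding d by (simp add: algebra_simps)
    moreover have "B x (B x ?p ?p) v = B x v (B x ?p ?p)" "B x (B x ?p v) ?p = B x ?p (B x v ?p)"
      using B_sym[OF xU, of "B x ?p ?p" v] B_sym[OF xU, of "B x ?p v" ?p] B_sym[OF xU, of ?p v] by simp_all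
    ultimately show ?thesis unfolding riem_eq[OF z q] fst_conv by simp
  qed
  show ?thesis unfolding flag_curv_loc_def riem metric_eq by simp
qed

end

section \<open>The global argument\<close>

locale berwald_circle_manifold = circle_preserving \<A> F \<sigma>
  for \<A> :: "('m::topological_space, 'n::finite) chart set" and F and \<sigma> +
  assumes berwald: "berwaldian \<A> F" and dim: "CARD('n) \<ge> 2" and connected: "connected (UNIV :: 'm set)"
begin

lemma patch:
  assumes a: "a \<in> \<A>"
  shows "berwald_circle_patch (chart_img a) (rep a) (\<sigma> \<circ> chart_inv a)"
proof (intro berwald_circle_patch.intro berwald_patch.intro finsler_patch circle_patch a berwald_patch_axioms.intro dim)
  show "Gam (rep a) k i j (x, y) = Gam (rep a) k i j (x, y')"
    if "x \<in> chart_img a" "y \<noteq> 0" "y' \<noteq> 0" for x y y' k i j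
    using berwald a that unfolding berwaldian_def by blast
qed

lemma berwald_patch: "a \<in> \<A> \<Longrightarrow> berwald_patch (chart_img a) (rep a)"
  using patch berwald_circle_patch.axioms(1) by blast

text \<open>Connectedness, for properties that are read off in a chart but do not depend on it.\<close>

lemma locally_determined_cases:
  assumes open_in_chart: "\<And>a. a \<in> \<A> \<Longrightarrow> open {x \<in> chart_img a. R a x} \<and> open {x \<in> chart_img a. \<not> R a x}"
    and change: "\<And>a b p. a \<in> \<A> \<Longrightarrow> b \<in> \<A> \<Longrightarrow> p \<in> chart_dom a \<Longrightarrow> p \<in> chart_dom b \<Longrightarrow>
      R a (chart_map a p) \<Longrightarrow> R b (chart_map b p)"
  shows "(\<forall>a\<in>\<A>. \<forall>x\<in>chart_img a. R a x) \<or> (\<forall>a\<in>\<A>. \<forall>x\<in>chart_img a. \<not> R a x)"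
proof -
  have op: "open (\<Union>a\<in>\<A>. {p \<in> chart_dom a. T a (chart_map a p)})"
    if "\<And>a. a \<in> \<A> \<Longrightarrow> open {x \<in> chart_img a. T a x}" for T
  proof (intro open_UN ballI)
    fix a assume a: "a \<in> \<A>"
    have "open (chart_dom a \<inter> chart_map a -` {x \<in> chart_img a. T a x})"
      by (rule continuous_open_preimage[OF homeomorphism_cont1[OF homeo[OF a]] open_dom[OF a] that[OF a]])
    moreover have "chart_dom a \<inter> chart_map a -` {x \<in> chart_img a. T a x} = {p \<in> chart_dom a. T a (chart_map a p)}"
      using chart_map_img[where a=a] by blast
    ultimately show "open {p \<in> chart_dom a. T a (chart_map a p)}" by simp
  qed
  define X where "X = (\<Union>a\<in>\<A>. {p \<in> chart_dom a. R a (chart_map a p)})"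
  define Y where "Y = (\<Union>a\<in>\<A>. {p \<in> chart_dom a. \<not> R a (chart_map a p)})"
  have "open X" "open Y" unfolding X_def Y_def by (rule op, use open_in_chart in blast)+
  moreover have "X \<inter> Y \<inter> UNIV = {}" unfolding X_def Y_def using change by blast
  moreover have "UNIV \<subseteq> X \<union> Y"
  proof
    fix p
    obtain a where "a \<in> \<A>" "p \<in> chart_dom a" by (rule cover)
    then show "p \<in> X \<union> Y" unfolding X_def Y_def by blast
  qed
  ultimately have "X \<inter> UNIV = {} \<or> Y \<inter> UNIV = {}" by (rule connectedD[OF connected])
  then have "X = {} \<or> Y = {}" by simp
  moreover have "chart_inv a x \<in> (if R a x then X else Y)" if "a \<in> \<A>" "x \<in> chart_img a" for a x
    using chart_inv_dom[OF that] chart_map_inv[OF that] that(1) unfolding X_def Y_def by auto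
  ultimately show ?thesis by (metis empty_iff)
qed

definition quadratic :: "('m, 'n) chart \<Rightarrow> real^'n \<Rightarrow> bool" where
  "quadratic a x \<longleftrightarrow> (\<forall>y y'. y \<noteq> 0 \<longrightarrow> y' \<noteq> 0 \<longrightarrow> fund_tensor (rep a) (x, y) = fund_tensor (rep a) (x, y'))"

text \<open>The Jacobian of a transition maps slit tangent spaces onto each other and does not depend on the
  direction.\<close>

lemma quadratic_change:
  assumes a: "a \<in> \<A>" and b: "b \<in> \<A>" and p: "p \<in> chart_dom a" "p \<in> chart_dom b"
    and q: "quadratic a (chart_map a p)"
  shows "quadratic b (chart_map b p)"
proof -
  interpret cc: chart_change "chart_img a" "rep a" "chart_img b" "rep b" "overlap a b" "transition a b"
    by (rule chart_change[OF a b])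
  let ?x = "chart_map a p"
  have x: "?x \<in> overlap a b" by (rule in_overlap[OF p])
  have tr: "transition a b ?x = chart_map b p" by (rule transition_point[OF a p(1)])
  have lift: "\<exists>y1. y1 \<noteq> 0 \<and> (?x, y1) \<in> cc.WD \<and> cc.\<Theta> (?x, y1) = (chart_map b p, y)" if y: "y \<noteq> 0" for y
  proof -
    obtain y1 where y1: "ddir y1 (transition a b) ?x = y" using cc.J_surj[OF x] by blast
    then have "y1 \<noteq> 0" using y linear_0[OF cc.linear_J[OF x]] by blast
    then show ?thesis using y1 x tr by (auto simp: cc.\<Theta>_def)
  qed
  have "fund_tensor (rep b) (chart_map b p, y) $ i $ j = fund_tensor (rep b) (chart_map b p, y') $ i $ j"
    if y: "y \<noteq> 0" "y' \<noteq> 0" for y y' i j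
  proof -
    obtain y1 where y1: "y1 \<noteq> 0" "(?x, y1) \<in> cc.WD" "cc.\<Theta> (?x, y1) = (chart_map b p, y)" using lift[OF y(1)] by blast
    obtain y2 where y2: "y2 \<noteq> 0" "(?x, y2) \<in> cc.WD" "cc.\<Theta> (?x, y2) = (chart_map b p, y')" using lift[OF y(2)] by blast
    obtain u v where uv: "ddir u (transition a b) ?x = axis i 1" "ddir v (transition a b) ?x = axis j 1"
      using cc.J_surj[OF x] by blast
    have g12: "fund_tensor (rep a) (?x, y1) = fund_tensor (rep a) (?x, y2)" using q y1(1) y2(1) unfolding quadratic_def by blast
    have "axis i 1 \<bullet> (fund_tensor (rep b) (chart_map b p, y) *v axis j 1)
        = axis i 1 \<bullet> (fund_tensor (rep b) (chart_map b p, y') *v axis j 1)"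
      using cc.g_change[OF y1(2), of u v] cc.g_change[OF y2(2), of u v] unfolding y1(3) y2(3) g12 by (simp add: uv)
    then show ?thesis by (simp add: matrix_vector_mult_basis column_def inner_axis')
  qed
  then show ?thesis unfolding quadratic_def vec_eq_iff by blast
qed

lemma quadratic_cases:
  "(\<forall>a\<in>\<A>. \<forall>x\<in>chart_img a. quadratic a x) \<or> (\<forall>a\<in>\<A>. \<forall>x\<in>chart_img a. \<not> quadratic a x)"
proof (rule locally_determined_cases)
  fix a assume a: "a \<in> \<A>"
  interpret p: berwald_patch "chart_img a" "rep a" by (rule berwald_patch[OF a])
  have "quadratic a = p.quadratic_at" by (simp add: fun_eq_iff quadratic_def p.quadratic_at_def)
  then show "open {x \<in> chart_img a. quadratic a x} \<and> open {x \<in> chart_img a. \<not> quadratic a x}"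
    using p.open_quadratic p.open_not_quadratic by simp
qed (rule quadratic_change)

definition critical :: "('m, 'n) chart \<Rightarrow> real^'n \<Rightarrow> bool" where
  "critical a x \<longleftrightarrow> (\<forall>v. ddir v (\<sigma> \<circ> chart_inv a) x = 0)"

lemma diff_factor: "a \<in> \<A> \<Longrightarrow> x \<in> chart_img a \<Longrightarrow> (\<sigma> \<circ> chart_inv a) differentiable (at x)"
  by (rule smooth_on_differentiable[OF smooth_factor])

lemma critical_change:
  assumes a: "a \<in> \<A>" and b: "b \<in> \<A>" and p: "p \<in> chart_dom a" "p \<in> chart_dom b"
    and crit: "critical a (chart_map a p)"
  shows "critical b (chart_map b p)"
  unfolding critical_def
proof
  fix v
  let ?x = "chart_map b p"
  have x: "?x \<in> overlap b a" by (rule in_overlap[OF p(2,1)])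
  have tr: "transition b a ?x = chart_map a p" by (rule transition_point[OF b p(2)])
  have "ddir v (\<sigma> \<circ> chart_inv b) ?x = ddir v (\<lambda>x. (\<sigma> \<circ> chart_inv a) (transition b a x)) ?x"
    by (rule ddir_cong[OF open_overlap[OF b a] x]) (simp add: chart_inv_transition[OF b a])
  also have "\<dots> = ddir (ddir v (transition b a) ?x) (\<sigma> \<circ> chart_inv a) (transition b a ?x)"
    by (rule ddir_eq[OF has_derivative_compose[OF has_derivative_ddir[OF diff_transition[OF b a x]]
            has_derivative_ddir[OF diff_factor[OF a transition_in[OF b a x]]]]])
  also have "\<dots> = 0" using crit unfolding tr critical_def by blast
  finally show "ddir v (\<sigma> \<circ> chart_inv b) ?x = 0" .
qed

lemma noncritical_exists:
  assumes "nontrivial \<sigma>"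
  shows "\<exists>a\<in>\<A>. \<exists>x\<in>chart_img a. \<not> critical a x"
proof (rule ccontr)
  assume "\<not> ?thesis"
  then have crit: "\<And>a x. a \<in> \<A> \<Longrightarrow> x \<in> chart_img a \<Longrightarrow> critical a x" by blast
  obtain p0 :: 'm where True by blast
  have loc: "\<exists>e>0. ball x e \<subseteq> {w \<in> chart_img a. \<sigma> (chart_inv a w) = \<sigma> (chart_inv a x)}"
    if a: "a \<in> \<A>" and x: "x \<in> chart_img a" for a x
  proof -
    obtain e where e: "e > 0" "ball x e \<subseteq> chart_img a" using open_img[OF a] x open_contains_ball by blast
    have "((\<sigma> \<circ> chart_inv a) has_derivative (\<lambda>v. 0)) (at w)" if "w \<in> ball x e" for w
      using has_derivative_ddir[OF diff_factor[OF a, of w]] crit[OF a, of w] e that unfolding critical_def by auto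
    then have const: "(\<sigma> \<circ> chart_inv a) w = (\<sigma> \<circ> chart_inv a) x" if "w \<in> ball x e" for w
      using has_derivative_zero_unique_connected[OF open_ball connected_ball, of x e "\<sigma> \<circ> chart_inv a" w x] that e(1)
      by simp
    have "ball x e \<subseteq> {w \<in> chart_img a. \<sigma> (chart_inv a w) = \<sigma> (chart_inv a x)}"
    proof
      fix w assume w: "w \<in> ball x e"
      then show "w \<in> {w \<in> chart_img a. \<sigma> (chart_inv a w) = \<sigma> (chart_inv a x)}"
        using const[OF w] e(2) by auto
    qed
    then show ?thesis using e(1) by blast
  qed
  have op: "open {x \<in> chart_img a. T (\<sigma> (chart_inv a x))}" if a: "a \<in> \<A>" for a T
  proof (rule openI)
    fix x assume x: "x \<in> {x \<in> chart_img a. T (\<sigma> (chart_inv a x))}"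
    then have xa: "x \<in> chart_img a" and Tx: "T (\<sigma> (chart_inv a x))" by auto
    obtain e where e: "e > 0" "ball x e \<subseteq> {w \<in> chart_img a. \<sigma> (chart_inv a w) = \<sigma> (chart_inv a x)}"
      using loc[OF a xa] by blast
    have "ball x e \<subseteq> {x \<in> chart_img a. T (\<sigma> (chart_inv a x))}"
    proof
      fix w assume "w \<in> ball x e"
      then have "w \<in> chart_img a" "\<sigma> (chart_inv a w) = \<sigma> (chart_inv a x)" using e(2) by auto
      then show "w \<in> {x \<in> chart_img a. T (\<sigma> (chart_inv a x))}" using Tx by simp
    qed
    then show "\<exists>e>0. ball x e \<subseteq> {x \<in> chart_img a. T (\<sigma> (chart_inv a x))}" using e(1) by blast
  qed
  have cases: "(\<forall>a\<in>\<A>. \<forall>x\<in>chart_img a. \<sigma> (chart_inv a x) = \<sigma> p0) \<or> (\<forall>a\<in>\<A>. \<forall>x\<in>chart_img a. \<sigma> (chart_inv a x) \<noteq> \<sigma> p0)"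
    by (rule locally_determined_cases) (use op chart_inv_map in auto)
  have val: "\<exists>a\<in>\<A>. \<exists>x\<in>chart_img a. chart_inv a x = p" for p
  proof -
    obtain a where a: "a \<in> \<A>" "p \<in> chart_dom a" by (rule cover)
    show ?thesis
      by (rule bexI[OF _ a(1)], rule bexI[OF _ chart_map_img[OF a(2)]], rule chart_inv_map[OF a])
  qed
  have "\<sigma> p = \<sigma> p0" for p
  proof -
    obtain a x where 1: "a \<in> \<A>" "x \<in> chart_img a" "chart_inv a x = p" using val[of p] by blast
    obtain b y where 2: "b \<in> \<A>" "y \<in> chart_img b" "chart_inv b y = p0" using val[of p0] by blast
    show ?thesis using cases 1 2 by blast
  qed
  then show False using assms unfolding nontrivial_def by blast
qed

lemma independent_vector:
  obtains v :: "real^'n" where "\<And>r s. r *\<^sub>R v + s *\<^sub>R w = 0 \<Longrightarrow> r = 0"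
proof -
  have "\<not> UNIV \<subseteq> span {w}"
  proof
    assume "UNIV \<subseteq> span {w}"
    then have "dim (UNIV :: (real^'n) set) \<le> card {w}" by (rule dim_le_card) simp
    then show False using dim by simp
  qed
  then obtain v where v: "v \<notin> span {w}" by blast
  have "r = 0" if "r *\<^sub>R v + s *\<^sub>R w = 0" for r s
  proof (rule ccontr)
    assume r: "r \<noteq> 0"
    have "r *\<^sub>R v = - s *\<^sub>R w" using that by (simp add: eq_neg_iff_add_eq_0)
    then have "(1 / r) *\<^sub>R (r *\<^sub>R v) = (1 / r) *\<^sub>R (- s *\<^sub>R w)" by simp
    then have "v = (- s / r) *\<^sub>R w" using r by simp
    moreover have "(- s / r) *\<^sub>R w \<in> span {w}" by (intro span_mul span_base) simp
    ultimately show False using v by metis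
  qed
  then show thesis using that by blast
qed

lemma noncritical_zero_flag:
  assumes nq: "\<And>a x. a \<in> \<A> \<Longrightarrow> x \<in> chart_img a \<Longrightarrow> \<not> quadratic a x"
    and p: "a \<in> \<A>" "p \<in> chart_dom a" "\<not> critical a (chart_map a p)"
  shows "p \<in> zero_flag_set \<A> F"
proof -
  define b where "b = (SOME b. b \<in> \<A> \<and> p \<in> chart_dom b)"
  have b: "b \<in> \<A>" "p \<in> chart_dom b" unfolding b_def using someI[of "\<lambda>b. b \<in> \<A> \<and> p \<in> chart_dom b" a] p by auto
  interpret c: berwald_circle_patch "chart_img b" "rep b" "\<sigma> \<circ> chart_inv b" by (rule patch[OF b(1)])
  let ?x = "chart_map b p"
  have x: "?x \<in> chart_img b" by (rule chart_map_img[OF b(2)])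
  have "\<not> critical b ?x" using critical_change[OF b(1) p(1) b(2) p(2)] p(3) by blast
  then obtain w where "c.ds ?x w \<noteq> 0" unfolding critical_def c.ds_def by blast
  then have P: "c.P ?x \<noteq> 0" using c.g_P[of ?x 1 w] x by auto
  have hess: "c.hess x u = 0" if "x \<in> chart_img b" for x u
    using c.hess_nonzero_quadratic[OF that, of u] nq[OF b(1) that]
    unfolding quadratic_def c.quadratic_at_def by blast
  obtain v where v: "\<And>r s. r *\<^sub>R v + s *\<^sub>R c.P ?x = 0 \<Longrightarrow> r = 0" using independent_vector by blast
  have v0: "v \<noteq> 0" using v[of 1 0] by auto
  let ?v = "tvec_of \<A> b p v" and ?w = "tvec_of \<A> b p (c.P ?x)"
  have "lin_indep2 ?v ?w"
    unfolding lin_indep2_def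
  proof (intro allI impI)
    fix r s assume "\<forall>a. r *\<^sub>R ?v a + s *\<^sub>R ?w a = 0"
    then have "r *\<^sub>R ?v b + s *\<^sub>R ?w b = 0" by blast
    then have "r *\<^sub>R v + s *\<^sub>R c.P ?x = 0" by (simp add: tvec_of_self[OF b])
    then show "r = 0 \<and> s = 0" using v[of r s] P by auto
  qed
  moreover have "flag_curvature \<A> F p ?v ?w = 0"
    unfolding flag_curvature_def Let_def b_def[symmetric] tvec_of_self[OF b]
    by (rule c.zero_flag[OF open_img[OF b(1)] subset_refl hess x v0])
  ultimately show ?thesis
    unfolding zero_flag_set_def using tvec_of_tangent[OF b] by blast
qed

lemma riemannian_if_nontrivial:
  assumes nd: "nowhere_dense (zero_flag_set \<A> F)" and nt: "nontrivial \<sigma>"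
  shows "riemannian \<A> F"
proof -
  have "\<forall>a\<in>\<A>. \<forall>x\<in>chart_img a. quadratic a x"
  proof (rule ccontr)
    assume "\<not> ?thesis"
    then have nq: "\<And>a x. a \<in> \<A> \<Longrightarrow> x \<in> chart_img a \<Longrightarrow> \<not> quadratic a x" using quadratic_cases by blast
    obtain a x where a: "a \<in> \<A>" and x: "x \<in> chart_img a" "\<not> critical a x" using noncritical_exists[OF nt] by blast
    then obtain v where v: "ddir v (\<sigma> \<circ> chart_inv a) x \<noteq> 0" unfolding critical_def by blast
    let ?d = "\<lambda>x. ddir v (\<sigma> \<circ> chart_inv a) x"
    define X where "X = chart_dom a \<inter> chart_map a -` (chart_img a \<inter> ?d -` (- {0}))"
    have "open (chart_img a \<inter> ?d -` (- {0}))"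
      by (rule continuous_open_preimage[OF smooth_on_continuous[OF smooth_on_ddir[OF smooth_factor[OF a]]] open_img[OF a]])
        (intro open_Compl closed_singleton)
    then have "open X"
      unfolding X_def by (rule continuous_open_preimage[OF homeomorphism_cont1[OF homeo[OF a]] open_dom[OF a]])
    moreover have "X \<subseteq> zero_flag_set \<A> F"
    proof
      fix p assume "p \<in> X"
      then have p: "p \<in> chart_dom a" "\<not> critical a (chart_map a p)" unfolding X_def critical_def by auto
      show "p \<in> zero_flag_set \<A> F" by (rule noncritical_zero_flag[OF _ a p]) (rule nq)
    qed
    ultimately have "X \<subseteq> interior (closure (zero_flag_set \<A> F))"
      by (meson closure_subset interior_maximal order_trans)
    moreover have "chart_inv a x \<in> X"
      using x v chart_inv_dom[OF a x(1)] chart_map_inv[OF a x(1)] by (simp add: X_def)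
    ultimately show False using nd unfolding nowhere_dense_def by blast
  qed
  then show ?thesis unfolding riemannian_def quadratic_def by blast
qed

end

theorem mainTheorem1:
  fixes \<A> :: "('m::{t2_space, second_countable_topology}, 'n::finite) chart set"
    and F :: "('m, 'n) finsler_fun"
    and \<sigma> :: "'m \<Rightarrow> real"
  assumes "smooth_atlas \<A>"
    and "connected (UNIV :: 'm set)"
    and "CARD('n) \<ge> 2"
    and "finsler_structure \<A> F"
    and "geodesically_complete \<A> F"
    and "berwaldian \<A> F"
    and "nowhere_dense (zero_flag_set \<A> F)"
    and "conformal_circle_preserving \<A> F \<sigma>"
    and "nontrivial \<sigma>"
  shows "riemannian \<A> F"
proof -
  interpret berwald_circle_manifold \<A> F \<sigma>
    by unfold_locales (fact assms)+
  show ?thesis by (rule riemannian_if_nontrivial[OF assms(7,9)])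
qed

end
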